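(* Let $\Gamma$ be a generalized quadrangle and $\mathcal{O}$ a set of regular points of $\Gamma$ satisfying (PP) and (TP). Then all points of $\mathcal{O}$ are projective, and for every $p\in\mathcal{O}$ the perp-plane $\Gamma_p$ is a Moufang projective plane; in particular the dual net $\Gamma^*_p$ associated to $p$ satisfies (LD).
   Context: A generalized quadrangle is a triple $(\mathcal{P},\mathcal{L},\mathtt{I})$ of disjoint point/line sets with symmetric incidence such that no two distinct points lie on two distinct common lines, every element is incident with at least three elements, and for every point $x$ and line $M$ not through $x$ there are a unique point $y$ and line $N$ with $x\,\mathtt{I}\,N\,\mathtt{I}\,y\,\mathtt{I}\,M$. Collinear/opposite points as usual; $x^\perp$: points collinear with $x$ including $x$; $X^\perp=\bigcap_{x\in X}x^\perp$. A point $x$ is regular if for every $y$ opposite $x$, $\{x,y\}^{\perp\perp}=\{u,v\}^\perp$ for some opposite $u,v$. For a regular point $x$ the dual net $\Gamma_x^*$ has points $x^\perp\setminus\{x\}$ and blocks $\{x,y\}^\perp$ ($y$ opposite $x$); $x$ is projective if $\Gamma^*_x$ is a dual affine plane (any two distinct blocks meet), and then the perp-plane $\Gamma_x$ is the projective plane with point set $x^\perp$ and blocks $\{x,y\}^\perp$, $y\in\mathcal{P}\setminus\{x\}$. (PP): at least one element of $\mathcal{O}$ is projective. (TP): for all opposite points $x,y$, $|\{x,y\}^\perp\cap\mathcal{O}|\neq1$. In $\Gamma^*_x$, distinct points not in a common block are parallel; the classes of "equal or parallel" are vertical lines; a new point $\infty$ is adjoined on all vertical lines. A triangle is three distinct blocks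 pairwise meeting in three distinct points; two triangles are in perspective from $\infty$ if three distinct vertical lines each contain one vertex of each, inducing a correspondence of sides. (LD): for every pair of triangles in perspective from $\infty$ for which two pairs of corresponding sides meet on one vertical line $V$, the third pair also meets on $V$.
   Formalization: In (LD), the formal statement requires corresponding vertices of the two triangles in perspective from ∞ to be distinct; with a coincident pair of vertices the condition as literally worded fails already in the symplectic quadrangle of order 3. *)

theory Defs
  imports Main
begin

section \<open>Generalized quadrangles\<close>

text \<open>Points and lines have different types, so the two sets are disjoint and one relation
  between points and lines represents the symmetric incidence.\<close>

record ('p, 'l) geometry =
  Points :: "'p set"
  Lines :: "'l set"
  Inc :: "'p \<Rightarrow> 'l \<Rightarrow> bool"

text \<open>The sets may be infinite, hence ``at least three'' is not expressed by \<^const>\<open>card\<close>.\<close>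

locale generalized_quadrangle =
  fixes \<Gamma> :: "('p, 'l) geometry"
  assumes Inc_carrier: "Inc \<Gamma> x M \<Longrightarrow> x \<in> Points \<Gamma> \<and> M \<in> Lines \<Gamma>"
    and linear: "\<lbrakk>x \<noteq> y; Inc \<Gamma> x M; Inc \<Gamma> y M; Inc \<Gamma> x N; Inc \<Gamma> y N\<rbrakk> \<Longrightarrow> M = N"
    and thick_point: "x \<in> Points \<Gamma> \<Longrightarrow>
      \<exists>M1 M2 M3. distinct [M1, M2, M3] \<and> Inc \<Gamma> x M1 \<and> Inc \<Gamma> x M2 \<and> Inc \<Gamma> x M3"
    and thick_line: "M \<in> Lines \<Gamma> \<Longrightarrow>
      \<exists>x1 x2 x3. distinct [x1, x2, x3] \<and> Inc \<Gamma> x1 M \<and> Inc \<Gamma> x2 M \<and> Inc \<Gamma> x3 M"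
    and project: "\<lbrakk>x \<in> Points \<Gamma>; M \<in> Lines \<Gamma>; \<not> Inc \<Gamma> x M\<rbrakk> \<Longrightarrow>
      \<exists>!(y, N). Inc \<Gamma> x N \<and> Inc \<Gamma> y N \<and> Inc \<Gamma> y M"

definition collinear :: "('p, 'l) geometry \<Rightarrow> 'p \<Rightarrow> 'p \<Rightarrow> bool" where
  "collinear \<Gamma> x y \<longleftrightarrow> (\<exists>M. Inc \<Gamma> x M \<and> Inc \<Gamma> y M)"

definition opposite :: "('p, 'l) geometry \<Rightarrow> 'p \<Rightarrow> 'p \<Rightarrow> bool" where
  "opposite \<Gamma> x y \<longleftrightarrow> x \<in> Points \<Gamma> \<and> y \<in> Points \<Gamma> \<and> x \<noteq> y \<and> \<not> collinear \<Gamma> x y"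

definition pperp :: "('p, 'l) geometry \<Rightarrow> 'p \<Rightarrow> 'p set" where
  "pperp \<Gamma> x = {y \<in> Points \<Gamma>. y = x \<or> collinear \<Gamma> x y}"

definition perp :: "('p, 'l) geometry \<Rightarrow> 'p set \<Rightarrow> 'p set" where
  "perp \<Gamma> X = {z \<in> Points \<Gamma>. \<forall>x\<in>X. z \<in> pperp \<Gamma> x}"

definition regular_point :: "('p, 'l) geometry \<Rightarrow> 'p \<Rightarrow> bool" where
  "regular_point \<Gamma> x \<longleftrightarrow> x \<in> Points \<Gamma> \<and>
     (\<forall>y. opposite \<Gamma> x y \<longrightarrow>
        (\<exists>u v. opposite \<Gamma> u v \<and> perp \<Gamma> (perp \<Gamma> {x, y}) = perp \<Gamma> {u, v}))"


section \<open>Dual nets and condition (LD)\<close>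

text \<open>From here on, a geometry is a set \<open>X\<close> of points with a set \<open>\<B>\<close> of blocks, each block being
  the set of its points.\<close>

definition joined :: "'p set set \<Rightarrow> 'p \<Rightarrow> 'p \<Rightarrow> bool" where
  "joined \<B> a b \<longleftrightarrow> (\<exists>B\<in>\<B>. a \<in> B \<and> b \<in> B)"

text \<open>The third condition dualizes the parallel axiom of a net; the last three exclude
  degenerate structures.\<close>

definition dual_net :: "'p set \<Rightarrow> 'p set set \<Rightarrow> bool" where
  "dual_net X \<B> \<longleftrightarrow>
     (\<forall>B\<in>\<B>. B \<subseteq> X) \<and>
     (\<forall>B\<in>\<B>. \<forall>C\<in>\<B>. \<forall>a\<in>B \<inter> C. \<forall>b\<in>B \<inter> C. B \<noteq> C \<longrightarrow> a = b) \<and>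
     (\<forall>a\<in>X. \<forall>B\<in>\<B>. a \<notin> B \<longrightarrow> (\<exists>!b. b \<in> B \<and> \<not> joined \<B> a b)) \<and>
     \<B> \<noteq> {} \<and>
     (\<forall>B\<in>\<B>. \<exists>a b c. distinct [a, b, c] \<and> {a, b, c} \<subseteq> B) \<and>
     (\<forall>a\<in>X. \<exists>B\<in>\<B>. \<exists>C\<in>\<B>. B \<noteq> C \<and> a \<in> B \<and> a \<in> C)"

definition dual_affine_plane :: "'p set \<Rightarrow> 'p set set \<Rightarrow> bool" where
  "dual_affine_plane X \<B> \<longleftrightarrow> dual_net X \<B> \<and> (\<forall>B\<in>\<B>. \<forall>C\<in>\<B>. B \<noteq> C \<longrightarrow> B \<inter> C \<noteq> {})"

definition parallel :: "'p set set \<Rightarrow> 'p \<Rightarrow> 'p \<Rightarrow> bool" where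
  "parallel \<B> a b \<longleftrightarrow> a \<noteq> b \<and> \<not> joined \<B> a b"

text \<open>The point \<open>\<infinity>\<close> adjoined to all vertical lines lies on no block; it therefore does not affect
  where sides of triangles meet, and it is not represented.\<close>

definition vertical_lines :: "'p set \<Rightarrow> 'p set set \<Rightarrow> 'p set set" where
  "vertical_lines X \<B> = X // {(a, b). a \<in> X \<and> b \<in> X \<and> (a = b \<or> parallel \<B> a b)}"

text \<open>\<open>A1, A2, A3\<close> are the sides, and \<open>ai\<close> is the vertex not on the side \<open>Ai\<close>.\<close>

definition triangle ::
    "'p set set \<Rightarrow> 'p set \<Rightarrow> 'p set \<Rightarrow> 'p set \<Rightarrow> 'p \<Rightarrow> 'p \<Rightarrow> 'p \<Rightarrow> bool" where
  "triangle \<B> A1 A2 A3 a1 a2 a3 \<longleftrightarrow>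
     {A1, A2, A3} \<subseteq> \<B> \<and> distinct [A1, A2, A3] \<and>
     A2 \<inter> A3 = {a1} \<and> A3 \<inter> A1 = {a2} \<and> A1 \<inter> A2 = {a3} \<and> distinct [a1, a2, a3]"

text \<open>As usual in configurations of Desargues type, corresponding vertices are distinct: if
  \<open>a3 = b3\<close>, then the sides \<open>A1, B1\<close> and \<open>A2, B2\<close> meet in this common vertex, which says nothing
  about \<open>A3\<close> and \<open>B3\<close>.  Since a block meets a vertical line at most once, corresponding sides are
  then distinct as well.\<close>

definition in_perspective_from_infinity ::
    "'p set \<Rightarrow> 'p set set \<Rightarrow> 'p \<Rightarrow> 'p \<Rightarrow> 'p \<Rightarrow> 'p \<Rightarrow> 'p \<Rightarrow> 'p \<Rightarrow> bool" where
  "in_perspective_from_infinity X \<B> a1 a2 a3 b1 b2 b3 \<longleftrightarrow>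
     (\<exists>V1 V2 V3. {V1, V2, V3} \<subseteq> vertical_lines X \<B> \<and> distinct [V1, V2, V3] \<and>
        {a1, b1} \<subseteq> V1 \<and> {a2, b2} \<subseteq> V2 \<and> {a3, b3} \<subseteq> V3 \<and>
        a1 \<noteq> b1 \<and> a2 \<noteq> b2 \<and> a3 \<noteq> b3)"

definition LD :: "'p set \<Rightarrow> 'p set set \<Rightarrow> bool" where
  "LD X \<B> \<longleftrightarrow>
     (\<forall>A1 A2 A3 a1 a2 a3 B1 B2 B3 b1 b2 b3. \<forall>V\<in>vertical_lines X \<B>.
        triangle \<B> A1 A2 A3 a1 a2 a3 \<longrightarrow>
        triangle \<B> B1 B2 B3 b1 b2 b3 \<longrightarrow>
        in_perspective_from_infinity X \<B> a1 a2 a3 b1 b2 b3 \<longrightarrow>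
        A1 \<inter> B1 \<inter> V \<noteq> {} \<longrightarrow> A2 \<inter> B2 \<inter> V \<noteq> {} \<longrightarrow> A3 \<inter> B3 \<inter> V \<noteq> {})"


section \<open>Moufang projective planes\<close>

definition projective_plane :: "'p set \<Rightarrow> 'p set set \<Rightarrow> bool" where
  "projective_plane X \<B> \<longleftrightarrow>
     (\<forall>B\<in>\<B>. B \<subseteq> X) \<and>
     (\<forall>a\<in>X. \<forall>b\<in>X. a \<noteq> b \<longrightarrow> (\<exists>!B. B \<in> \<B> \<and> a \<in> B \<and> b \<in> B)) \<and>
     (\<forall>B\<in>\<B>. \<forall>C\<in>\<B>. B \<noteq> C \<longrightarrow> (\<exists>!a. a \<in> B \<and> a \<in> C)) \<and>
     (\<exists>a b c d. {a, b, c, d} \<subseteq> X \<and> distinct [a, b, c, d] \<and>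
        (\<forall>B\<in>\<B>. \<not> {a, b, c} \<subseteq> B \<and> \<not> {a, b, d} \<subseteq> B \<and> \<not> {a, c, d} \<subseteq> B \<and> \<not> {b, c, d} \<subseteq> B))"

definition collineation :: "'p set \<Rightarrow> 'p set set \<Rightarrow> ('p \<Rightarrow> 'p) \<Rightarrow> bool" where
  "collineation X \<B> f \<longleftrightarrow> bij_betw f X X \<and> bij_betw ((`) f) \<B> \<B>"

definition central_collineation ::
    "'p set \<Rightarrow> 'p set set \<Rightarrow> 'p \<Rightarrow> 'p set \<Rightarrow> ('p \<Rightarrow> 'p) \<Rightarrow> bool" where
  "central_collineation X \<B> c A f \<longleftrightarrow>
     collineation X \<B> f \<and> (\<forall>a\<in>A. f a = a) \<and> (\<forall>B\<in>\<B>. c \<in> B \<longrightarrow> f ` B = B)"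

text \<open>A plane is Moufang if every line \<open>A\<close> is a translation line, that is, the plane is
  \<open>(c, A)\<close>-transitive for every point \<open>c\<close> on \<open>A\<close>.\<close>

definition center_axis_transitive :: "'p set \<Rightarrow> 'p set set \<Rightarrow> 'p \<Rightarrow> 'p set \<Rightarrow> bool" where
  "center_axis_transitive X \<B> c A \<longleftrightarrow>
     (\<forall>B\<in>\<B>. \<forall>a\<in>B. \<forall>b\<in>B. c \<in> B \<longrightarrow> B \<noteq> A \<longrightarrow> a \<notin> insert c A \<longrightarrow> b \<notin> insert c A \<longrightarrow>
        (\<exists>f. central_collineation X \<B> c A f \<and> f a = b))"

definition translation_line :: "'p set \<Rightarrow> 'p set set \<Rightarrow> 'p set \<Rightarrow> bool" where
  "translation_line X \<B> A \<longleftrightarrow> (\<forall>c\<in>A. center_axis_transitive X \<B> c A)"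

definition moufang_plane :: "'p set \<Rightarrow> 'p set set \<Rightarrow> bool" where
  "moufang_plane X \<B> \<longleftrightarrow> projective_plane X \<B> \<and> (\<forall>A\<in>\<B>. translation_line X \<B> A)"


section \<open>The dual net and the perp-plane of a point\<close>

definition dual_net_points :: "('p, 'l) geometry \<Rightarrow> 'p \<Rightarrow> 'p set" where
  "dual_net_points \<Gamma> x = pperp \<Gamma> x - {x}"

definition dual_net_blocks :: "('p, 'l) geometry \<Rightarrow> 'p \<Rightarrow> 'p set set" where
  "dual_net_blocks \<Gamma> x = {perp \<Gamma> {x, y} | y. opposite \<Gamma> x y}"

definition projective_point :: "('p, 'l) geometry \<Rightarrow> 'p \<Rightarrow> bool" where
  "projective_point \<Gamma> x \<longleftrightarrow>
     regular_point \<Gamma> x \<and> dual_affine_plane (dual_net_points \<Gamma> x) (dual_net_blocks \<Gamma> x)"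

definition perp_plane_points :: "('p, 'l) geometry \<Rightarrow> 'p \<Rightarrow> 'p set" where
  "perp_plane_points \<Gamma> x = pperp \<Gamma> x"

definition perp_plane_blocks :: "('p, 'l) geometry \<Rightarrow> 'p \<Rightarrow> 'p set set" where
  "perp_plane_blocks \<Gamma> x = {perp \<Gamma> {x, y} | y. y \<in> Points \<Gamma> - {x}}"


section \<open>Conditions on a set of points\<close>

definition PP :: "('p, 'l) geometry \<Rightarrow> 'p set \<Rightarrow> bool" where
  "PP \<Gamma> \<O> \<longleftrightarrow> (\<exists>p\<in>\<O>. projective_point \<Gamma> p)"

definition TP :: "('p, 'l) geometry \<Rightarrow> 'p set \<Rightarrow> bool" where
  "TP \<Gamma> \<O> \<longleftrightarrow> (\<forall>x y. opposite \<Gamma> x y \<longrightarrow> card (perp \<Gamma> {x, y} \<inter> \<O>) \<noteq> 1)"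

end

theory Submission
  imports Defs
begin

text \<open>
  Collinearity has a grid rule at a regular point: if two families of three points are collinear
  crosswise except for one pair, and a regular point occurs in them, then the last pair is collinear
  too.  If moreover the regular point \<open>p\<close> is projective, then \<open>{p, w, g}\<^sup>\<bottom>\<close> is never empty.  For \<open>q\<close>
  opposite \<open>p\<close>, sending a point \<open>u\<close> of \<open>q\<^sup>\<bottom>\<close> to the block \<open>{p, u}\<^sup>\<bottom>\<close> identifies \<open>q\<^sup>\<bottom>\<close> with the dual of the
  perp-plane of \<open>p\<close>; hence \<open>q\<close> is projective if it is regular, and this spreads over the given set.

  The little theorem of Desargues with centre \<open>p\<close> and axis through \<open>p\<close> is proved by writing the
  configuration as a plane section of a complete 5-point in space, every line of which lies in the
  plane \<open>y\<^sup>\<bottom>\<close> of some point \<open>y\<close> of the given set.  Up to position there are four degrees of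
  freedom for such a 5-point, and they suffice to put the planes through four of the six sides into the
  given set.  This works unless these planes have a common point \<open>e\<close>; then all six sides are
  represented by points of \<open>e\<^sup>\<bottom>\<close>, and a second lift, over \<open>e\<^sup>\<bottom>\<close> instead of \<open>p\<^sup>\<bottom>\<close>, closes the configuration.

  Consequently the perp-plane of \<open>p\<close> is \<open>(p, L)\<close>-transitive for all \<open>L\<close> through \<open>p\<close>.  Dually,
  \<open>{p, q}\<^sup>\<bottom>\<close> is a translation line of the perp-plane of \<open>q\<close>, and every block not through \<open>q\<close> has this form;
  the lines through \<open>q\<close> are images of such blocks under elations.
\<close>


section \<open>Elations from the little theorem of Desargues\<close>

lemma center_axis_transitiveD:
  assumes "center_axis_transitive X \<B> c A" "B \<in> \<B>" "a \<in> B" "b \<in> B" "c \<in> B" "B \<noteq> A"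
    "a \<notin> insert c A" "b \<notin> insert c A"
  shows "\<exists>f. central_collineation X \<B> c A f \<and> f a = b"
  using assms(1)[unfolded center_axis_transitive_def, rule_format, OF assms(2,3,4,5,6,7,8)] .

section \<open>Projective planes with at least three points on every block\<close>

locale thick_plane =
  fixes X :: "'a set" and \<B> :: "'a set set"
  assumes plane: "projective_plane X \<B>"
    and three_points: "B \<in> \<B> \<Longrightarrow> \<exists>x y z. distinct [x, y, z] \<and> {x, y, z} \<subseteq> B"
begin

lemma block_subset: "B \<in> \<B> \<Longrightarrow> a \<in> B \<Longrightarrow> a \<in> X"
  using conjunct1[OF plane[unfolded projective_plane_def]] by blast

lemma block_eq:
  assumes "B \<in> \<B>" "C \<in> \<B>" "a \<in> B" "b \<in> B" "a \<in> C" "b \<in> C" "a \<noteq> b"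
  shows "B = C"
proof -
  have "\<forall>a\<in>X. \<forall>b\<in>X. a \<noteq> b \<longrightarrow> (\<exists>!B. B \<in> \<B> \<and> a \<in> B \<and> b \<in> B)"
    using plane by (simp add: projective_plane_def)
  then have "\<exists>!B. B \<in> \<B> \<and> a \<in> B \<and> b \<in> B" using assms block_subset by blast
  then show ?thesis using assms by blast
qed

lemma join:
  assumes "a \<in> X" "b \<in> X" "a \<noteq> b"
  obtains B where "B \<in> \<B>" "a \<in> B" "b \<in> B"
proof -
  have "\<forall>a\<in>X. \<forall>b\<in>X. a \<noteq> b \<longrightarrow> (\<exists>!B. B \<in> \<B> \<and> a \<in> B \<and> b \<in> B)"
    using plane by (simp add: projective_plane_def)
  then show ?thesis using that assms by blast
qed

lemma meet_blocks:
  assumes "B \<in> \<B>" "C \<in> \<B>" "B \<noteq> C"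
  obtains a where "a \<in> B" "a \<in> C"
proof -
  have "\<forall>B\<in>\<B>. \<forall>C\<in>\<B>. B \<noteq> C \<longrightarrow> (\<exists>!a. a \<in> B \<and> a \<in> C)"
    using plane by (simp add: projective_plane_def)
  then show ?thesis using that assms by blast
qed

end

text \<open>\<open>flag_closes\<close> is the little theorem of Desargues for the flag
  \<open>(p, L)\<close>, stated for proper triangles; collinear triples are treated separately in
  \<open>par_trans\<close>.\<close>

locale little_desargues_flag = thick_plane +
  fixes p and L
  assumes flag: "L \<in> \<B>" "p \<in> L"
    and other_vertical: "\<lbrakk>a \<in> X; a \<notin> L\<rbrakk> \<Longrightarrow>
      \<exists>x\<in>X. x \<notin> L \<and> \<not> (\<exists>V\<in>\<B>. p \<in> V \<and> a \<in> V \<and> x \<in> V)"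
    and flag_closes: "\<lbrakk>V1 \<in> \<B>; V2 \<in> \<B>; V3 \<in> \<B>; distinct [L, V1, V2, V3]; p \<in> V1; p \<in> V2; p \<in> V3;
      {a1, b1} \<subseteq> V1 - {p}; {a2, b2} \<subseteq> V2 - {p}; {a3, b3} \<subseteq> V3 - {p}; a1 \<noteq> b1; a2 \<noteq> b2; a3 \<noteq> b3;
      {A12, A23, A13, B12, B23, B13} \<subseteq> \<B>; \<not> (\<exists>B\<in>\<B>. {a1, a2, a3} \<subseteq> B); \<not> (\<exists>B\<in>\<B>. {b1, b2, b3} \<subseteq> B);
      {a1, a2, i12} \<subseteq> A12; {b1, b2, i12} \<subseteq> B12; {a2, a3, i23} \<subseteq> A23; {b2, b3, i23} \<subseteq> B23;
      {a1, a3, i13} \<subseteq> A13; {b1, b3, i13} \<subseteq> B13; i12 \<in> L; i23 \<in> L\<rbrakk> \<Longrightarrow> i13 \<in> L"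
begin

definition affine :: "'a \<Rightarrow> bool" where
  "affine a \<longleftrightarrow> a \<in> X \<and> a \<notin> L"

definition vert :: "'a \<Rightarrow> 'a \<Rightarrow> bool" where
  "vert a b \<longleftrightarrow> (\<exists>V\<in>\<B>. p \<in> V \<and> a \<in> V \<and> b \<in> V)"

text \<open>With \<open>L\<close> as line at infinity, the lines \<open>ax\<close> and
  \<open>by\<close> are parallel. For vertical pairs \<open>a\<close>, \<open>b\<close> and
  \<open>x\<close>, \<open>y\<close> this is a parallelogram: the translation with centre
  \<open>p\<close> taking \<open>a\<close> to \<open>b\<close> takes \<open>x\<close> to
  \<open>y\<close>.\<close>

definition par :: "'a \<Rightarrow> 'a \<Rightarrow> 'a \<Rightarrow> 'a \<Rightarrow> bool" where
  "par a b x y \<longleftrightarrow> (\<exists>i\<in>L. \<exists>B\<in>\<B>. \<exists>C\<in>\<B>. a \<in> B \<and> x \<in> B \<and> i \<in> B \<and> b \<in> C \<and> y \<in> C \<and> i \<in> C)"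

lemma p_in_X: "p \<in> X"
  using flag block_subset by blast

lemma affine_ne: "affine a \<Longrightarrow> a \<noteq> p"
  using flag by (auto simp: affine_def)

lemma vert_refl: "affine a \<Longrightarrow> vert a a"
  using join[of a p] p_in_X affine_ne by (metis affine_def vert_def)

lemma vert_sym: "vert a b \<Longrightarrow> vert b a"
  by (auto simp: vert_def)

lemma vert_trans:
  assumes "vert a b" "vert b c" "affine b"
  shows "vert a c"
proof -
  obtain V W where V: "V \<in> \<B>" "p \<in> V" "a \<in> V" "b \<in> V" "W \<in> \<B>" "p \<in> W" "b \<in> W" "c \<in> W"
    using assms by (auto simp: vert_def)
  then have "V = W" using block_eq[of V W b p] affine_ne[OF assms(3)] by blast
  then show ?thesis using V by (auto simp: vert_def)
qed

lemma vert_center: "B \<in> \<B> \<Longrightarrow> a \<in> B \<Longrightarrow> b \<in> B \<Longrightarrow> a \<noteq> b \<Longrightarrow> vert a b \<Longrightarrow> p \<in> B"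
  using block_eq by (metis vert_def)

lemma par_sym: "par a b x y \<Longrightarrow> par x y a b"
  by (auto simp: par_def)

lemma par_swap: "par a b x y \<Longrightarrow> par b a y x"
  by (auto simp: par_def)

text \<open>The point \<open>y\<close> is where the vertical line of \<open>x\<close> meets the line
  joining \<open>b\<close> to the point at infinity \<open>i\<close> of \<open>ax\<close>. As
  \<open>ax\<close> is not vertical, \<open>i\<close> differs from \<open>p\<close>.\<close>

lemma par_exists:
  assumes "affine a" "affine b" "affine x" "vert a b" "a \<noteq> b" "\<not> vert a x"
  shows "\<exists>y. affine y \<and> vert x y \<and> y \<noteq> x \<and> par a b x y"
proof -
  have ax: "a \<noteq> x" using assms vert_refl by metis
  obtain B where B: "B \<in> \<B>" "a \<in> B" "x \<in> B" using join ax assms by (metis affine_def)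
  have pB: "p \<notin> B" using B assms by (auto simp: vert_def)
  have BL: "B \<noteq> L" using B assms by (auto simp: affine_def)
  obtain i where i: "i \<in> B" "i \<in> L" using meet_blocks[OF B(1) flag(1) BL] by blast
  have ip: "i \<noteq> p" using i pB by metis
  have bi: "b \<noteq> i" using i assms by (auto simp: affine_def)
  obtain C where C: "C \<in> \<B>" "b \<in> C" "i \<in> C"
    using join[OF _ _ bi] assms block_subset[OF flag(1) i(2)] by (metis affine_def)
  obtain V where V: "V \<in> \<B>" "p \<in> V" "x \<in> V" using vert_refl[OF assms(3)] by (auto simp: vert_def)
  have "C \<noteq> V" using V C assms vert_trans[OF assms(4) _ assms(2)] by (metis vert_def)
  then obtain y where y: "y \<in> C" "y \<in> V" using meet_blocks[OF C(1) V(1)] by blast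
  have CL: "C \<noteq> L" and VL: "V \<noteq> L" using C V assms by (auto simp: affine_def)
  have "y \<notin> L"
  proof
    assume "y \<in> L"
    then have "y = p" using block_eq[of V L y p] V y flag VL by blast
    then have "C = L" using block_eq[of C L p i] C y i ip flag by blast
    then show False using CL by simp
  qed
  moreover have "y \<noteq> x"
  proof
    assume "y = x"
    moreover have "x \<noteq> i" using i assms by (auto simp: affine_def)
    ultimately have "B = C" using block_eq[of B C x i] B C y i by blast
    then show False using vert_center[of B a b] B C assms pB by blast
  qed
  moreover have "par a b x y" using B C i y by (auto simp: par_def)
  ultimately show ?thesis
    using y V block_subset[OF V(1)] unfolding affine_def vert_def by blast
qed

lemma par_unique:
  assumes "affine a" "affine b" "affine x" "affine y" "affine y'" "\<not> vert a x"
    "vert x y" "vert x y'" "par a b x y" "par a b x y'"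
  shows "y = y'"
proof (rule ccontr)
  assume ne: "y \<noteq> y'"
  obtain i B C where i: "i \<in> L" "B \<in> \<B>" "C \<in> \<B>" "a \<in> B" "x \<in> B" "i \<in> B" "b \<in> C" "y \<in> C" "i \<in> C"
    using assms(9) by (auto simp: par_def)
  obtain i' B' C' where i': "i' \<in> L" "B' \<in> \<B>" "C' \<in> \<B>" "a \<in> B'" "x \<in> B'" "i' \<in> B'" "b \<in> C'" "y' \<in> C'" "i' \<in> C'"
    using assms(10) by (auto simp: par_def)
  have ax: "a \<noteq> x" using assms vert_refl by metis
  then have BB: "B = B'" using block_eq[of B B' a x] i i' by blast
  have "B \<noteq> L" using i assms by (auto simp: affine_def)
  then have ii: "i = i'" using block_eq[of B L i i'] i i' BB flag by blast
  have "b \<noteq> i" using i assms by (auto simp: affine_def)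
  then have CC: "C = C'" using block_eq[of C C' b i] i i' ii by blast
  have "vert y y'" using vert_trans[of y x y'] vert_sym[of x y] assms by blast
  then have pC: "p \<in> C" using vert_center[of C y y'] i i' CC ne by blast
  have "i \<noteq> p" using i assms by (auto simp: vert_def)
  then have "C = L" using block_eq[of C L i p] i pC flag by blast
  then show False using i assms by (auto simp: affine_def)
qed

text \<open>The sides of a collinear triple have the same point at infinity, so \<open>b1\<close>,
  \<open>b2\<close>, \<open>b3\<close> lie on one line through it.\<close>

lemma par_trans_collinear:
  assumes "affine a1" "affine a2" "affine a3" "affine b2" "\<not> vert a1 a2" "\<not> vert a2 a3" 
    and B: "B \<in> \<B>" "{a1, a2, a3} \<subseteq> B"
    and par: "par a1 b1 a2 b2" "par a2 b2 a3 b3"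
  shows "par a1 b1 a3 b3"
proof -
  obtain i A C where i: "i \<in> L" "A \<in> \<B>" "C \<in> \<B>" "a1 \<in> A" "a2 \<in> A" "i \<in> A" "b1 \<in> C" "b2 \<in> C" "i \<in> C"
    using par(1) by (auto simp: par_def)
  obtain i' A' C' where i': "i' \<in> L" "A' \<in> \<B>" "C' \<in> \<B>" "a2 \<in> A'" "a3 \<in> A'" "i' \<in> A'" "b2 \<in> C'" "b3 \<in> C'" "i' \<in> C'"
    using par(2) by (auto simp: par_def)
  have "a1 \<noteq> a2" "a2 \<noteq> a3" using assms vert_refl by metis+
  then have AB: "A = B" "A' = B" using block_eq[of A B a1 a2] block_eq[of A' B a2 a3] i i' B by blast+
  have "B \<noteq> L" using B assms by (auto simp: affine_def)
  then have ii: "i = i'" using block_eq[of B L i i'] i i' AB B flag by blast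
  have "b2 \<noteq> i" using i assms by (auto simp: affine_def)
  then have "C = C'" using block_eq[of C C' b2 i] i i' ii by blast
  then show ?thesis using i i' ii B AB unfolding par_def by blast
qed

text \<open>For two proper triangles this is \<open>flag_closes\<close>; otherwise the collinear
  case applies, after exchanging the triangles if necessary.\<close>

lemma par_trans:
  assumes aff: "affine a1" "affine a2" "affine a3" "affine b1" "affine b2" "affine b3"
    and nv: "\<not> vert a1 a2" "\<not> vert a1 a3" "\<not> vert a2 a3"
    and v: "vert a1 b1" "vert a2 b2" "vert a3 b3" and ne: "a1 \<noteq> b1" "a2 \<noteq> b2" "a3 \<noteq> b3"
    and par: "par a1 b1 a2 b2" "par a2 b2 a3 b3"
  shows "par a1 b1 a3 b3"
proof -
  have "\<not> vert u' w'" if "vert u u'" "vert w w'" "\<not> vert u w" "affine u'" "affine w'" for u u' w w'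
    using vert_trans[of u u' w'] vert_trans[of u w' w] vert_sym[of w w'] that by blast
  then have nvb: "\<not> vert b1 b2" "\<not> vert b1 b3" "\<not> vert b2 b3"
    using v nv aff by metis+
  show ?thesis
  proof (cases "(\<exists>B\<in>\<B>. {a1, a2, a3} \<subseteq> B) \<or> (\<exists>B\<in>\<B>. {b1, b2, b3} \<subseteq> B)")
    case True
    then show ?thesis
    proof
      assume "\<exists>B\<in>\<B>. {a1, a2, a3} \<subseteq> B"
      then show ?thesis using par_trans_collinear[OF aff(1,2,3,5) nv(1,3) _ _ par] by blast
    next
      assume "\<exists>B\<in>\<B>. {b1, b2, b3} \<subseteq> B"
      then have "par b1 a1 b3 a3"
        using par_trans_collinear[OF aff(4,5,6,2) nvb(1,3) _ _ par_swap[OF par(1)] par_swap[OF par(2)]]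
        by blast
      then show ?thesis by (rule par_swap)
    qed
  next
    case False
    obtain V1 V2 V3 where V: "V1 \<in> \<B>" "p \<in> V1" "a1 \<in> V1" "b1 \<in> V1" "V2 \<in> \<B>" "p \<in> V2" "a2 \<in> V2" "b2 \<in> V2"
      "V3 \<in> \<B>" "p \<in> V3" "a3 \<in> V3" "b3 \<in> V3"
      using v unfolding vert_def by blast
    have "V1 \<noteq> V2" "V1 \<noteq> V3" "V2 \<noteq> V3" using V nv unfolding vert_def by blast+
    moreover have "L \<noteq> V1" "L \<noteq> V2" "L \<noteq> V3" using V aff unfolding affine_def by blast+
    ultimately have dV: "distinct [L, V1, V2, V3]" by simp
    have sub: "{a1, b1} \<subseteq> V1 - {p}" "{a2, b2} \<subseteq> V2 - {p}" "{a3, b3} \<subseteq> V3 - {p}"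
      using V aff affine_ne by auto
    obtain i A C where i: "i \<in> L" "A \<in> \<B>" "C \<in> \<B>" "a1 \<in> A" "a2 \<in> A" "i \<in> A" "b1 \<in> C" "b2 \<in> C" "i \<in> C"
      using par(1) by (auto simp: par_def)
    obtain j A' C' where j: "j \<in> L" "A' \<in> \<B>" "C' \<in> \<B>" "a2 \<in> A'" "a3 \<in> A'" "j \<in> A'" "b2 \<in> C'" "b3 \<in> C'" "j \<in> C'"
      using par(2) by (auto simp: par_def)
    have X: "a1 \<in> X" "a3 \<in> X" "b1 \<in> X" "b3 \<in> X" using aff by (auto simp: affine_def)
    have "a1 \<noteq> a3" "b1 \<noteq> b3" using nv nvb aff vert_refl by metis+
    then obtain D E where D: "D \<in> \<B>" "a1 \<in> D" "a3 \<in> D" and E: "E \<in> \<B>" "b1 \<in> E" "b3 \<in> E"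
      using join[OF X(1,2)] join[OF X(3,4)] by metis
    have "D \<noteq> E"
    proof
      assume "D = E"
      then have "p \<in> D" using vert_center[of D a1 b1] D E v ne by blast
      then show False using D nv unfolding vert_def by blast
    qed
    then obtain k where k: "k \<in> D" "k \<in> E" using meet_blocks D E by metis
    have "k \<in> L"
      by (rule flag_closes[OF V(1,5,9) dV V(2,6,10) sub ne, of A A' D C C' E i j])
         (use False i j D E k in auto)
    then show ?thesis using k D E by (auto simp: par_def)
  qed
qed

section \<open>Elations determined by a point and its image\<close>

definition base :: "'a \<Rightarrow> 'a \<Rightarrow> 'a \<Rightarrow> 'a \<Rightarrow> bool" where
  "base a b c d \<longleftrightarrow> affine a \<and> affine b \<and> affine c \<and> affine d \<and> vert a b \<and> vert c d \<and>
     a \<noteq> b \<and> c \<noteq> d \<and> \<not> vert a c \<and> par a b c d"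

text \<open>The pair \<open>a\<close>, \<open>b\<close> cannot place the image of a point on its own
  vertical line; there the second pair \<open>c\<close>, \<open>d\<close> takes over. Agreement with
  every applicable pair is demanded, which keeps the relation symmetric in the two pairs.\<close>

definition image_of :: "'a \<Rightarrow> 'a \<Rightarrow> 'a \<Rightarrow> 'a \<Rightarrow> 'a \<Rightarrow> 'a \<Rightarrow> bool" where
  "image_of a b c d x y \<longleftrightarrow> affine y \<and> vert x y \<and> y \<noteq> x \<and>
     (\<not> vert a x \<longrightarrow> par a b x y) \<and> (\<not> vert c x \<longrightarrow> par c d x y)"

definition elation :: "'a \<Rightarrow> 'a \<Rightarrow> 'a \<Rightarrow> 'a \<Rightarrow> 'a \<Rightarrow> 'a" where
  "elation a b c d x = (if x \<in> L then x else (SOME y. image_of a b c d x y))"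

lemma base_swap:
  assumes "base a b c d"
  shows "base b a d c"
proof -
  note b = assms[unfolded base_def]
  have "\<not> vert b d"
  proof
    assume "vert b d"
    then have "vert a d" using vert_trans[of a b d] b by blast
    then show False using vert_trans[of a d c] vert_sym[of c d] b by blast
  qed
  then show ?thesis
    using b vert_sym[of a b] vert_sym[of c d] par_swap[of a b c d] unfolding base_def by blast
qed

lemma base_flip: "base a b c d \<Longrightarrow> base c d a b"
  using vert_sym[of c a] par_sym[of a b c d] unfolding base_def by blast

lemma base_separates:
  assumes "base a b c d" "affine x" "vert a x"
  shows "\<not> vert c x"
proof
  assume "vert c x"
  then have "vert a c" using vert_trans[of a x c] vert_sym[of c x] assms by blast
  then show False using assms by (simp add: base_def)
qed

text \<open>Interchanging source and image in both pairs describes the inverse map.\<close>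

lemma image_of_swap:
  assumes "base a b c d" "image_of a b c d x y" "affine x"
  shows "image_of b a d c y x"
proof -
  note b = assms(1)[unfolded base_def] and im = assms(2)[unfolded image_of_def]
  have *: "vert u x \<longleftrightarrow> vert v y" if "vert u v" "affine u" "affine v" for u v
  proof -
    have "vert u x \<longleftrightarrow> vert u y"
      using vert_trans[of u x y] vert_trans[of u y x] vert_sym[of x y] im assms(3) by blast
    then show ?thesis
      using vert_trans[of u v y] vert_trans[of v u y] vert_sym[of u v] that by blast
  qed
  show ?thesis
    using b im assms(3) *[of a b] *[of c d] vert_sym[of x y] par_swap[of a b x y] par_swap[of c d x y]
    unfolding image_of_def by blast
qed

lemma image_of_unique:
  assumes "base a b c d" "affine x" "image_of a b c d x y" "image_of a b c d x y'"
  shows "y = y'"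
proof (cases "vert a x")
  case True
  then have "\<not> vert c x" using base_separates assms by blast
  then show ?thesis
    using par_unique[of c d x y y'] assms unfolding base_def image_of_def by blast
next
  case False
  then show ?thesis
    using par_unique[of a b x y y'] assms unfolding base_def image_of_def by blast
qed

text \<open>Off both vertical lines the two pairs prescribe the same image, by
  \<open>par_trans\<close> along \<open>c\<close>, \<open>a\<close>, \<open>x\<close>.\<close>

lemma image_of_exists:
  assumes "base a b c d" "affine x"
  shows "\<exists>y. image_of a b c d x y"
proof -
  note b = assms(1)[unfolded base_def]
  show ?thesis
  proof (cases "vert a x")
    case True
    then have "\<not> vert c x" using base_separates assms by blast
    then show ?thesis using par_exists[of c d x] True b assms(2) by (auto simp: image_of_def)
  next
    case False
    then obtain y where y: "affine y" "vert x y" "y \<noteq> x" "par a b x y"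
      using par_exists[of a b x] b assms(2) by blast
    have "\<not> vert c a" "par c d a b" using b vert_sym par_sym by blast+
    then have "par c d x y" if "\<not> vert c x"
      by (intro par_trans[of c a x d b y]) (use b y that False assms(2) in auto)
    then show ?thesis using y False by (auto simp: image_of_def)
  qed
qed

lemma image_of_base:
  assumes "base a b c d"
  shows "image_of a b c d a b" "image_of a b c d c d"
  using assms vert_refl par_sym unfolding base_def image_of_def by auto

text \<open>In the plane of order 2 no third vertical line is available for the transitivity of \<^const>\<open>par\<close>.\<close>

lemma two_verticals:
  assumes base: "base a b c d" and few: "\<And>g. affine g \<Longrightarrow> vert a g \<or> vert c g"
    and z: "affine z" "vert c z"
  shows "z = c \<or> z = d"
proof (rule ccontr)
  assume ne: "\<not> ?thesis"
  note b = base[unfolded base_def]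
  obtain i B C where i: "i \<in> L" "B \<in> \<B>" "C \<in> \<B>" "a \<in> B" "c \<in> B" "i \<in> B" "b \<in> C" "d \<in> C" "i \<in> C"
    using b by (auto simp: par_def)
  have pB: "p \<notin> B" using i b unfolding vert_def by blast
  have "\<not> vert a z" using base_separates[OF base z(1)] z by blast
  moreover have "vert a w" if "vert b w" for w using vert_trans[of a b w] that b by blast
  ultimately have bc: "\<not> vert b c" "\<not> vert b z" using b by blast+
  have "b \<noteq> z" using bc b vert_refl by metis
  \<comment> \<open>The line \<open>bz\<close> is parallel to \<open>ac\<close> only if
    \<open>z = d\<close>. Otherwise it meets \<open>ac\<close> in an affine point \<open>w\<close>,
    which can lie on neither of the two vertical lines.\<close>
  then obtain K where K: "K \<in> \<B>" "b \<in> K" "z \<in> K" using join[of b z] b z by (metis affine_def)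
  have pK: "p \<notin> K" using K bc unfolding vert_def by blast
  have "K \<noteq> B" using vert_center[of B a b] i K b pB by blast
  then obtain w where w: "w \<in> K" "w \<in> B" using meet_blocks K i by metis
  have "w \<notin> L"
  proof
    assume wL: "w \<in> L"
    have "B \<noteq> L" using i b unfolding affine_def by blast
    then have "w = i" using block_eq[of B L w i] wL w i flag by blast
    moreover have "b \<noteq> i" using i b unfolding affine_def by blast
    ultimately have "K = C" using block_eq[of K C b i] K i w by blast
    then have "p \<in> K" using vert_center[of K z d] K i ne z b vert_trans vert_sym by metis
    then show False using pK by simp
  qed
  then have "affine w" using w block_subset[OF K(1)] by (auto simp: affine_def)
  then consider "vert a w" | "vert c w" using few by blast
  then show False
  proof cases
    case 1
    then have "w = a" using vert_center[of B a w] w i pB by blast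
    then show False using vert_center[of K a b] K w b pK by blast
  next
    case 2
    then have "w = c" using vert_center[of B c w] w i pB by blast
    then show False using vert_center[of K c z] K w z ne pK by blast
  qed
qed

text \<open>This is what makes the map preserve collinearity. A base pair vertical to neither point
  gives it by transitivity of \<open>par\<close>; critical is the case of one point on each of the
  two base vertical lines.\<close>

lemma image_of_par:
  assumes base: "base a b c d" and x: "affine x" "affine x'" "\<not> vert x x'"
    and im: "image_of a b c d x y" "image_of a b c d x' y'"
  shows "par x y x' y'"
proof -
  have via: "par s t s' t'"
    if "base u v u' v'" "affine s" "affine s'" "\<not> vert s s'" "\<not> vert u s" "\<not> vert u s'"
      "image_of u v u' v' s t" "image_of u v u' v' s' t'" for s t s' t' u v u' v'
  proof -
    have "\<not> vert s u" "par s t u v" "par u v s' t'"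
      using that(5-8) vert_sym par_sym unfolding image_of_def by blast+
    then show ?thesis
      by (intro par_trans[of s u s' t v t']) (use that in \<open>auto simp: base_def image_of_def\<close>)
  qed
  have flip: "image_of c d a b s t" if "image_of a b c d s t" for s t
    using that by (auto simp: image_of_def)
  \<comment> \<open>A third vertical line serves as intermediate station. If there is none, the two
    vertical lines have only two affine points each, and the positions are checked directly.\<close>
  have cross: "par s t s' t'"
    if bs: "base u v u' v'" and s: "affine s" "affine s'" and vs: "vert u s" "vert u' s'"
      and ims: "image_of u v u' v' s t" "image_of u v u' v' s' t'" for s t s' t' u v u' v'
  proof -
    note b = bs[unfolded base_def]
    have flip': "image_of u' v' u v s t" if "image_of u v u' v' s t" for s t
      using that by (auto simp: image_of_def)
    have nv: "\<not> vert u' s" "\<not> vert u s'"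
      using base_separates[OF bs s(1) vs(1)] base_separates[OF bs s(2)] vs by blast+
    have ns: "\<not> vert s s'" using nv vert_trans[of u s s'] vs s by blast
    show ?thesis
    proof (cases "\<exists>g. affine g \<and> \<not> vert u g \<and> \<not> vert u' g")
      case True
      then obtain g where g: "affine g" "\<not> vert u g" "\<not> vert u' g" by blast
      obtain h where h: "image_of u v u' v' g h" using image_of_exists[OF bs g(1)] by blast
      have ng: "\<not> vert s g" "\<not> vert s' g" using g vs s vert_trans by metis+
      have "par s t g h"
        by (rule via[OF base_flip[OF bs] s(1) g(1) ng(1) nv(1) g(3)]) (use ims h flip' in auto)
      moreover have "par s' t' g h"
        by (rule via[OF bs s(2) g(1) ng(2) nv(2) g(2)]) (use ims h in auto)
      ultimately show ?thesis
        using par_trans[of s g s' t h t'] ims h s g ng ns vert_sym par_sym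
        unfolding image_of_def by metis
    next
      case False
      have s_cases: "z = u \<or> z = v" if "affine z" "vert u z" for z
        using two_verticals[OF base_flip[OF bs]] False that by blast
      have s'_cases: "z = u' \<or> z = v'" if "affine z" "vert u' z" for z
        using two_verticals[OF bs] False that by blast
      show ?thesis
      proof (cases "s = u \<or> s' = u'")
        case True
        then show ?thesis
        proof
          assume "s = u"
          moreover have "t = v"
            using image_of_unique[OF bs s(1) ims(1)] image_of_base(1)[OF bs] \<open>s = u\<close> by blast
          ultimately show ?thesis using ims(2) nv by (auto simp: image_of_def)
        next
          assume "s' = u'"
          moreover have "t' = v'"
            using image_of_unique[OF bs s(2) ims(2)] image_of_base(2)[OF bs] \<open>s' = u'\<close> by blast
          ultimately show ?thesis using ims(1) nv par_sym by (auto simp: image_of_def)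
        qed
      next
        case False
        then have sv: "s = v" "s' = v'" using s_cases[OF s(1) vs(1)] s'_cases[OF s(2) vs(2)] by auto
        have "vert u t" "vert u' t'" "affine t" "affine t'" "t \<noteq> s" "t' \<noteq> s'"
          using ims vs s vert_trans unfolding image_of_def by blast+
        then have "t = u" "t' = u'" using s_cases s'_cases sv by metis+
        then show ?thesis using sv b par_swap by blast
      qed
    qed
  qed
  note b = base[unfolded base_def]
  have not_both: "\<not> (vert a z \<and> vert c z)" if "affine z" for z
    using base_separates[OF base] that by blast
  consider "\<not> vert a x" "\<not> vert a x'" | "\<not> vert c x" "\<not> vert c x'" | "vert a x" "vert c x'"
    | "vert c x" "vert a x'" using not_both x by metis
  then show ?thesis
  proof cases
    case 1
    then show ?thesis using via[OF base x] im by blast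
  next
    case 2
    then show ?thesis using via[OF base_flip[OF base] x] im flip by blast
  next
    case 3
    then show ?thesis using cross[OF base x(1,2)] im by blast
  next
    case 4
    then show ?thesis using cross[OF base_flip[OF base] x(1,2)] im flip by blast
  qed
qed

lemma elation_image:
  assumes "base a b c d" "affine x"
  shows "image_of a b c d x (elation a b c d x)"
  using someI_ex[OF image_of_exists[OF assms]] assms(2) by (auto simp: elation_def affine_def)

lemma elation_axis: "x \<in> L \<Longrightarrow> elation a b c d x = x"
  by (simp add: elation_def)

lemma elation_in_X: "base a b c d \<Longrightarrow> x \<in> X \<Longrightarrow> elation a b c d x \<in> X"
  using elation_image[of a b c d x] elation_axis[of x a b c d]
  by (cases "x \<in> L") (auto simp: affine_def image_of_def)

lemma elation_inverse:
  assumes base: "base a b c d" and x: "x \<in> X"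
  shows "elation b a d c (elation a b c d x) = x"
proof (cases "x \<in> L")
  case True
  then show ?thesis by (simp add: elation_axis)
next
  case False
  then have aff: "affine x" using x by (simp add: affine_def)
  let ?y = "elation a b c d x"
  have im: "image_of a b c d x ?y" by (rule elation_image[OF base aff])
  then have "affine ?y" by (simp add: image_of_def)
  then show ?thesis
    using image_of_unique[OF base_swap[OF base] _ elation_image[OF base_swap[OF base]]
        image_of_swap[OF base im aff]] by blast
qed

lemma elation_block_center:
  assumes base: "base a b c d" and B: "B \<in> \<B>" "p \<in> B" and x: "x \<in> B"
  shows "elation a b c d x \<in> B"
proof (cases "x \<in> L")
  case False
  then have aff: "affine x" using x B block_subset by (auto simp: affine_def)
  have "vert x (elation a b c d x)" using elation_image[OF base aff] by (simp add: image_of_def)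
  then obtain V where V: "V \<in> \<B>" "p \<in> V" "x \<in> V" "elation a b c d x \<in> V" by (auto simp: vert_def)
  then have "V = B" using block_eq[of V B p x] B x affine_ne[OF aff] by blast
  then show ?thesis using V by simp
qed (use x elation_axis in auto)

lemma elation_block:
  assumes base: "base a b c d" and B: "B \<in> \<B>"
  shows "\<exists>C\<in>\<B>. elation a b c d ` B \<subseteq> C"
proof (cases "p \<in> B")
  case True
  then show ?thesis using elation_block_center[OF base B True] B by blast
next
  case False
  let ?f = "elation a b c d"
  have BL: "B \<noteq> L" using False flag by blast
  obtain i where i: "i \<in> B" "i \<in> L" using meet_blocks[OF B flag(1) BL] by blast
  have iB: "x = i" if "x \<in> B" "x \<in> L" for x using block_eq[OF B flag(1), of x i] that i BL by blast
  show ?thesis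
  proof (cases "\<exists>x\<in>B. x \<notin> L")
    case True
    then obtain x where x: "x \<in> B" "x \<notin> L" by blast
    then have aff: "affine x" using block_subset[OF B] by (simp add: affine_def)
    have im: "image_of a b c d x (?f x)" by (rule elation_image[OF base aff])
    then have fx: "?f x \<in> X" "?f x \<noteq> i" using i by (auto simp: image_of_def affine_def)
    \<comment> \<open>The image block joins the image of one affine point of \<open>B\<close> to the
      fixed point \<open>i\<close> of \<open>B\<close> on the axis.\<close>
    obtain C where C: "C \<in> \<B>" "?f x \<in> C" "i \<in> C" using join[OF fx(1) block_subset[OF B i(1)] fx(2)] by blast
    have "?f x' \<in> C" if x': "x' \<in> B" for x'
    proof (cases "x' \<in> L \<or> x' = x")
      case True
      then show ?thesis using iB[OF x'] elation_axis[of x'] C by auto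
    next
      case False
      then have aff': "affine x'" using x' block_subset[OF B] by (simp add: affine_def)
      have "\<not> vert x x'" using vert_center[OF B x(1) x'] False \<open>p \<notin> B\<close> by blast
      then have "par x (?f x) x' (?f x')"
        using image_of_par[OF base aff aff' _ im elation_image[OF base aff']] by blast
      then obtain j D E where j: "j \<in> L" "D \<in> \<B>" "E \<in> \<B>" "x \<in> D" "x' \<in> D" "j \<in> D" "?f x \<in> E" "?f x' \<in> E" "j \<in> E"
        by (auto simp: par_def)
      have "D = B" using block_eq[of D B x x'] j B x x' False by blast
      then have "j = i" using iB j by blast
      then have "E = C" using block_eq[of E C i "?f x"] j C fx by blast
      then show ?thesis using j by simp
    qed
    then show ?thesis using C by blast
  next
    case False
    then have "?f ` B \<subseteq> L" using elation_axis by auto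
    then show ?thesis using flag by blast
  qed
qed

text \<open>The map and its inverse both send blocks into blocks; going back and forth turns the
  inclusion into an equality.\<close>

lemma elation_block_image:
  assumes base: "base a b c d" and B: "B \<in> \<B>"
  shows "elation a b c d ` B \<in> \<B>"
proof -
  let ?f = "elation a b c d" and ?g = "elation b a d c"
  obtain C where C: "C \<in> \<B>" "?f ` B \<subseteq> C" using elation_block[OF base B] by blast
  obtain D where D: "D \<in> \<B>" "?g ` C \<subseteq> D" using elation_block[OF base_swap[OF base] C(1)] by blast
  have gf: "?g (?f x) = x" if "x \<in> B" for x
    using elation_inverse[OF base] block_subset[OF B that] by blast
  have fg: "?f (?g x) = x" if "x \<in> C" for x
    using elation_inverse[OF base_swap[OF base]] block_subset[OF C(1) that] by blast
  have BD: "B \<subseteq> D"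
  proof
    fix x assume "x \<in> B"
    then have "?g (?f x) \<in> D" using C D by blast
    then show "x \<in> D" using gf \<open>x \<in> B\<close> by simp
  qed
  obtain x y where "x \<in> B" "y \<in> B" "x \<noteq> y" using three_points[OF B] by auto
  then have "B = D" using block_eq[OF B D(1), of x y] BD by blast
  have "C \<subseteq> ?f ` B"
  proof
    fix x assume x: "x \<in> C"
    then have "?g x \<in> B" using D \<open>B = D\<close> by blast
    then show "x \<in> ?f ` B" using fg[OF x] by force
  qed
  then show ?thesis using C by (metis subset_antisym)
qed

lemma elation_collineation:
  assumes base: "base a b c d"
  shows "collineation X \<B> (elation a b c d)"
  unfolding collineation_def
proof
  note base' = base_swap[OF base]
  show "bij_betw (elation a b c d) X X"
    by (rule bij_betw_byWitness[where f' = "elation b a d c"])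
       (use elation_inverse[OF base] elation_inverse[OF base'] elation_in_X[OF base]
          elation_in_X[OF base'] in auto)
  have inv: "elation v u v' u' ` elation u v u' v' ` B = B" if "base u v u' v'" "B \<in> \<B>" for u v u' v' B
    using elation_inverse[OF that(1)] block_subset[OF that(2)] by (force simp: image_image)
  show "bij_betw ((`) (elation a b c d)) \<B> \<B>"
    by (rule bij_betw_byWitness[where f' = "(`) (elation b a d c)"])
       (use inv[OF base] inv[OF base'] elation_block_image[OF base] elation_block_image[OF base'] in auto)
qed

text \<open>A point \<open>c\<close> off the vertical line of \<open>a\<close> and \<open>b\<close>,
  with \<open>d\<close> completing the parallelogram, provides the second pair. The identity serves
  for \<open>a = b\<close>, where no \<open>base\<close> is available.\<close>

theorem flag_transitive: "center_axis_transitive X \<B> p L"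
  unfolding center_axis_transitive_def
proof (intro ballI impI)
  fix B a b
  assume B: "B \<in> \<B>" "a \<in> B" "b \<in> B" "p \<in> B" "B \<noteq> L" and off: "a \<notin> insert p L" "b \<notin> insert p L"
  show "\<exists>f. central_collineation X \<B> p L f \<and> f a = b"
  proof (cases "a = b")
    case True
    have "central_collineation X \<B> p L id"
      by (simp add: central_collineation_def collineation_def bij_betw_def inj_on_def)
    then show ?thesis using True by (intro exI[of _ id]) simp
  next
    case False
    have aff: "affine a" "affine b" using off B block_subset by (auto simp: affine_def)
    have ab: "vert a b" using B by (auto simp: vert_def)
    obtain c where c: "affine c" "\<not> vert a c"
      using other_vertical[of a] aff(1) unfolding affine_def vert_def by blast
    obtain d where d: "affine d" "vert c d" "d \<noteq> c" "par a b c d"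
      using par_exists[OF aff c(1) ab False c(2)] by blast
    have base: "base a b c d" using aff ab c d False by (auto simp: base_def)
    have "elation a b c d a = b"
      using image_of_unique[OF base aff(1) elation_image[OF base aff(1)]] image_of_base(1)[OF base] by blast
    moreover have "elation a b c d ` C = C" if C: "C \<in> \<B>" "p \<in> C" for C
    proof -
      have "elation a b c d ` C \<subseteq> C" using elation_block_center[OF base C] by blast
      moreover obtain x y z where "distinct [x, y, z]" "{x, y, z} \<subseteq> elation a b c d ` C"
        using three_points[OF elation_block_image[OF base C(1)]] by blast
      ultimately show ?thesis
        using block_eq[OF elation_block_image[OF base C(1)] C(1), of x y] by (simp add: subset_iff)
    qed
    ultimately show ?thesis
      using elation_collineation[OF base] elation_axis
      by (intro exI[of _ "elation a b c d"]) (simp add: central_collineation_def)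
  qed
qed

end

section \<open>Translation lines under collineations\<close>

context thick_plane
begin

lemma collineation_inverse:
  assumes f: "collineation X \<B> f"
  shows "collineation X \<B> (inv_into X f)"
    and "B \<in> \<B> \<Longrightarrow> inv_into X f ` f ` B = B" and "B \<in> \<B> \<Longrightarrow> f ` inv_into X f ` B = B"
proof -
  let ?g = "inv_into X f"
  have bX: "bij_betw f X X" and b\<B>: "bij_betw ((`) f) \<B> \<B>" using f by (auto simp: collineation_def)
  have inj: "inj_on f X" and surj: "f ` X = X" using bX by (auto simp: bij_betw_def)
  show gf: "?g ` f ` B = B" if "B \<in> \<B>" for B
    using inv_into_image_cancel[OF inj] block_subset[OF that] by blast
  show fg: "f ` ?g ` B = B" if "B \<in> \<B>" for B
    using image_inv_into_cancel[OF surj] block_subset[OF that] by blast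
  have img: "((`) f) ` \<B> = \<B>" using b\<B> by (simp add: bij_betw_def)
  have "?g ` B \<in> \<B>" if "B \<in> \<B>" for B
  proof -
    obtain B0 where "B0 \<in> \<B>" "B = f ` B0" using img \<open>B \<in> \<B>\<close> by blast
    then show ?thesis using gf by simp
  qed
  then have "bij_betw ((`) ?g) \<B> \<B>"
    by (intro bij_betw_byWitness[where f' = "(`) f"]) (use gf fg img in auto)
  then show "collineation X \<B> ?g"
    using bij_betw_inv_into[OF bX] by (simp add: collineation_def)
qed

lemma collineation_comp:
  assumes "collineation X \<B> f" "collineation X \<B> g"
  shows "collineation X \<B> (f \<circ> g)"
proof -
  have "(`) (f \<circ> g) = (`) f \<circ> (`) g" by (auto simp: fun_eq_iff)
  then show ?thesis
    using assms bij_betw_trans[of g X X f X] bij_betw_trans[of "(`) g" \<B> \<B> "(`) f" \<B>]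
    by (simp add: collineation_def)
qed

text \<open>The elations for the image line are the conjugates by \<open>f\<close> of those for
  \<open>A\<close>.\<close>

lemma translation_line_image:
  assumes f: "collineation X \<B> f" and A: "A \<in> \<B>" and tr: "translation_line X \<B> A"
  shows "translation_line X \<B> (f ` A)"
  unfolding translation_line_def center_axis_transitive_def
proof (intro ballI impI)
  let ?g = "inv_into X f"
  fix c' B a' b'
  assume c': "c' \<in> f ` A" and B: "B \<in> \<B>" "a' \<in> B" "b' \<in> B" "c' \<in> B" "B \<noteq> f ` A"
    and off: "a' \<notin> insert c' (f ` A)" "b' \<notin> insert c' (f ` A)"
  have inj: "inj_on f X" using f by (simp add: collineation_def bij_betw_def)
  note g = collineation_inverse[OF f]
  have gB: "?g ` B \<in> \<B>" using g(1) B(1) by (auto simp: collineation_def bij_betw_def)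
  have fg: "f (?g x) = x" if "x \<in> X" for x
    using f that by (intro f_inv_into_f) (auto simp: collineation_def bij_betw_def)
  have gf: "?g (f x) = x" if "x \<in> A" for x
    using inv_into_f_f[OF inj block_subset[OF A that]] .
  let ?a = "?g a'" and ?b = "?g b'" and ?c = "?g c'"
  have pts: "f ?a = a'" "f ?b = b'" "f ?c = c'" using fg block_subset[OF B(1)] B by auto
  have cA: "?c \<in> A" using c' gf by auto
  have "?a \<notin> insert ?c A" "?b \<notin> insert ?c A"
    using off pts imageI[of ?a A f] imageI[of ?b A f] by auto
  moreover have "?g ` B \<noteq> A" using g(3)[OF B(1)] B(5) by metis
  moreover have "center_axis_transitive X \<B> ?c A" using tr cA by (simp add: translation_line_def)
  moreover have "?a \<in> ?g ` B" "?b \<in> ?g ` B" "?c \<in> ?g ` B" using B by auto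
  ultimately obtain h where h: "central_collineation X \<B> ?c A h" "h ?a = ?b"
    using center_axis_transitiveD[of X \<B> ?c A "?g ` B" ?a ?b] gB by auto
  have "central_collineation X \<B> c' (f ` A) (f \<circ> h \<circ> ?g)"
    unfolding central_collineation_def
  proof (intro conjI ballI impI)
    show "collineation X \<B> (f \<circ> h \<circ> ?g)"
      using collineation_comp f g(1) h(1) by (simp add: central_collineation_def)
    show "(f \<circ> h \<circ> ?g) x = x" if "x \<in> f ` A" for x
      using that gf h(1) by (auto simp: central_collineation_def)
    show "(f \<circ> h \<circ> ?g) ` C = C" if C: "C \<in> \<B>" "c' \<in> C" for C
    proof -
      have "?g ` C \<in> \<B>" using g(1) C(1) by (auto simp: collineation_def bij_betw_def)
      then have "h ` ?g ` C = ?g ` C" using h(1) C(2) by (simp add: central_collineation_def)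
      then show ?thesis using g(3)[OF C(1)] by (simp only: image_comp[symmetric])
    qed
  qed
  moreover have "(f \<circ> h \<circ> ?g) a' = b'" using h(2) pts by simp
  ultimately show "\<exists>f'. central_collineation X \<B> c' (f ` A) f' \<and> f' a' = b'" by blast
qed

text \<open>A line through \<open>q\<close> is the image of a line off \<open>q\<close> under an
  elation with axis \<open>M\<close>, and images of translation lines are translation lines.\<close>

lemma moufang_if_translation_lines_off_point:
  assumes q: "q \<in> X" and M: "M \<in> \<B>" "q \<notin> M"
    and tr: "\<And>A. A \<in> \<B> \<Longrightarrow> q \<notin> A \<Longrightarrow> translation_line X \<B> A"
  shows "moufang_plane X \<B>"
  unfolding moufang_plane_def
proof (intro conjI ballI plane)
  fix L assume L: "L \<in> \<B>"
  show "translation_line X \<B> L"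
  proof (cases "q \<in> L")
    case True
    have "M \<noteq> L" using M True by blast
    obtain x y where xy: "x \<in> M" "y \<in> M" "x \<noteq> y" using three_points[OF M(1)] by auto
    then have "x \<notin> L \<or> y \<notin> L" using block_eq[OF M(1) L xy(1,2)] \<open>M \<noteq> L\<close> by blast
    \<comment> \<open>The centre lies on \<open>M\<close> but off \<open>L\<close>, so that the line
      \<open>qc\<close> differs from \<open>L\<close> and the image \<open>y\<close> of
      \<open>q\<close> along it is off \<open>L\<close>.\<close>
    then obtain c where c: "c \<in> M" "c \<notin> L" using xy by blast
    then obtain J where J: "J \<in> \<B>" "q \<in> J" "c \<in> J"
      using join[of q c thesis] q block_subset[OF M(1), of c] M(2) by blast
    obtain y where y: "y \<in> J" "y \<noteq> q" "y \<noteq> c"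
    proof -
      obtain x1 x2 x3 where "distinct [x1, x2, x3]" "{x1, x2, x3} \<subseteq> J" using three_points[OF J(1)] by blast
      then have "\<exists>y\<in>J. y \<noteq> q \<and> y \<noteq> c" by (cases "x1 = q \<or> x1 = c"; cases "x2 = q \<or> x2 = c") auto
      then show ?thesis using that by blast
    qed
    have ne: "J \<noteq> M" "q \<noteq> c" using J M c by auto
    moreover have "y \<notin> M" using block_eq[OF J(1) M(1), of y c] ne J y c by blast
    moreover have "center_axis_transitive X \<B> c M" using tr[OF M] c by (simp add: translation_line_def)
    ultimately obtain f where f: "central_collineation X \<B> c M f" "f q = y"
      using center_axis_transitiveD[of X \<B> c M J q y] J y M(2) by auto
    then have col: "collineation X \<B> f" by (simp add: central_collineation_def)
    let ?g = "inv_into X f"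
    have gL: "?g ` L \<in> \<B>"
      using collineation_inverse(1)[OF col] L by (auto simp: collineation_def bij_betw_def)
    have "J \<noteq> L" using J c by blast
    then have "y \<notin> L" using block_eq[OF J(1) L, of y q] J y True by blast
    then have "q \<notin> ?g ` L"
      using f(2) collineation_inverse(3)[OF col L] imageI[of q "?g ` L" f] by auto
    then have "translation_line X \<B> (f ` ?g ` L)"
      using translation_line_image[OF col gL] tr[OF gL] by simp
    then show ?thesis using collineation_inverse(3)[OF col L] by simp
  qed (use tr[OF L] in blast)
qed

end


section \<open>Collinearity in generalized quadrangles\<close>

context generalized_quadrangle
begin

abbreviation adj (infix "\<sim>" 50) where
  "x \<sim> y \<equiv> collinear \<Gamma> x y"

lemma adj_commute: "x \<sim> y \<longleftrightarrow> y \<sim> x"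
  by (auto simp: collinear_def)

lemma adj_points: "x \<sim> y \<Longrightarrow> x \<in> Points \<Gamma>" "x \<sim> y \<Longrightarrow> y \<in> Points \<Gamma>"
  using Inc_carrier by (auto simp: collinear_def)

lemma adj_refl: "x \<in> Points \<Gamma> \<Longrightarrow> x \<sim> x"
  using thick_point[of x] by (auto simp: collinear_def)

lemma on_line_adj: "Inc \<Gamma> x M \<Longrightarrow> Inc \<Gamma> y M \<Longrightarrow> x \<sim> y"
  by (auto simp: collinear_def)

lemma line_through: 
  assumes "x \<sim> y"
  obtains M where "Inc \<Gamma> x M" "Inc \<Gamma> y M" "M \<in> Lines \<Gamma>"
  using assms Inc_carrier by (auto simp: collinear_def)

text \<open>Otherwise \<open>x\<close> and \<open>y\<close> would be two projections of
  \<open>z\<close> onto \<open>M\<close>.\<close>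

lemma on_lineI:
  assumes "Inc \<Gamma> x M" "Inc \<Gamma> y M" "x \<noteq> y" "z \<sim> x" "z \<sim> y"
  shows "Inc \<Gamma> z M"
proof (rule ccontr)
  assume z: "\<not> Inc \<Gamma> z M"
  obtain N N' where N: "Inc \<Gamma> z N" "Inc \<Gamma> x N" "Inc \<Gamma> z N'" "Inc \<Gamma> y N'"
    using assms by (auto simp: collinear_def)
  have "\<exists>!(y, N). Inc \<Gamma> z N \<and> Inc \<Gamma> y N \<and> Inc \<Gamma> y M"
    using project[OF _ _ z] assms(1) Inc_carrier N by blast
  then have "(x, N) = (y, N')"
    using N assms(1,2) by auto
  then show False using assms(3) by simp
qed

lemma no_triangle:
  assumes "x \<noteq> y" "x \<sim> y" "z \<sim> x" "z \<sim> y" "w \<sim> x" "w \<sim> y"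
  shows "z \<sim> w"
  using line_through[OF assms(2)] on_lineI assms on_line_adj by metis

lemma projection:
  assumes "x \<in> Points \<Gamma>" "M \<in> Lines \<Gamma>"
  obtains y where "Inc \<Gamma> y M" "x \<sim> y"
proof (cases "Inc \<Gamma> x M")
  case True
  then show ?thesis using that adj_refl assms by blast
next
  case False
  then show ?thesis using project[OF assms False] that on_line_adj by blast
qed

lemma third_point:
  assumes "M \<in> Lines \<Gamma>"
  obtains z where "Inc \<Gamma> z M" "z \<noteq> x" "z \<noteq> y"
proof -
  obtain x1 x2 x3 where x: "distinct [x1, x2, x3]" "Inc \<Gamma> x1 M" "Inc \<Gamma> x2 M" "Inc \<Gamma> x3 M"
    using thick_line[OF assms] by blast
  show ?thesis
    by (cases "x1 = x \<or> x1 = y"; cases "x2 = x \<or> x2 = y"; cases "x3 = x \<or> x3 = y")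
       (use x that in auto)
qed

lemma third_line:
  assumes "x \<in> Points \<Gamma>"
  obtains M where "Inc \<Gamma> x M" "M \<noteq> N" "M \<noteq> N'"
proof -
  obtain M1 M2 M3 where x: "distinct [M1, M2, M3]" "Inc \<Gamma> x M1" "Inc \<Gamma> x M2" "Inc \<Gamma> x M3"
    using thick_point[OF assms] by blast
  show ?thesis
    by (cases "M1 = N \<or> M1 = N'"; cases "M2 = N \<or> M2 = N'"; cases "M3 = N \<or> M3 = N'")
       (use x that in auto)
qed

text \<open>For collinear points another point of a joining line serves; otherwise the projections
  of \<open>z\<close> onto two lines through \<open>x\<close> are distinct, and one of them is not
  \<open>y\<close>.\<close>

lemma common_neighbour:
  assumes "x \<in> Points \<Gamma>" "z \<in> Points \<Gamma>"
  obtains g where "g \<sim> x" "g \<sim> z" "g \<noteq> y"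
proof (cases "x \<sim> z")
  case True
  then obtain M where M: "Inc \<Gamma> x M" "Inc \<Gamma> z M" "M \<in> Lines \<Gamma>"
    by (rule line_through)
  obtain g where "Inc \<Gamma> g M" "g \<noteq> y" using third_point[OF M(3), of y y] by metis
  then show ?thesis using that M on_line_adj by blast
next
  case False
  obtain M where M: "Inc \<Gamma> x M" using third_line[OF assms(1)] by metis
  obtain N where N: "Inc \<Gamma> x N" "N \<noteq> M" using third_line[OF assms(1)] by metis
  obtain g h where g: "Inc \<Gamma> g M" "z \<sim> g" and h: "Inc \<Gamma> h N" "z \<sim> h"
    using projection assms Inc_carrier M N by metis
  have "g \<noteq> h"
    using linear[of g x M N] g h M N False adj_commute by metis
  then show ?thesis
    using that[of g] that[of h] g h M N on_line_adj adj_commute by metis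
qed

lemma mem_pperp: "x \<in> Points \<Gamma> \<Longrightarrow> y \<in> pperp \<Gamma> x \<longleftrightarrow> y \<sim> x"
  using adj_commute adj_refl adj_points by (auto simp: pperp_def)

lemma mem_perp_pair:
  "x \<in> Points \<Gamma> \<Longrightarrow> y \<in> Points \<Gamma> \<Longrightarrow> z \<in> perp \<Gamma> {x, y} \<longleftrightarrow> z \<sim> x \<and> z \<sim> y"
  using mem_pperp adj_points by (auto simp: perp_def)

lemma mem_perp:
  "X \<subseteq> Points \<Gamma> \<Longrightarrow> z \<in> perp \<Gamma> X \<longleftrightarrow> z \<in> Points \<Gamma> \<and> (\<forall>x\<in>X. z \<sim> x)"
  using mem_pperp by (auto simp: perp_def)

lemma perp_subset: "perp \<Gamma> X \<subseteq> Points \<Gamma>"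
  by (auto simp: perp_def)

lemma opposite_iff: "opposite \<Gamma> x y \<longleftrightarrow> x \<in> Points \<Gamma> \<and> y \<in> Points \<Gamma> \<and> \<not> x \<sim> y"
  using adj_refl by (auto simp: opposite_def)

text \<open>Regularity in a form that does not distinguish whether \<open>x\<close> and \<open>z\<close> are collinear.\<close>

definition completes_grids :: "'p \<Rightarrow> bool" where
  "completes_grids y \<longleftrightarrow> y \<in> Points \<Gamma> \<and> (\<forall>w w' x z e. y \<noteq> w \<longrightarrow> x \<noteq> z \<longrightarrow> y \<sim> x \<longrightarrow> y \<sim> z \<longrightarrow>
     w \<sim> x \<longrightarrow> w \<sim> z \<longrightarrow> w' \<sim> x \<longrightarrow> w' \<sim> z \<longrightarrow> y \<sim> e \<longrightarrow> w \<sim> e \<longrightarrow> w' \<sim> e)"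

text \<open>Projectivity of \<open>y\<close> in terms of collinearity: the blocks of
  \<open>w\<close> and \<open>g\<close> in the perp-plane of \<open>y\<close> have a common point.
  Degenerate positions are included to save case distinctions.\<close>

definition meets_all :: "'p \<Rightarrow> bool" where
  "meets_all y \<longleftrightarrow> (\<forall>w\<in>Points \<Gamma>. \<forall>g\<in>Points \<Gamma>. \<exists>e. y \<sim> e \<and> w \<sim> e \<and> g \<sim> e)"

text \<open>Let \<open>t\<close> be the projection of \<open>u\<close> onto the line
  \<open>w'x\<close>, and \<open>s\<close> that of \<open>v\<close> onto the line \<open>ut\<close>.
  By \<open>S\<close>, \<open>s\<close> is collinear with \<open>x\<close> and \<open>z\<close>; the
  absence of triangles then forces \<open>s = t\<close> and \<open>t = w'\<close>.\<close>

lemma regular_in_span: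
  assumes S: "\<And>s c. u \<sim> s \<Longrightarrow> v \<sim> s \<Longrightarrow> y \<sim> c \<Longrightarrow> w \<sim> c \<Longrightarrow> s \<sim> c"
    and uv: "v \<in> Points \<Gamma>" "u \<sim> y" "u \<sim> w"
    and yw: "\<not> y \<sim> w" and xz: "\<not> x \<sim> z" "x \<noteq> u"
    and adj: "y \<sim> x" "y \<sim> z" "w \<sim> x" "w \<sim> z" "w' \<sim> x" "w' \<sim> z"
  shows "u \<sim> w' \<and> v \<sim> w'"
proof -
  have ux: "\<not> u \<sim> x"
    using no_triangle[of u x y w] uv yw xz(2) adj adj_commute by metis
  have "w' \<noteq> x" using adj xz by metis
  obtain L where L: "Inc \<Gamma> w' L" "Inc \<Gamma> x L" "L \<in> Lines \<Gamma>" using adj(5) by (rule line_through)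
  obtain t where t: "Inc \<Gamma> t L" "u \<sim> t" using projection L(3) adj_points(1)[OF uv(2)] by metis
  obtain N where N: "Inc \<Gamma> u N" "Inc \<Gamma> t N" "N \<in> Lines \<Gamma>" using t(2) by (rule line_through)
  obtain s where s: "Inc \<Gamma> s N" "v \<sim> s" using projection N(3) uv(1) by metis
  have su: "u \<sim> s" using N s on_line_adj by metis
  have "s \<sim> x" using S[OF su s(2)] adj by metis
  moreover have "t \<sim> x" using on_line_adj t L by metis
  ultimately have "s = t"
    using on_lineI[of s N t x] s N ux on_line_adj adj_commute by metis
  then have "t \<sim> z" using S[OF su s(2)] adj by metis
  then have "t = w'"
    using on_lineI[of t L w' z] t L adj xz on_line_adj adj_commute by metis
  then show ?thesis using \<open>s = t\<close> s su by metis
qed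

lemma regular_completes_grids:
  assumes "regular_point \<Gamma> y"
  shows "completes_grids y"
  unfolding completes_grids_def
proof (intro conjI allI impI)
  show yP: "y \<in> Points \<Gamma>" using assms by (simp add: regular_point_def)
  fix w w' x z e
  assume *: "y \<noteq> w" "x \<noteq> z" and adj: "y \<sim> x" "y \<sim> z" "w \<sim> x" "w \<sim> z" "w' \<sim> x" "w' \<sim> z"
    "y \<sim> e" "w \<sim> e"
  have wP: "w \<in> Points \<Gamma>" using adj adj_points by blast
  show "w' \<sim> e"
  proof (cases "x \<sim> z")
    case True
    then obtain M where M: "Inc \<Gamma> x M" "Inc \<Gamma> z M" by (rule line_through)
    have "Inc \<Gamma> y M" "Inc \<Gamma> w M" "Inc \<Gamma> w' M" using on_lineI M * adj by metis+
    then show ?thesis using on_lineI[of y M w e] * adj on_line_adj adj_commute by metis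
  next
    case False
    have yw: "\<not> y \<sim> w" using no_triangle[of y w x z] * adj False adj_commute by metis
    then obtain u v where uv: "opposite \<Gamma> u v" "perp \<Gamma> (perp \<Gamma> {y, w}) = perp \<Gamma> {u, v}"
      using assms yP wP by (auto simp: regular_point_def opposite_iff)
    then have P: "u \<in> Points \<Gamma>" "v \<in> Points \<Gamma>" by (auto simp: opposite_iff)
    have S: "s \<sim> c" if "u \<sim> s" "v \<sim> s" "y \<sim> c" "w \<sim> c" for s c
    proof -
      have "s \<in> perp \<Gamma> (perp \<Gamma> {y, w})"
        using that uv(2) mem_perp_pair[OF P] adj_commute by metis
      moreover have "c \<in> perp \<Gamma> {y, w}" using that mem_perp_pair[OF yP wP] adj_commute by metis
      ultimately show ?thesis using mem_perp[OF perp_subset] by blast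
    qed
    have "y \<in> perp \<Gamma> (perp \<Gamma> {y, w})" "w \<in> perp \<Gamma> (perp \<Gamma> {y, w})"
      using mem_perp[OF perp_subset] mem_perp_pair[OF yP wP] yP wP adj_commute by metis+
    then have u: "u \<sim> y" "u \<sim> w" "v \<sim> y" "v \<sim> w"
      using uv(2) mem_perp_pair[OF P] adj_commute by metis+
    \<comment> \<open>This places \<open>w'\<close> in the span of \<open>y\<close> and
      \<open>w\<close>. The auxiliary lemma asks for \<open>x \<noteq> u\<close>, which can be had
      by exchanging \<open>x\<close> and \<open>z\<close>.\<close>
    have "u \<sim> w' \<and> v \<sim> w'"
    proof (cases "x = u")
      case False
      then show ?thesis
        using regular_in_span[of u v y w x z w'] S u P yw \<open>\<not> x \<sim> z\<close> adj by blast
    next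
      case True
      then show ?thesis
        using regular_in_span[of u v y w z x w'] S u P yw \<open>\<not> x \<sim> z\<close> adj * adj_commute by metis
    qed
    then show ?thesis using S adj by blast
  qed
qed

lemma completes_gridsD:
  assumes "completes_grids y" "y \<noteq> w" "x \<noteq> z" "y \<sim> x" "y \<sim> z" "w \<sim> x" "w \<sim> z"
    "w' \<sim> x" "w' \<sim> z" "y \<sim> e" "w \<sim> e"
  shows "w' \<sim> e"
  using assms unfolding completes_grids_def by blast

text \<open>Here the regular point stands in the third place. If \<open>t\<close> is the projection
  of \<open>y\<close> onto the line \<open>ew\<close>, the rule with \<open>y\<close> in first place
  gives \<open>u \<sim> t\<close>, and \<open>t \<noteq> e\<close> would put \<open>u\<close> on
  that line.\<close>

lemma completes_gridsD3:
  assumes "completes_grids y" "u \<noteq> w" "x \<noteq> z" "u \<sim> x" "u \<sim> z" "w \<sim> x" "w \<sim> z"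
    "y \<sim> x" "y \<sim> z" "u \<sim> e" "w \<sim> e"
  shows "y \<sim> e"
proof (cases "x \<sim> z \<or> y = u \<or> y = w")
  case True
  then show ?thesis
  proof (elim disjE)
    assume "x \<sim> z"
    then obtain M where M: "Inc \<Gamma> x M" "Inc \<Gamma> z M" by (rule line_through)
    have "Inc \<Gamma> y M" "Inc \<Gamma> w M" "Inc \<Gamma> u M" using on_lineI M assms by metis+
    then show ?thesis using on_lineI[of u M w e] assms on_line_adj adj_commute by metis
  qed (use assms in auto)
next
  case False
  have uw: "\<not> u \<sim> w" using no_triangle[of u w x z] assms False adj_commute by metis
  have "e \<noteq> w" using uw assms by metis
  obtain N where N: "Inc \<Gamma> e N" "Inc \<Gamma> w N" "N \<in> Lines \<Gamma>"
    using line_through assms(11) adj_commute by metis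
  obtain t where t: "Inc \<Gamma> t N" "y \<sim> t"
    using projection N(3) adj_points(1)[OF assms(8)] by metis
  have "w \<sim> t" using t N on_line_adj by metis
  have "u \<sim> t"
    by (rule completes_gridsD[of y w x z u t]) (use assms False t \<open>w \<sim> t\<close> in auto)
  then have "t = e"
    using on_lineI[of t N e u] t N uw assms on_line_adj adj_commute by metis
  then show ?thesis using t by simp
qed

section \<open>Common neighbours of three points and their spread to opposite points\<close>

lemma meets_allE:
  assumes "meets_all y" "w \<in> Points \<Gamma>" "g \<in> Points \<Gamma>"
  obtains e where "e \<sim> y" "e \<sim> w" "e \<sim> g"
  using assms adj_commute unfolding meets_all_def by metis

text \<open>Take a second common neighbour \<open>w\<close> of \<open>x\<close> and
  \<open>z\<close>, and \<open>k\<close> collinear with \<open>y\<close>, \<open>w\<close> and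
  \<open>g\<close>. By the grid rule the projection of \<open>x\<close> onto the line
  \<open>kg\<close> is collinear with \<open>z\<close>. If \<open>x = k\<close>, then
  \<open>x\<close> and \<open>z\<close> change places.\<close>

lemma meets_line:
  assumes "completes_grids y" "meets_all y" "x \<noteq> z" "y \<sim> x" "y \<sim> z" "g \<in> Points \<Gamma>"
  obtains e where "e \<sim> x" "e \<sim> z" "e \<sim> g"
proof (cases "x \<sim> z")
  case True
  then obtain M where M: "Inc \<Gamma> x M" "Inc \<Gamma> z M" "M \<in> Lines \<Gamma>" by (rule line_through)
  obtain e where "Inc \<Gamma> e M" "g \<sim> e" using projection[OF assms(6) M(3)] by blast
  then show ?thesis using that M on_line_adj adj_commute by metis
next
  case False
  obtain w where w: "w \<sim> x" "w \<sim> z" "w \<noteq> y"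
    using common_neighbour[of x z y] assms adj_points by metis
  obtain k where k: "k \<sim> y" "k \<sim> w" "k \<sim> g"
    using meets_allE[OF assms(2) _ assms(6), of w] w adj_points by metis
  have *: "\<exists>e. e \<sim> x \<and> e \<sim> z \<and> e \<sim> g" if xz: "x' \<noteq> k" "{x', z'} = {x, z}" for x' z'
  proof -
    obtain N where N: "Inc \<Gamma> k N" "Inc \<Gamma> g N" "N \<in> Lines \<Gamma>" using k(3) by (rule line_through)
    have x': "y \<sim> x'" "w \<sim> x'" "y \<sim> z'" "w \<sim> z'" using xz assms w by (auto simp: doubleton_eq_iff)
    obtain e where e: "Inc \<Gamma> e N" "x' \<sim> e" using projection N(3) adj_points(2)[OF x'(1)] by metis
    have "e \<sim> k" "e \<sim> g" using e N on_line_adj by metis+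
    have "e \<sim> z'"
      by (rule completes_gridsD[OF assms(1), of w x' k])
         (use x' e k w xz \<open>e \<sim> k\<close> in \<open>auto simp: adj_commute\<close>)
    then show ?thesis using e \<open>e \<sim> g\<close> xz adj_commute by (metis doubleton_eq_iff)
  qed
  show ?thesis using *[of x z] *[of z x] assms(3) that by (cases "x = k") auto
qed

text \<open>By \<open>nearer\<close>, a block of \<open>q\<close> given by \<open>z'\<close>
  contains one given by a point \<open>z\<close> collinear with \<open>p\<close>. So
  \<open>w\<close> and \<open>g\<close> may be replaced by points collinear with \<open>p\<close>,
  where \<open>meets_line\<close> applies.\<close>

lemma meets_all_transfer:
  assumes p: "completes_grids p" "meets_all p" and q: "completes_grids q" and pq: "\<not> p \<sim> q"
  shows "meets_all q"
  unfolding meets_all_def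
proof (intro ballI)
  have P: "p \<in> Points \<Gamma>" "q \<in> Points \<Gamma>" using p q by (auto simp: completes_grids_def)
  have nearer: "\<exists>z. z \<sim> p \<and> (\<forall>e. q \<sim> e \<longrightarrow> z \<sim> e \<longrightarrow> z' \<sim> e)"
    if z': "z' \<in> Points \<Gamma>" "\<not> q \<sim> z'" for z'
  proof -
    obtain u v where u: "u \<sim> q" "u \<sim> z'" and v: "v \<sim> q" "v \<sim> z'" "v \<noteq> u"
      using common_neighbour P z' by metis
    obtain z where z: "z \<sim> p" "z \<sim> u" "z \<sim> v"
      using meets_allE[OF p(2), of u v] u v adj_points by metis
    have "q \<noteq> z" using z pq adj_commute by metis
    have "z' \<sim> e" if "q \<sim> e" "z \<sim> e" for e
      by (rule completes_gridsD[OF q, of z u v])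
         (use u v z that \<open>q \<noteq> z\<close> in \<open>auto simp: adj_commute\<close>)
    then show ?thesis using z by blast
  qed
  fix w g assume wg: "w \<in> Points \<Gamma>" "g \<in> Points \<Gamma>"
  show "\<exists>e. q \<sim> e \<and> w \<sim> e \<and> g \<sim> e"
  proof (cases "q \<sim> w \<or> q \<sim> g")
    case True
    have *: "\<exists>e. q \<sim> e \<and> w \<sim> e \<and> g \<sim> e" if qw: "q \<sim> w" "g \<in> Points \<Gamma>" for w g
    proof -
      obtain M where M: "Inc \<Gamma> q M" "Inc \<Gamma> w M" "M \<in> Lines \<Gamma>" using qw(1) by (rule line_through)
      obtain e where "Inc \<Gamma> e M" "g \<sim> e" using projection[OF qw(2) M(3)] by blast
      then show ?thesis using M on_line_adj by metis
    qed
    then show ?thesis using True wg by metis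
  next
    case False
    obtain z1 where z1: "z1 \<sim> p" "\<And>e. q \<sim> e \<Longrightarrow> z1 \<sim> e \<Longrightarrow> w \<sim> e" using nearer wg False by metis
    obtain z2 where z2: "z2 \<sim> p" "\<And>e. q \<sim> e \<Longrightarrow> z2 \<sim> e \<Longrightarrow> g \<sim> e" using nearer wg False by metis
    have "\<exists>e. q \<sim> e \<and> z1 \<sim> e \<and> z2 \<sim> e"
    proof (cases "z1 = z2")
      case True
      then show ?thesis
        using common_neighbour[of q z1] P z1 adj_points adj_commute by metis
    next
      case False
      then show ?thesis
        using meets_line[OF p False _ _ P(2)] z1 z2 adj_commute by metis
    qed
    then show ?thesis using z1 z2 by blast
  qed
qed

lemma projective_meets_all:
  assumes "projective_point \<Gamma> p"
  shows "meets_all p"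
  unfolding meets_all_def
proof (intro ballI)
  fix w g assume wg: "w \<in> Points \<Gamma>" "g \<in> Points \<Gamma>"
  have P: "p \<in> Points \<Gamma>" using assms by (auto simp: projective_point_def regular_point_def)
  have *: "\<exists>e. p \<sim> e \<and> w \<sim> e \<and> g \<sim> e" if pw: "p \<sim> w" "g \<in> Points \<Gamma>" for w g
  proof -
    obtain M where M: "Inc \<Gamma> p M" "Inc \<Gamma> w M" "M \<in> Lines \<Gamma>" using pw(1) by (rule line_through)
    obtain e where "Inc \<Gamma> e M" "g \<sim> e" using projection[OF pw(2) M(3)] by blast
    then show ?thesis using M on_line_adj by metis
  qed
  show "\<exists>e. p \<sim> e \<and> w \<sim> e \<and> g \<sim> e"
  proof (cases "p \<sim> w \<or> p \<sim> g")
    case True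
    then show ?thesis using * wg by metis
  next
    case False
    have B: "perp \<Gamma> {p, w} \<in> dual_net_blocks \<Gamma> p" "perp \<Gamma> {p, g} \<in> dual_net_blocks \<Gamma> p"
      using wg False P by (auto simp: dual_net_blocks_def opposite_iff)
    have "perp \<Gamma> {p, w} \<inter> perp \<Gamma> {p, g} \<noteq> {}"
    proof (cases "perp \<Gamma> {p, w} = perp \<Gamma> {p, g}")
      case True
      then show ?thesis
        using common_neighbour[OF P wg(1)] mem_perp_pair[OF P wg(1)] by (metis Int_absorb empty_iff)
    next
      case False
      then show ?thesis using assms B by (auto simp: projective_point_def dual_affine_plane_def)
    qed
    then show ?thesis
      using mem_perp_pair[OF P wg(1)] mem_perp_pair[OF P wg(2)] adj_commute by blast
  qed
qed

lemma off_line_of_center: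
  assumes "a \<sim> p" "b \<sim> p" "a \<sim> b" "a \<noteq> b" "u \<sim> a" "u \<sim> b" "p \<in> Points \<Gamma>"
  shows "u \<sim> p"
  using no_triangle[of a b p u] assms adj_commute by metis

text \<open>The point \<open>b\<close> is the projection of \<open>y\<close> onto the line
  \<open>ap\<close>. This is the parallel axiom of the dual net.\<close>

lemma block_parallel_class:
  assumes p: "completes_grids p" and a: "a \<sim> p" "a \<noteq> p" and y: "y \<in> Points \<Gamma>" "\<not> p \<sim> y"
    and ay: "\<not> a \<sim> y" 
  shows "\<exists>!b. b \<sim> p \<and> b \<sim> y \<and> b \<sim> a"
proof -
  obtain M where M: "Inc \<Gamma> a M" "Inc \<Gamma> p M" "M \<in> Lines \<Gamma>" using a(1) by (rule line_through)
  obtain b where b: "Inc \<Gamma> b M" "y \<sim> b" using projection[OF y(1) M(3)] by blast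
  show ?thesis
  proof (rule ex1I[of _ b])
    show "b \<sim> p \<and> b \<sim> y \<and> b \<sim> a" using b M on_line_adj adj_commute by metis
    fix b' assume b': "b' \<sim> p \<and> b' \<sim> y \<and> b' \<sim> a"
    then have "Inc \<Gamma> b' M" using on_lineI[of a M p b'] M a by metis
    then show "b' = b" using on_lineI[of b M b' y] b b' M y on_line_adj adj_commute by metis
  qed
qed

lemma outside_common_neighbour:
  assumes "a \<sim> p" "b \<sim> p" "\<not> a \<sim> b" "p \<in> Points \<Gamma>"
  obtains y where "y \<sim> a" "y \<sim> b" "\<not> y \<sim> p"
proof -
  obtain y where y: "y \<sim> a" "y \<sim> b" "y \<noteq> p"
    using common_neighbour assms adj_points by metis
  then have "\<not> y \<sim> p" using no_triangle[of y p a b] assms adj_commute by metis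
  then show ?thesis using that y by blast
qed

lemma other_direction:
  assumes "a \<sim> p" "a \<noteq> p"
  obtains N b b' where "Inc \<Gamma> p N" "Inc \<Gamma> b N" "Inc \<Gamma> b' N" "b \<noteq> b'" "b \<noteq> p" "b' \<noteq> p"
    "\<not> a \<sim> b" "\<not> a \<sim> b'" "\<not> Inc \<Gamma> a N" "N \<noteq> M"
proof -
  have p: "p \<in> Points \<Gamma>" using assms adj_points by blast
  obtain K where K: "Inc \<Gamma> a K" "Inc \<Gamma> p K" using assms(1) by (rule line_through)
  obtain N where N: "Inc \<Gamma> p N" "N \<noteq> K" "N \<noteq> M" using third_line[OF p] by metis
  have N_line: "N \<in> Lines \<Gamma>" using N Inc_carrier by blast
  obtain b where b: "Inc \<Gamma> b N" "b \<noteq> p" using third_point[OF N_line, of p p] by metis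
  obtain b' where b': "Inc \<Gamma> b' N" "b' \<noteq> p" "b' \<noteq> b" using third_point[OF N_line] by metis
  have aN: "\<not> Inc \<Gamma> a N" using linear[of a p K N] K N assms by blast
  have "\<not> a \<sim> c" if "Inc \<Gamma> c N" "c \<noteq> p" for c
    using on_lineI[of p N c a] N that aN assms by blast
  then show ?thesis using that[OF N(1) b(1) b'(1)] b b' aN N(3) by metis
qed

text \<open>Needed to connect two collinear points of \<open>\<O>\<close>. The point
  \<open>r\<close> is collinear with \<open>a\<close> and \<open>d\<close>, where \<open>d\<close>
  avoids the projection \<open>c\<close> of \<open>y\<close> onto \<open>K\<close>. Were
  \<open>r \<sim> x\<close>, the grid rule at \<open>p\<close> would give \<open>r \<sim> c\<close>
  and put \<open>r\<close> on \<open>K\<close>.\<close>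

lemma good_opposite_both:
  assumes p: "p \<in> \<O>" "completes_grids p" and x: "x \<sim> p" "x \<noteq> p"
    and second: "\<And>u v. p \<sim> u \<Longrightarrow> p \<sim> v \<Longrightarrow> \<not> u \<sim> v \<Longrightarrow> \<exists>q\<in>\<O>. q \<noteq> p \<and> q \<sim> u \<and> q \<sim> v"
  shows "\<exists>r\<in>\<O>. \<not> r \<sim> p \<and> \<not> r \<sim> x"
proof -
  have pP: "p \<in> Points \<Gamma>" using x adj_points by blast
  obtain N a where a: "Inc \<Gamma> p N" "Inc \<Gamma> a N" "a \<noteq> p" "\<not> x \<sim> a"
    using other_direction[OF x] by metis
  have ap: "a \<sim> p" using a on_line_adj by blast
  obtain y where y: "y \<sim> x" "y \<sim> a" "\<not> y \<sim> p"
    using outside_common_neighbour[OF x(1) ap a(4) pP] by metis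
  obtain K where K: "Inc \<Gamma> p K" "\<not> Inc \<Gamma> x K" "K \<noteq> N" using other_direction[OF x] by metis
  have K_line: "K \<in> Lines \<Gamma>" using K Inc_carrier by blast
  obtain c where c: "Inc \<Gamma> c K" "y \<sim> c" using projection[OF adj_points(1)[OF y(1)] K_line] by blast
  obtain d where d: "Inc \<Gamma> d K" "d \<noteq> p" "d \<noteq> c" using third_point[OF K_line] by metis
  have dp: "d \<sim> p" "c \<sim> p" using c d K on_line_adj by metis+
  have "\<not> a \<sim> d"
  proof
    assume "a \<sim> d"
    then have "Inc \<Gamma> a K" using on_lineI[of p K d a] K d ap by metis
    then show False using linear[of a p K N] a K by blast
  qed
  then obtain r where r: "r \<in> \<O>" "r \<noteq> p" "r \<sim> a" "r \<sim> d"
    using second[of a d] ap dp adj_commute by metis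
  have rp: "\<not> r \<sim> p" using no_triangle[of r p a d] r \<open>\<not> a \<sim> d\<close> ap dp adj_commute by metis
  have "\<not> r \<sim> x"
  proof
    assume rx: "r \<sim> x"
    have "p \<noteq> y" "a \<noteq> x" using y(3) a(4) adj_refl pP adj_points(1)[OF x(1)] by metis+
    then have "r \<sim> c"
      by (intro completes_gridsD[OF p(2), of y a x r c]) (use x ap y rx r dp c in \<open>auto simp: adj_commute\<close>)
    then have "Inc \<Gamma> r K" using on_lineI[of c K d r] c d r by metis
    then show False using rp K on_line_adj by blast
  qed
  then show ?thesis using r rp by blast
qed

end


section \<open>The little theorem of Desargues in a perp-plane\<close>

text \<open>These are the grid rule, projectivity, and (TP) in the following form: since
  \<open>{x, y}\<^sup>\<bottom>\<close> contains the point \<open>p\<close> of \<open>\<O>\<close>,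
  it contains a second one.\<close>

locale quadrangle_with_good_points = generalized_quadrangle \<Gamma>
  for \<Gamma> :: "('p, 'l) geometry" +
  fixes \<O> :: "'p set"
  assumes good_grids: "p \<in> \<O> \<Longrightarrow> completes_grids p"
    and good_meets: "p \<in> \<O> \<Longrightarrow> meets_all p"
    and second_good: "\<lbrakk>p \<in> \<O>; p \<sim> x; p \<sim> y; \<not> x \<sim> y\<rbrakk> \<Longrightarrow> \<exists>q\<in>\<O>. q \<noteq> p \<and> q \<sim> x \<and> q \<sim> y"
begin

lemma good_point: "p \<in> \<O> \<Longrightarrow> p \<in> Points \<Gamma>"
  using good_grids by (auto simp: completes_grids_def)

text \<open>Rows \<open>y\<close>, \<open>w\<close>, \<open>w'\<close> and columns \<open>x\<close>,
  \<open>z\<close>, \<open>e\<close>: eight collinearities give the ninth. Below, a point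
  \<open>u\<close> also stands for the plane \<open>u\<^sup>\<bottom>\<close>; the rule then says
  that a plane through two points of a line contains the line.\<close>

lemma grid:
  fixes y w w' x z e
  assumes "y \<in> \<O> \<or> w \<in> \<O>" "y \<noteq> w" "x \<noteq> z" "y \<sim> x" "y \<sim> z" "w \<sim> x" "w \<sim> z" "w' \<sim> x" "w' \<sim> z"
    "y \<sim> e" "w \<sim> e"
  shows "w' \<sim> e"
  using assms good_grids completes_gridsD[of y w x z w' e] completes_gridsD[of w y x z w' e] by blast

lemma grid_last:
  fixes y w w' x z e
  assumes "w' \<in> \<O>" "y \<noteq> w" "x \<noteq> z" "y \<sim> x" "y \<sim> z" "w \<sim> x" "w \<sim> z" "w' \<sim> x" "w' \<sim> z"
    "y \<sim> e" "w \<sim> e"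
  shows "w' \<sim> e"
  using assms good_grids completes_gridsD3 by blast

text \<open>In the spatial picture, three planes have a common point as soon as one belongs to
  \<open>\<O>\<close>.\<close>

lemma meet:
  assumes "p \<in> \<O>" "w \<in> Points \<Gamma>" "g \<in> Points \<Gamma>"
  obtains e where "e \<sim> p" "e \<sim> w" "e \<sim> g"
  using meets_allE good_meets assms by blast

lemma meet_line:
  assumes "p \<in> \<O>" "x \<noteq> z" "p \<sim> x" "p \<sim> z" "g \<in> Points \<Gamma>"
  obtains e where "e \<sim> x" "e \<sim> z" "e \<sim> g"
  using meets_line good_meets good_grids assms by metis

lemma good_opposite:
  assumes "p \<in> \<O>" "a \<sim> p" "b \<sim> p" "\<not> a \<sim> b"
  obtains u where "u \<in> \<O>" "\<not> u \<sim> p" "u \<sim> a" "u \<sim> b"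
proof -
  obtain u where u: "u \<in> \<O>" "u \<noteq> p" "u \<sim> a" "u \<sim> b"
    using second_good assms adj_commute by metis
  have "\<not> u \<sim> p" using no_triangle[of u p a b] u assms adj_commute by metis
  then show ?thesis using that u by blast
qed

definition vertical_pair :: "'p \<Rightarrow> 'p \<Rightarrow> 'p \<Rightarrow> bool" where
  "vertical_pair p a b \<longleftrightarrow> p \<noteq> a \<and> p \<noteq> b \<and> a \<noteq> b \<and> a \<sim> p \<and> b \<sim> p \<and> a \<sim> b"

lemma vertical_pair_sym: "vertical_pair p a b \<Longrightarrow> vertical_pair p b a"
  by (auto simp: vertical_pair_def adj_commute)

lemma vertical_pair_off: "vertical_pair p a b \<Longrightarrow> u \<sim> a \<Longrightarrow> \<not> u \<sim> p \<Longrightarrow> \<not> u \<sim> b"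
  using off_line_of_center[of a p b u] adj_points by (auto simp: vertical_pair_def)

text \<open>The projection of \<open>e\<close> onto the line of \<open>p\<close>, \<open>a\<close>,
  \<open>b\<close> is, in the spatial picture, a plane through this line and
  \<open>e\<close>.\<close>

lemma vertical_projection:
  assumes "vertical_pair p a b" "e \<in> Points \<Gamma>"
  obtains w where "w \<sim> p" "w \<sim> a" "w \<sim> b" "w \<sim> e"
proof -
  obtain M where M: "Inc \<Gamma> p M" "Inc \<Gamma> a M" "M \<in> Lines \<Gamma>"
    using assms line_through unfolding vertical_pair_def by (metis adj_commute)
  then have "Inc \<Gamma> b M"
    using on_lineI[of p M a b] assms adj_commute unfolding vertical_pair_def by metis
  then show ?thesis
    using projection[OF assms(2) M(3)] M that on_line_adj adj_commute by metis
qed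

lemma vertical_disjoint:
  assumes "\<not> a \<sim> a'" "w \<noteq> p" "w \<sim> p" "w \<sim> a" "w \<sim> a'" "a \<sim> p" "a' \<sim> p"
  shows False
  using no_triangle[of w p a a'] assms adj_commute by metis

section \<open>Perspective triangles and their lifts to space\<close>

definition frame :: "'p \<Rightarrow> 'p \<Rightarrow> 'p \<Rightarrow> 'p \<Rightarrow> 'p \<Rightarrow> 'p \<Rightarrow> 'p \<Rightarrow> bool" where
  "frame p a1 a2 a3 b1 b2 b3 \<longleftrightarrow> p \<in> \<O> \<and>
     vertical_pair p a1 b1 \<and> vertical_pair p a2 b2 \<and> vertical_pair p a3 b3 \<and>
     \<not> a1 \<sim> a2 \<and> \<not> a1 \<sim> a3 \<and> \<not> a2 \<sim> a3 \<and> \<not> b1 \<sim> b2 \<and> \<not> b1 \<sim> b3 \<and> \<not> b2 \<sim> b3"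

definition side :: "'p \<Rightarrow> 'p \<Rightarrow> 'p \<Rightarrow> 'p \<Rightarrow> 'p \<Rightarrow> bool" where
  "side p u a b c \<longleftrightarrow> u \<in> \<O> \<and> \<not> u \<sim> p \<and> u \<sim> a \<and> u \<sim> b \<and> \<not> u \<sim> c"

text \<open>The planes \<open>u\<close> and \<open>v\<close> pass through the sides
  \<open>aa'\<close> and \<open>bb'\<close> and intersect in the line \<open>ee'\<close>, which
  therefore meets the plane of \<open>p\<close> where the two sides meet.\<close>

definition lifted_side :: "'p \<Rightarrow> 'p \<Rightarrow> 'p \<Rightarrow> 'p \<Rightarrow> 'p \<Rightarrow> 'p \<Rightarrow> 'p \<Rightarrow> bool" where
  "lifted_side p e e' a a' b b' \<longleftrightarrow> (\<exists>u v. (u \<in> \<O> \<or> v \<in> \<O>) \<and> u \<noteq> v \<and> u \<noteq> p \<and> v \<noteq> p \<and>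
     u \<sim> a \<and> u \<sim> a' \<and> v \<sim> b \<and> v \<sim> b' \<and> u \<sim> e \<and> u \<sim> e' \<and> v \<sim> e \<and> v \<sim> e')"

text \<open>Of the 5-point only \<open>e1\<close>, \<open>e2\<close>, \<open>e3\<close> are
  recorded: their plane cuts out the axis.\<close>

definition lifted :: "'p \<Rightarrow> 'p \<Rightarrow> 'p \<Rightarrow> 'p \<Rightarrow> 'p \<Rightarrow> 'p \<Rightarrow> 'p \<Rightarrow> bool" where
  "lifted p a1 a2 a3 b1 b2 b3 \<longleftrightarrow> (\<exists>e1 e2 e3.
     \<not> e1 \<sim> p \<and> \<not> e2 \<sim> p \<and> \<not> e3 \<sim> p \<and> e1 \<noteq> e2 \<and> e1 \<noteq> e3 \<and> e2 \<noteq> e3 \<and>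
     lifted_side p e1 e2 a1 a2 b1 b2 \<and> lifted_side p e1 e3 a1 a3 b1 b3 \<and>
     lifted_side p e2 e3 a2 a3 b2 b3)"

text \<open>The 5-point is \<open>e1, \<dots>, e5\<close>: its lines meet the plane of \<open>p\<close> in the points of the Desargues
  configuration, namely \<open>e\<^sub>i e\<^sub>4\<close> in \<open>a\<^sub>i\<close>, \<open>e\<^sub>i e\<^sub>5\<close> in \<open>b\<^sub>i\<close> and \<open>e\<^sub>4 e\<^sub>5\<close> in \<open>p\<close>.  The plane through
  \<open>e\<^sub>i, e\<^sub>j, e\<^sub>4\<close> (\<open>e\<^sub>i, e\<^sub>j, e\<^sub>5\<close>; \<open>e\<^sub>i, e\<^sub>4, e\<^sub>5\<close>) belongs to \<open>u\<^sub>i\<^sub>j\<close> (\<open>v\<^sub>i\<^sub>j\<close>; \<open>w\<^sub>i\<close>).  The last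
  assumption says that the four planes chosen in \<open>\<O>\<close> do not share the point \<open>e1\<close>.\<close>

lemma lift_exists:
  assumes frame: "frame p a1 a2 a3 b1 b2 b3"
    and sides: "side p u12 a1 a2 a3" "side p u13 a1 a3 a2" "side p v12 b1 b2 b3" "side p v23 b2 b3 b1"
    and e1: "e1 \<sim> u12" "e1 \<sim> u13" "e1 \<sim> v12" "\<not> e1 \<sim> v23"
  shows "lifted p a1 a2 a3 b1 b2 b3"
proof -
  have p: "p \<in> \<O>" "p \<in> Points \<Gamma>"
    and vp: "vertical_pair p a1 b1" "vertical_pair p a2 b2" "vertical_pair p a3 b3"
    and na: "\<not> a1 \<sim> a2" "\<not> a1 \<sim> a3" "\<not> a2 \<sim> a3" "\<not> b1 \<sim> b2" "\<not> b1 \<sim> b3" "\<not> b2 \<sim> b3"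
    using frame good_point by (auto simp: frame_def)
  have ap: "a1 \<sim> p" "a2 \<sim> p" "a3 \<sim> p" "b1 \<sim> p" "b2 \<sim> p" "b3 \<sim> p"
    using vp by (auto simp: vertical_pair_def)
  have u: "u12 \<in> \<O>" "u13 \<in> \<O>" "v12 \<in> \<O>" "v23 \<in> \<O>"
    "u12 \<sim> a1" "u12 \<sim> a2" "u13 \<sim> a1" "u13 \<sim> a3" "v12 \<sim> b1" "v12 \<sim> b2" "v23 \<sim> b2" "v23 \<sim> b3"
    and nu: "\<not> u12 \<sim> p" "\<not> u13 \<sim> p" "\<not> v12 \<sim> p" "\<not> v23 \<sim> p"
    "\<not> u12 \<sim> a3" "\<not> u13 \<sim> a2" "\<not> v12 \<sim> b3" "\<not> v23 \<sim> b1"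
    using sides by (auto simp: side_def)
  have nv: "\<not> u12 \<sim> b1" "\<not> u12 \<sim> b2" "\<not> u13 \<sim> b1" "\<not> u13 \<sim> b3"
    "\<not> v12 \<sim> a1" "\<not> v12 \<sim> a2" "\<not> v23 \<sim> a2" "\<not> v23 \<sim> a3"
    using vertical_pair_off u nu vp vertical_pair_sym by metis+
  have upt: "u12 \<in> Points \<Gamma>" "u13 \<in> Points \<Gamma>" "v12 \<in> Points \<Gamma>" "v23 \<in> Points \<Gamma>"
    using u good_point by auto
  have neu: "u12 \<noteq> u13" "v12 \<noteq> v23" using u nu by metis+
  have ne1: "e1 \<noteq> a1" using e1 nv adj_commute by metis
  \<comment> \<open>Otherwise the planes \<open>p\<close>, \<open>u12\<close> and \<open>u13\<close>
    would share the line \<open>a1 e1\<close>, so that \<open>u13\<close> would contain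
    \<open>a2\<close>.\<close>
  have e1p: "\<not> e1 \<sim> p"
  proof
    assume "e1 \<sim> p"
    then have "u13 \<sim> a2"
      by (intro grid[of p u12 a1 e1 u13 a2])
         (use p u ap e1 ne1 nu adj_refl[OF p(2)] in \<open>auto simp: adj_commute\<close>)
    then show False using nu by simp
  qed
  obtain e2 where e2: "e2 \<sim> u12" "e2 \<sim> v12" "e2 \<sim> v23" using meet[OF u(1) upt(3,4)] by metis
  have ne2: "e2 \<noteq> b2" using e2 nv adj_commute by metis
  have e2p: "\<not> e2 \<sim> p"
  proof
    assume "e2 \<sim> p"
    then have "v23 \<sim> b1"
      by (intro grid[of p v12 b2 e2 v23 b1])
         (use p u ap e2 ne2 nu adj_refl[OF p(2)] in \<open>auto simp: adj_commute\<close>)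
    then show False using nu by simp
  qed
  obtain w1 where w1: "w1 \<sim> p" "w1 \<sim> a1" "w1 \<sim> b1" "w1 \<sim> e1"
    using vertical_projection[OF vp(1)] adj_points(1)[OF e1(1)] by metis
  obtain w2 where w2: "w2 \<sim> p" "w2 \<sim> a2" "w2 \<sim> b2" "w2 \<sim> e2"
    using vertical_projection[OF vp(2)] adj_points(1)[OF e2(1)] by metis
  have wp: "w1 \<noteq> p" "w2 \<noteq> p" using w1 w2 e1p e2p adj_commute by metis+
  have w12: "w1 \<noteq> w2"
    using vertical_disjoint[of a1 a2 w1 p] w1 w2 wp na ap by metis
  have neuw: "w1 \<noteq> u12" "w1 \<noteq> u13" "w2 \<noteq> u12" "w1 \<noteq> v12" "w2 \<noteq> v12" "w2 \<noteq> v23"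
    using w1 w2 nu by metis+
  \<comment> \<open>Cut out by \<open>u12\<close>, \<open>u13\<close> and \<open>w2\<close>, the
    point also lies in \<open>w1\<close>, since this plane contains the line \<open>e1 a1\<close>
    common to \<open>u12\<close> and \<open>u13\<close>. Likewise for \<open>e5\<close> with
    \<open>v12\<close> and \<open>v23\<close>.\<close>
  obtain e4 where e4: "e4 \<sim> u12" "e4 \<sim> u13" "e4 \<sim> w2"
    using meet[OF u(1) upt(2)] adj_points(1)[OF w2(1)] by metis
  have e4w1: "w1 \<sim> e4"
    by (rule grid[of u12 u13 e1 a1 w1 e4]) (use u e1 ne1 neu w1 e4 in \<open>auto simp: adj_commute\<close>)
  obtain e5 where e5: "e5 \<sim> v12" "e5 \<sim> v23" "e5 \<sim> w1"
    using meet[OF u(3) upt(4)] adj_points(1)[OF w1(1)] by metis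
  have e5w2: "w2 \<sim> e5"
    by (rule grid[of v12 v23 e2 b2 w2 e5]) (use u e2 ne2 neu w2 e5 in \<open>auto simp: adj_commute\<close>)
  have e45: "e4 \<noteq> a1" "e5 \<noteq> b2"
    using vertical_disjoint[of a1 a2 w2 p] vertical_disjoint[of b1 b2 w1 p] w1 w2 wp na ap e4 e5
      adj_commute by metis+
  have e4': "e4 \<noteq> p" "e4 \<noteq> a2" "e4 \<noteq> a3" using e4 nu adj_commute by metis+
  have e5': "e5 \<noteq> p" "e5 \<noteq> b1" "e5 \<noteq> b3" using e5 nu adj_commute by metis+
  have e4p: "\<not> e4 \<sim> p"
  proof
    assume "e4 \<sim> p"
    then have "u13 \<sim> a2"
      by (intro grid[of p u12 a1 e4 u13 a2])
         (use p u ap e4 e45 nu adj_refl[OF p(2)] in \<open>auto simp: adj_commute\<close>)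
    then show False using nu by simp
  qed
  have e5p: "\<not> e5 \<sim> p"
  proof
    assume "e5 \<sim> p"
    then have "v23 \<sim> b1"
      by (intro grid[of p v12 b2 e5 v23 b1])
         (use p u ap e5 e45 nu adj_refl[OF p(2)] in \<open>auto simp: adj_commute\<close>)
    then show False using nu by simp
  qed
  \<comment> \<open>Chosen through \<open>e4\<close>, the plane \<open>w3\<close> contains
    \<open>e5\<close> too: \<open>w1\<close> and \<open>w2\<close> share \<open>p\<close>,
    \<open>e4\<close> and \<open>e5\<close>, which are thus on a line of the spatial
    picture.\<close>
  obtain w3 where w3: "w3 \<sim> p" "w3 \<sim> a3" "w3 \<sim> b3" "w3 \<sim> e4"
    using vertical_projection[OF vp(3)] adj_points(1)[OF e4(1)] by metis
  have w3': "w3 \<noteq> p" "w3 \<noteq> u13" "w3 \<noteq> v23" using w3 e4p nu adj_commute by metis+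
  have w3e5: "e5 \<sim> w3"
    by (rule grid[of p e4 w1 w2 e5 w3]) (use p e4 e4' e5 e4w1 e5w2 w1 w2 w3 w12 in \<open>auto simp: adj_commute\<close>)
  obtain e3 where e3: "e3 \<sim> u13" "e3 \<sim> v23" "e3 \<sim> w3"
    using meet[OF u(2) upt(4)] adj_points(1)[OF w3(1)] by metis
  have e3p: "\<not> e3 \<sim> p"
  proof
    assume "e3 \<sim> p"
    then have "e3 \<sim> a3" "e3 \<sim> b3"
      using no_triangle[of w3 p e3 a3] no_triangle[of w3 p e3 b3] w3 w3' e3 ap adj_commute by metis+
    then have "e3 = a3" "e3 = b3"
      using off_line_of_center[of e3 p a3 u13] off_line_of_center[of e3 p b3 v23]
        \<open>e3 \<sim> p\<close> ap u nu e3 p adj_commute by metis+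
    then show False using vp by (auto simp: vertical_pair_def)
  qed
  \<comment> \<open>The last planes \<open>u23\<close> and \<open>v13\<close> may lie outside
    \<open>\<O>\<close>; it is their partners \<open>v23\<close> and \<open>u13\<close> that belong
    to it.\<close>
  obtain u23 where u23: "u23 \<sim> a2" "u23 \<sim> a3" "u23 \<sim> e4"
    using meet_line[OF p(1), of a2 a3 e4] ap na e4 adj_refl adj_points adj_commute by metis
  obtain v13 where v13: "v13 \<sim> b1" "v13 \<sim> b3" "v13 \<sim> e5"
    using meet_line[OF p(1), of b1 b3 e5] ap na e5 adj_refl adj_points adj_commute by metis
  have ne: "u12 \<noteq> v12" "u13 \<noteq> v13" "u23 \<noteq> v23" "u23 \<noteq> p" "v13 \<noteq> p"
    using nv u v13 u23 e4p e5p adj_commute by metis+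
  have 1: "u23 \<sim> e2"
    by (rule grid[of u12 w2 e4 a2 u23 e2]) (use u e4 e4' w2 u23 e2 neuw in \<open>auto simp: adj_commute\<close>)
  have 2: "u23 \<sim> e3"
    by (rule grid[of u13 w3 e4 a3 u23 e3]) (use u e4 e4' w3 w3' u23 e3 neuw in \<open>auto simp: adj_commute\<close>)
  have 3: "v13 \<sim> e1"
    by (rule grid[of v12 w1 e5 b1 v13 e1]) (use u e5 e5' w1 v13 e1 neuw in \<open>auto simp: adj_commute\<close>)
  have 4: "v13 \<sim> e3"
    by (rule grid[of v23 w3 e5 b3 v13 e3]) (use u e5 e5' w3 w3' w3e5 v13 e3 in \<open>auto simp: adj_commute\<close>)
  have d: "e1 \<noteq> e2" "e1 \<noteq> e3" using e1 e2 e3 by metis+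
  \<comment> \<open>If the points coincided, \<open>u12\<close> and \<open>u13\<close> would share
    the line \<open>e1 e2\<close>, which contains \<open>a1\<close> and lies in
    \<open>v12\<close>.\<close>
  have d': "e2 \<noteq> e3"
  proof
    assume "e2 = e3"
    then have "v12 \<sim> a1"
      by (intro grid[of u12 u13 e1 e2 v12 a1]) (use u e1 e2 e3 d neu in \<open>auto simp: adj_commute\<close>)
    then show False using nv by simp
  qed
  have "lifted_side p e1 e2 a1 a2 b1 b2"
    unfolding lifted_side_def
    by (rule exI[of _ u12], rule exI[of _ v12]) (use u e1 e2 ne nu p adj_refl in \<open>auto simp: adj_commute\<close>)
  moreover have "lifted_side p e1 e3 a1 a3 b1 b3"
    unfolding lifted_side_def
    by (rule exI[of _ u13], rule exI[of _ v13])
       (use u e1 e3 3 4 v13 ne nu p adj_refl in \<open>auto simp: adj_commute\<close>)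
  moreover have "lifted_side p e2 e3 a2 a3 b2 b3"
    unfolding lifted_side_def
    by (rule exI[of _ u23], rule exI[of _ v23])
       (use u e2 e3 1 2 u23 ne nu p adj_refl in \<open>auto simp: adj_commute\<close>)
  ultimately show ?thesis
    unfolding lifted_def using e1p e2p e3p d d' by blast
qed

section \<open>Closing the Desargues configuration\<close>

definition on_block :: "'p \<Rightarrow> 'p \<Rightarrow> 'p \<Rightarrow> 'p \<Rightarrow> bool" where
  "on_block p a b i \<longleftrightarrow> i \<sim> p \<and> (\<exists>u. u \<noteq> p \<and> u \<sim> a \<and> u \<sim> b \<and> u \<sim> i)"

lemma on_block_adj:
  assumes "p \<in> \<O>" "a \<sim> p" "b \<sim> p" "a \<noteq> b" "on_block p a b i" "v \<sim> a" "v \<sim> b"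
  shows "v \<sim> i"
proof -
  obtain u where "u \<noteq> p" "u \<sim> a" "u \<sim> b" "u \<sim> i" "i \<sim> p" using assms by (auto simp: on_block_def)
  then show ?thesis by (intro grid[of p u a b v i]) (use assms in \<open>auto simp: adj_commute\<close>)
qed

definition closes :: "'p \<Rightarrow> 'p \<Rightarrow> 'p \<Rightarrow> 'p \<Rightarrow> 'p \<Rightarrow> 'p \<Rightarrow> 'p \<Rightarrow> bool" where
  "closes p a1 a2 a3 b1 b2 b3 \<longleftrightarrow> (\<forall>L i12 i23 i13. Inc \<Gamma> p L \<longrightarrow> Inc \<Gamma> i12 L \<longrightarrow> Inc \<Gamma> i23 L \<longrightarrow>
     on_block p a1 a2 i12 \<longrightarrow> on_block p b1 b2 i12 \<longrightarrow> on_block p a2 a3 i23 \<longrightarrow> on_block p b2 b3 i23 \<longrightarrow>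
     on_block p a1 a3 i13 \<longrightarrow> on_block p b1 b3 i13 \<longrightarrow> Inc \<Gamma> i13 L)"

lemma frameD:
  assumes "frame p a1 a2 a3 b1 b2 b3"
  shows "p \<in> \<O>" "p \<in> Points \<Gamma>"
    "vertical_pair p a1 b1" "vertical_pair p a2 b2" "vertical_pair p a3 b3"
    "\<not> a1 \<sim> a2" "\<not> a1 \<sim> a3" "\<not> a2 \<sim> a3" "\<not> b1 \<sim> b2" "\<not> b1 \<sim> b3" "\<not> b2 \<sim> b3"
    "a1 \<sim> p" "a2 \<sim> p" "a3 \<sim> p" "b1 \<sim> p" "b2 \<sim> p" "b3 \<sim> p"
    "a1 \<noteq> a2" "a1 \<noteq> a3" "a2 \<noteq> a3" "b1 \<noteq> b2" "b1 \<noteq> b3" "b2 \<noteq> b3"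
proof -
  have "a \<noteq> b" if "a \<sim> p" "\<not> a \<sim> b" for a b
    using that adj_refl adj_points by metis
  then show "a1 \<noteq> a2" "a1 \<noteq> a3" "a2 \<noteq> a3" "b1 \<noteq> b2" "b1 \<noteq> b3" "b2 \<noteq> b3"
    using assms by (auto simp: frame_def vertical_pair_def)
qed (use assms good_point in \<open>auto simp: frame_def vertical_pair_def\<close>)

lemma sideD:
  assumes "side p u a b c"
  shows "u \<in> \<O>" "u \<in> Points \<Gamma>" "\<not> u \<sim> p" "u \<sim> a" "u \<sim> b" "\<not> u \<sim> c" "u \<noteq> p"
  using assms good_point adj_refl by (auto simp: side_def)

text \<open>The plane \<open>r\<close> through \<open>L\<close> and \<open>e2\<close> contains
  \<open>e1\<close> and \<open>e3\<close>, because \<open>i12\<close> is on \<open>e1 e2\<close> and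
  \<open>i23\<close> on \<open>e2 e3\<close>. Hence it contains \<open>i13\<close>, and points
  common to the planes \<open>r\<close> and \<open>p\<close> lie on \<open>L\<close>.\<close>

lemma lifted_closes:
  assumes frame: "frame p a1 a2 a3 b1 b2 b3" and lifted: "lifted p a1 a2 a3 b1 b2 b3"
  shows "closes p a1 a2 a3 b1 b2 b3"
  unfolding closes_def
proof (intro allI impI)
  fix L i12 i23 i13
  assume L: "Inc \<Gamma> p L" "Inc \<Gamma> i12 L" "Inc \<Gamma> i23 L"
    and on: "on_block p a1 a2 i12" "on_block p b1 b2 i12" "on_block p a2 a3 i23" "on_block p b2 b3 i23"
      "on_block p a1 a3 i13" "on_block p b1 b3 i13"
  note f = frameD[OF frame]
  obtain e1 e2 e3 where e: "\<not> e1 \<sim> p" "\<not> e2 \<sim> p" "\<not> e3 \<sim> p" "e1 \<noteq> e2" "e1 \<noteq> e3" "e2 \<noteq> e3"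
    and ls: "lifted_side p e1 e2 a1 a2 b1 b2" "lifted_side p e1 e3 a1 a3 b1 b3"
      "lifted_side p e2 e3 a2 a3 b2 b3"
    using lifted unfolding lifted_def by blast
  obtain u12 v12 where s12: "u12 \<in> \<O> \<or> v12 \<in> \<O>" "u12 \<noteq> v12" "u12 \<sim> a1" "u12 \<sim> a2" "v12 \<sim> b1" "v12 \<sim> b2"
    "u12 \<sim> e1" "u12 \<sim> e2" "v12 \<sim> e1" "v12 \<sim> e2" using ls(1) unfolding lifted_side_def by blast
  obtain u13 v13 where s13: "u13 \<in> \<O> \<or> v13 \<in> \<O>" "u13 \<noteq> v13" "u13 \<sim> a1" "u13 \<sim> a3" "v13 \<sim> b1" "v13 \<sim> b3"
    "u13 \<sim> e1" "u13 \<sim> e3" "v13 \<sim> e1" "v13 \<sim> e3" using ls(2) unfolding lifted_side_def by blast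
  obtain u23 v23 where s23: "u23 \<in> \<O> \<or> v23 \<in> \<O>" "u23 \<noteq> v23" "u23 \<sim> a2" "u23 \<sim> a3" "v23 \<sim> b2" "v23 \<sim> b3"
    "u23 \<sim> e2" "u23 \<sim> e3" "v23 \<sim> e2" "v23 \<sim> e3" using ls(3) unfolding lifted_side_def by blast
  have i: "u12 \<sim> i12" "v12 \<sim> i12" "u23 \<sim> i23" "v23 \<sim> i23" "u13 \<sim> i13" "v13 \<sim> i13"
    using on_block_adj[OF f(1)] f on s12 s13 s23 by blast+
  have ip: "i12 \<sim> p" "i23 \<sim> p" "i13 \<sim> p" using on by (auto simp: on_block_def)
  obtain r where r: "Inc \<Gamma> r L" "r \<sim> e2"
    using projection[of e2 L] L(1) Inc_carrier s12 adj_points adj_commute by metis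
  have rp: "r \<noteq> p" using r e adj_commute by metis
  have ri: "r \<sim> i12" "r \<sim> i23" "r \<sim> p" using r L on_line_adj by auto
  have "r \<sim> e1"
    by (rule grid[of u12 v12 e2 i12 r e1]) (use s12 i ri r e ip in \<open>auto simp: adj_commute\<close>)
  moreover have "r \<sim> e3"
    by (rule grid[of u23 v23 e2 i23 r e3]) (use s23 i ri r e ip in \<open>auto simp: adj_commute\<close>)
  ultimately have "r \<sim> i13"
    by (intro grid[of u13 v13 e1 e3 r i13]) (use s13 i e in \<open>auto simp: adj_commute\<close>)
  then show "Inc \<Gamma> i13 L" using on_lineI[of p L r i13] L r rp ip adj_commute by metis
qed

text \<open>Here the configuration is lifted from the plane of \<open>e\<close>, where the triangles \<open>u\<close> and \<open>v\<close> have
  the centre \<open>l\<close>.  The 5-point is \<open>E1, E2, E3, q, t\<close> with \<open>E1, E2, E3\<close> in the plane of \<open>p\<close>; the six lines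
  through the \<open>u\<close> and \<open>v\<close> meet \<open>\<O>\<close>, and \<open>y\<close> takes care of the line through \<open>q\<close>, \<open>t\<close> and \<open>l\<close>.\<close>

lemma cone_closes:
  assumes frame: "frame p a1 a2 a3 b1 b2 b3"
    and sides: "side p u12 a1 a2 a3" "side p u13 a1 a3 a2" "side p u23 a2 a3 a1"
      "side p v12 b1 b2 b3" "side p v13 b1 b3 b2" "side p v23 b2 b3 b1"
    and e: "e \<sim> u12" "e \<sim> u13" "e \<sim> u23" "e \<sim> v12" "e \<sim> v13" "e \<sim> v23"
  shows "closes p a1 a2 a3 b1 b2 b3"
  unfolding closes_def
proof (intro allI impI)
  fix L i12 i23 i13
  assume L: "Inc \<Gamma> p L" "Inc \<Gamma> i12 L" "Inc \<Gamma> i23 L"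
    and on: "on_block p a1 a2 i12" "on_block p b1 b2 i12" "on_block p a2 a3 i23" "on_block p b2 b3 i23"
      "on_block p a1 a3 i13" "on_block p b1 b3 i13"
  note f = frameD[OF frame]
  note s = sideD[OF sides(1)] sideD[OF sides(2)] sideD[OF sides(3)]
    sideD[OF sides(4)] sideD[OF sides(5)] sideD[OF sides(6)]
  have pp: "p \<sim> p" using adj_refl[OF f(2)] .
  have nv: "\<not> u12 \<sim> b1" "\<not> u12 \<sim> b2" "\<not> u13 \<sim> b1" "\<not> u13 \<sim> b3" "\<not> u23 \<sim> b2" "\<not> u23 \<sim> b3"
    "\<not> v12 \<sim> a1" "\<not> v12 \<sim> a2" "\<not> v13 \<sim> a1" "\<not> v13 \<sim> a3" "\<not> v23 \<sim> a2" "\<not> v23 \<sim> a3"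
    using vertical_pair_off[OF f(3) s(4) s(3)] vertical_pair_off[OF f(4) s(5) s(3)]
      vertical_pair_off[OF f(3) s(11) s(10)] vertical_pair_off[OF f(5) s(12) s(10)]
      vertical_pair_off[OF f(4) s(18) s(17)] vertical_pair_off[OF f(5) s(19) s(17)]
      vertical_pair_off[OF vertical_pair_sym[OF f(3)] s(25) s(24)]
      vertical_pair_off[OF vertical_pair_sym[OF f(4)] s(26) s(24)]
      vertical_pair_off[OF vertical_pair_sym[OF f(3)] s(32) s(31)]
      vertical_pair_off[OF vertical_pair_sym[OF f(5)] s(33) s(31)]
      vertical_pair_off[OF vertical_pair_sym[OF f(4)] s(39) s(38)]
      vertical_pair_off[OF vertical_pair_sym[OF f(5)] s(40) s(38)] by simp_all
  have i: "u12 \<sim> i12" "v12 \<sim> i12" "u23 \<sim> i23" "v23 \<sim> i23" "u13 \<sim> i13" "v13 \<sim> i13"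
    using on_block_adj[OF f(1) f(12,13,18) on(1) s(4,5)] on_block_adj[OF f(1) f(15,16,21) on(2) s(25,26)]
      on_block_adj[OF f(1) f(13,14,20) on(3) s(18,19)] on_block_adj[OF f(1) f(16,17,23) on(4) s(39,40)]
      on_block_adj[OF f(1) f(12,14,19) on(5) s(11,12)] on_block_adj[OF f(1) f(15,17,22) on(6) s(32,33)]
    by simp_all
  have ip: "i12 \<sim> p" "i23 \<sim> p" "i13 \<sim> p" using on by (auto simp: on_block_def)
  have ne: "u12 \<noteq> v12" "u13 \<noteq> v13" "u23 \<noteq> v23" "u12 \<noteq> u13" "u12 \<noteq> u23" "u13 \<noteq> u23"
    "v12 \<noteq> v13" "v12 \<noteq> v23" "v13 \<noteq> v23"
    using nv s by metis+
  have nea: "e \<noteq> a1" "e \<noteq> a2" "e \<noteq> a3" "e \<noteq> b1" "e \<noteq> b2" "e \<noteq> b3"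
    using e nv adj_commute by metis+
  have ep: "\<not> e \<sim> p"
  proof
    assume "e \<sim> p"
    then have "u13 \<sim> a2"
      by (intro grid[of p u12 a1 e u13 a2]) (use f s e nea pp in \<open>auto simp: adj_commute\<close>)
    then show False using s by simp
  qed
  \<comment> \<open>In the plane of \<open>e\<close> the axis is
    \<open>{p, e}\<^sup>\<bottom>\<close>. Its point \<open>l\<close> is on the lines
    \<open>u12 v12\<close> and \<open>u23 v23\<close>; the aim is to put it on
    \<open>u13 v13\<close>. Below, \<open>k1\<close>, \<open>k2\<close>, \<open>k3\<close> are the
    points of the axis where corresponding sides of the triangles \<open>u\<close> and
    \<open>v\<close> meet.\<close>
  obtain l where l: "Inc \<Gamma> l L" "l \<sim> e"
    using projection[of e L] L(1) Inc_carrier adj_points e adj_commute by metis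
  have lp: "l \<noteq> p" using l ep adj_commute by metis
  have li: "l \<sim> i12" "l \<sim> i23" "l \<sim> p" using l L on_line_adj by auto
  obtain k1 where k1: "k1 \<sim> p" "k1 \<sim> a1" "k1 \<sim> b1" "k1 \<sim> e"
    using vertical_projection[OF f(3)] adj_points(1)[OF e(1)] by metis
  obtain k2 where k2: "k2 \<sim> p" "k2 \<sim> a2" "k2 \<sim> b2" "k2 \<sim> e"
    using vertical_projection[OF f(4)] adj_points(1)[OF e(1)] by metis
  obtain k3 where k3: "k3 \<sim> p" "k3 \<sim> a3" "k3 \<sim> b3" "k3 \<sim> e"
    using vertical_projection[OF f(5)] adj_points(1)[OF e(1)] by metis
  \<comment> \<open>Neither \<open>a1\<close> nor \<open>b1\<close> is collinear with
    \<open>l\<close>, and \<open>e\<close> is collinear with at most one of them. A good point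
    collinear with \<open>l\<close> and the other one is different from \<open>e\<close>.\<close>
  obtain y where y: "y \<in> \<O>" "\<not> y \<sim> p" "y \<sim> l" "y \<noteq> e"
  proof -
    have la: "\<not> l \<sim> a1"
    proof
      assume "l \<sim> a1"
      then have aL: "Inc \<Gamma> a1 L" using on_lineI[of p L l a1] L l lp f adj_commute by metis
      then have "i12 = a1"
        using off_line_of_center[of i12 p a1 u12] i s ip f L on_line_adj adj_commute by metis
      then have "v12 \<sim> a1" using i by simp
      then show False using nv by simp
    qed
    have lb: "\<not> l \<sim> b1"
    proof
      assume "l \<sim> b1"
      then have "l \<sim> a1"
        using no_triangle[of p b1 l a1] f(3) li unfolding vertical_pair_def by (metis adj_commute)
      then show False using la by simp
    qed
    have "\<exists>x. x \<sim> p \<and> \<not> l \<sim> x \<and> \<not> e \<sim> x"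
    proof (cases "e \<sim> a1")
      case True
      then have "\<not> e \<sim> b1" using off_line_of_center[of a1 p b1 e] f(3) ep f unfolding vertical_pair_def by metis
      then show ?thesis using lb f by blast
    qed (use la f in blast)
    then obtain x where x: "x \<sim> p" "\<not> l \<sim> x" "\<not> e \<sim> x" by blast
    then show ?thesis using good_opposite[OF f(1), of l x] li that by metis
  qed
  \<comment> \<open>The vertex \<open>q\<close> has to lie in the plane of \<open>y\<close> but in
    neither of the planes of \<open>p\<close> and \<open>e\<close>. If \<open>y\<close> itself
    fails, a point on another line through \<open>y\<close> avoids both.\<close>
  obtain q where q: "q \<sim> y" "\<not> q \<sim> p" "\<not> q \<sim> e"
  proof (cases "y \<sim> e")
    case False
    then show ?thesis using that[of y] y adj_refl good_point by blast
  next
    case True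
    obtain N where N: "Inc \<Gamma> y N" "Inc \<Gamma> e N" using True by (rule line_through)
    obtain M where M: "Inc \<Gamma> y M" "M \<noteq> N" using third_line[of y N N] y good_point by blast
    have M_line: "M \<in> Lines \<Gamma>" using M Inc_carrier by blast
    obtain h where h: "Inc \<Gamma> h M" "p \<sim> h" using projection[OF f(2) M_line] by blast
    obtain q where q: "Inc \<Gamma> q M" "q \<noteq> y" "q \<noteq> h" using third_point[OF M_line] by metis
    have "\<not> q \<sim> p"
    proof
      assume "q \<sim> p"
      then have "Inc \<Gamma> p M" using on_lineI[of q M h p] q h adj_commute by metis
      then show False using y M on_line_adj by metis
    qed
    moreover have "\<not> q \<sim> e"
    proof
      assume "q \<sim> e"
      then have "Inc \<Gamma> e M" using on_lineI[of q M y e] q M True adj_commute by metis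
      then show False using linear[of y e M N] y M N by blast
    qed
    ultimately show ?thesis using that q M on_line_adj by blast
  qed
  have qP: "q \<in> Points \<Gamma>" using q adj_points by blast
  have neq: "q \<noteq> u12" "q \<noteq> u13" "q \<noteq> u23" "q \<noteq> l" "q \<noteq> e" using q e li l adj_commute adj_refl qP by metis+
  \<comment> \<open>\<open>X1\<close>, \<open>X2\<close>, \<open>X3\<close> are the planes through
    \<open>q\<close> and the sides of the triangle \<open>u\<close>; two of them and the plane of
    \<open>p\<close> will determine each of \<open>E1\<close>, \<open>E2\<close>,
    \<open>E3\<close>.\<close>
  obtain X1 where X1: "X1 \<sim> u12" "X1 \<sim> u13" "X1 \<sim> q" using meet[of u12 u13 q] s qP by metis
  obtain X2 where X2: "X2 \<sim> u12" "X2 \<sim> u23" "X2 \<sim> q" using meet[of u12 u23 q] s qP by metis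
  obtain X3 where X3: "X3 \<sim> u13" "X3 \<sim> u23" "X3 \<sim> q" using meet[of u13 u23 q] s qP by metis
  have Xk: "k1 \<sim> X1" "k2 \<sim> X2" "k3 \<sim> X3"
    subgoal by (rule grid[of u12 u13 e a1 k1 X1]) (use s e ne nea k1 X1 in \<open>auto simp: adj_commute\<close>)
    subgoal by (rule grid[of u12 u23 e a2 k2 X2]) (use s e ne nea k2 X2 in \<open>auto simp: adj_commute\<close>)
    subgoal by (rule grid[of u13 u23 e a3 k3 X3]) (use s e ne nea k3 X3 in \<open>auto simp: adj_commute\<close>)
    done
  \<comment> \<open>The planes \<open>u12\<close>, \<open>u13\<close>, \<open>u23\<close> share only
    \<open>e\<close>. As \<open>q\<close> is not collinear with \<open>e\<close>, this keeps
    \<open>X1\<close>, \<open>X2\<close>, \<open>X3\<close> distinct.\<close>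
  have apex: "x = e" if "x \<sim> u12" "x \<sim> u13" "x \<sim> u23" for x
  proof (rule ccontr)
    assume "x \<noteq> e"
    then have "u23 \<sim> a1" by (intro grid[of u12 u13 e x u23 a1]) (use s e ne that in \<open>auto simp: adj_commute\<close>)
    then show False using s by simp
  qed
  have apex': "x = e" if "x \<sim> v12" "x \<sim> v13" "x \<sim> v23" for x
  proof (rule ccontr)
    assume "x \<noteq> e"
    then have "v23 \<sim> b1" by (intro grid[of v12 v13 e x v23 b1]) (use s e ne that in \<open>auto simp: adj_commute\<close>)
    then show False using s by simp
  qed
  have XX: "X1 \<noteq> X2" "X1 \<noteq> X3" "X2 \<noteq> X3" using apex X1 X2 X3 q adj_commute by metis+
  have XP: "X1 \<in> Points \<Gamma>" "X2 \<in> Points \<Gamma>" "X3 \<in> Points \<Gamma>" using X1 X2 X3 adj_points by blast+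
  have Xp: "X1 \<noteq> p" "X2 \<noteq> p" "X3 \<noteq> p" using X1 X2 X3 s adj_commute by metis+
  obtain E1 where E1: "E1 \<sim> p" "E1 \<sim> X2" "E1 \<sim> X3" using meet[OF f(1) XP(2,3)] by metis
  obtain E2 where E2: "E2 \<sim> p" "E2 \<sim> X1" "E2 \<sim> X3" using meet[OF f(1) XP(1,3)] by metis
  obtain E3 where E3: "E3 \<sim> p" "E3 \<sim> X1" "E3 \<sim> X2" using meet[OF f(1) XP(1,2)] by metis
  have Eu: "E1 \<noteq> u12" "E1 \<noteq> u13" "E1 \<noteq> u23" "E1 \<noteq> v12" "E1 \<noteq> v13" "E1 \<noteq> v23" "E1 \<noteq> q"
    "E2 \<noteq> u12" "E2 \<noteq> u13" "E2 \<noteq> u23" "E2 \<noteq> v12" "E2 \<noteq> v13" "E2 \<noteq> v23" "E2 \<noteq> q"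
    "E3 \<noteq> u12" "E3 \<noteq> u13" "E3 \<noteq> u23" "E3 \<noteq> v12" "E3 \<noteq> v13" "E3 \<noteq> v23" "E3 \<noteq> q"
    using E1 E2 E3 s q by metis+
  have Ee: "\<not> E1 \<sim> e" "\<not> E2 \<sim> e" "\<not> E3 \<sim> e"
  proof -
    show "\<not> E1 \<sim> e"
    proof
      assume "E1 \<sim> e"
      then have "q \<sim> e"
        by (intro grid[of u23 E1 X2 X3 q e]) (use s e E1 Eu X2 X3 XX in \<open>auto simp: adj_commute\<close>)
      then show False using q by simp
    qed
    show "\<not> E2 \<sim> e"
    proof
      assume "E2 \<sim> e"
      then have "q \<sim> e"
        by (intro grid[of u13 E2 X1 X3 q e]) (use s e E2 Eu X1 X3 XX in \<open>auto simp: adj_commute\<close>)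
      then show False using q by simp
    qed
    show "\<not> E3 \<sim> e"
    proof
      assume "E3 \<sim> e"
      then have "q \<sim> e"
        by (intro grid[of u12 E3 X1 X2 q e]) (use s e E3 Eu X1 X2 XX in \<open>auto simp: adj_commute\<close>)
      then show False using q by simp
    qed
  qed
  have Ek: "E1 \<noteq> k2" "E1 \<noteq> k3" "E3 \<noteq> k1" using Ee k1 k2 k3 by metis+
  \<comment> \<open>Each \<open>Y\<close> is a plane through a side of the triangle \<open>v\<close>
    and one \<open>E\<close>. It contains a second \<open>E\<close>, because the line joining the
    two passes through the corresponding \<open>k\<close>.\<close>
  obtain Y2 where Y2: "Y2 \<sim> v12" "Y2 \<sim> v23" "Y2 \<sim> E1"
    using meet[of v12 v23 E1] s adj_points(1)[OF E1(1)] by metis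
  obtain Y3 where Y3: "Y3 \<sim> v13" "Y3 \<sim> v23" "Y3 \<sim> E1"
    using meet[of v13 v23 E1] s adj_points(1)[OF E1(1)] by metis
  obtain Y1 where Y1: "Y1 \<sim> v12" "Y1 \<sim> v13" "Y1 \<sim> E3"
    using meet[of v12 v13 E3] s adj_points(1)[OF E3(1)] by metis
  have Yk: "k1 \<sim> Y1" "k2 \<sim> Y2" "k3 \<sim> Y3"
    subgoal by (rule grid[of v12 v13 e b1 k1 Y1]) (use s e ne nea k1 Y1 in \<open>auto simp: adj_commute\<close>)
    subgoal by (rule grid[of v12 v23 e b2 k2 Y2]) (use s e ne nea k2 Y2 in \<open>auto simp: adj_commute\<close>)
    subgoal by (rule grid[of v13 v23 e b3 k3 Y3]) (use s e ne nea k3 Y3 in \<open>auto simp: adj_commute\<close>)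
    done
  have YE: "Y2 \<sim> E3" "Y1 \<sim> E2" "Y3 \<sim> E2"
    subgoal by (rule grid[of p X2 E1 k2 Y2 E3]) (use f Xp Xk Yk Y2 E1 E3 Ek k2 in \<open>auto simp: adj_commute\<close>)
    subgoal by (rule grid[of p X1 E3 k1 Y1 E2]) (use f Xp Xk Yk Y1 E2 E3 Ek k1 in \<open>auto simp: adj_commute\<close>)
    subgoal by (rule grid[of p X3 E1 k3 Y3 E2]) (use f Xp Xk Yk Y3 E1 E2 Ek k3 in \<open>auto simp: adj_commute\<close>)
    done
  obtain z12 where z12: "z12 \<sim> u12" "z12 \<sim> v12" "z12 \<sim> q" using meet[of u12 v12 q] s qP by metis
  obtain z23 where z23: "z23 \<sim> u23" "z23 \<sim> v23" "z23 \<sim> q" using meet[of u23 v23 q] s qP by metis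
  obtain z13 where z13: "z13 \<sim> u13" "z13 \<sim> v13" "z13 \<sim> q" using meet[of u13 v13 q] s qP by metis
  have ie: "e \<noteq> i12" "e \<noteq> i23" "e \<noteq> i13" "e \<noteq> z13" using ip ep z13 q adj_commute by metis+
  have zl: "l \<sim> z12" "l \<sim> z23"
    subgoal by (rule grid[of u12 v12 e i12 l z12]) (use s e ne ie i li l z12 in \<open>auto simp: adj_commute\<close>)
    subgoal by (rule grid[of u23 v23 e i23 l z23]) (use s e ne ie i li l z23 in \<open>auto simp: adj_commute\<close>)
    done
  have zE: "E3 \<sim> z12" "E1 \<sim> z23" "E2 \<sim> z13"
    subgoal by (rule grid[of q u12 X1 X2 E3 z12]) (use s neq X1 X2 XX E3 z12 in \<open>auto simp: adj_commute\<close>)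
    subgoal by (rule grid[of q u23 X2 X3 E1 z23]) (use s neq X2 X3 XX E1 z23 in \<open>auto simp: adj_commute\<close>)
    subgoal by (rule grid[of q u13 X1 X3 E2 z13]) (use s neq X1 X3 XX E2 z13 in \<open>auto simp: adj_commute\<close>)
    done
  \<comment> \<open>The planes \<open>y\<close> and \<open>g\<close> intersect in the line
    \<open>ql\<close>, and \<open>t\<close> is a point of this line in the plane \<open>Y2\<close>.
    Hence every plane through \<open>q\<close> and \<open>l\<close> contains
    \<open>t\<close>.\<close>
  obtain g where g: "g \<sim> q" "g \<sim> l" "g \<noteq> y" using common_neighbour qP adj_points(1)[OF li(1)] by metis
  obtain t where t: "t \<sim> y" "t \<sim> g" "t \<sim> Y2"
    using meet[OF y(1)] g adj_points(1)[OF g(1)] adj_points(1)[OF Y2(1)] by metis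
  have tz: "z \<sim> t" if "z \<sim> q" "z \<sim> l" for z
    by (rule grid[of y g q l z t]) (use y g t neq q that in \<open>auto simp: adj_commute\<close>)
  have tz': "t \<sim> z12" "t \<sim> z23"
    using tz[OF z12(3)] tz[OF z23(3)] zl adj_commute by metis+
  \<comment> \<open>This keeps \<open>t\<close> apart from \<open>q\<close>, and \<open>Y2\<close>
    apart from \<open>z12\<close> and \<open>z23\<close>, as the remaining grids require.\<close>
  have Y2q: "\<not> Y2 \<sim> q"
  proof
    assume Yq: "Y2 \<sim> q"
    have 1: "u23 \<sim> Y2"
      by (rule grid_last[of u23 E1 q X2 X3 Y2]) (use s Eu XX X2 X3 E1 Y2 Yq in \<open>auto simp: adj_commute\<close>)
    have 2: "u12 \<sim> Y2"
      by (rule grid_last[of u12 E3 q X1 X2 Y2]) (use s Eu XX X1 X2 E3 YE Yq in \<open>auto simp: adj_commute\<close>)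
    have "Y2 \<noteq> e" using Yq q adj_commute by metis
    then have "v12 \<sim> a2"
      by (intro grid[of u12 u23 e Y2 v12 a2]) (use s ne e 1 2 Y2 in \<open>auto simp: adj_commute\<close>)
    then show False using nv by simp
  qed
  have tY1: "t \<sim> Y1"
    by (rule grid[of v12 E3 Y2 z12 t Y1])
       (use s Eu YE zE Y1 Y2 Y2q z12 t tz' in \<open>auto simp: adj_commute\<close>)
  have tY3: "t \<sim> Y3"
    by (rule grid[of v23 E1 Y2 z23 t Y3])
       (use s Eu YE zE Y3 Y2 Y2q z23 t tz' in \<open>auto simp: adj_commute\<close>)
  have "Y1 \<noteq> Y3" using apex' Y1 Y3 YE Ee adj_commute by metis
  \<comment> \<open>The line \<open>v13 E2\<close> common to \<open>Y1\<close> and \<open>Y3\<close>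
    contains \<open>t\<close> and lies in \<open>z13\<close>. Containing \<open>q\<close> and
    \<open>t\<close>, the plane \<open>z13\<close> contains \<open>l\<close>.\<close>
  then have tz13: "t \<sim> z13"
    by (intro grid[of v13 E2 Y1 Y3 t z13]) (use s Eu YE zE Y1 Y3 tY1 tY3 z13 in \<open>auto simp: adj_commute\<close>)
  have "q \<noteq> t" using t Y2q adj_commute by metis
  then have "z13 \<sim> l"
    by (intro grid[of y g q t z13 l]) (use y g t q tz13 z13 in \<open>auto simp: adj_commute\<close>)
  then have "l \<sim> i13"
    by (intro grid[of u13 v13 e z13 l i13]) (use s ne e ie z13 i l in \<open>auto simp: adj_commute\<close>)
  then show "Inc \<Gamma> i13 L" using on_lineI[of p L l i13] L l lp ip adj_commute by metis
qed

section \<open>Symmetries of the configuration, and the choice between lift and cone\<close>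

lemma side_commute: "side p u a b c \<longleftrightarrow> side p u b a c"
  by (auto simp: side_def)

lemma frame_swap: "frame p a1 a2 a3 b1 b2 b3 \<Longrightarrow> frame p b1 b2 b3 a1 a2 a3"
  by (auto simp: frame_def vertical_pair_def adj_commute)

lemma frame_permute:
  assumes "frame p a1 a2 a3 b1 b2 b3"
  shows "frame p a1 a3 a2 b1 b3 b2" "frame p a2 a1 a3 b2 b1 b3"
  using assms by (auto simp: frame_def adj_commute)

lemma lifted_side_swap: "lifted_side p e e' a a' b b' \<Longrightarrow> lifted_side p e e' b b' a a'"
  unfolding lifted_side_def by (subst ex_comm) (elim ex_forward, auto)

lemma lifted_side_commute: "lifted_side p e e' a a' b b' \<Longrightarrow> lifted_side p e' e a' a b' b"
  unfolding lifted_side_def by (elim ex_forward) auto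

lemma lifted_swap: "lifted p a1 a2 a3 b1 b2 b3 \<Longrightarrow> lifted p b1 b2 b3 a1 a2 a3"
  unfolding lifted_def by (elim ex_forward) (auto intro: lifted_side_swap)

lemma lifted_permute:
  "lifted p a1 a2 a3 b1 b2 b3 \<Longrightarrow> lifted p a1 a3 a2 b1 b3 b2"
  "lifted p a1 a2 a3 b1 b2 b3 \<Longrightarrow> lifted p a2 a1 a3 b2 b1 b3"
proof -
  assume "lifted p a1 a2 a3 b1 b2 b3"
  then obtain e1 e2 e3 where e: "\<not> e1 \<sim> p" "\<not> e2 \<sim> p" "\<not> e3 \<sim> p" "e1 \<noteq> e2" "e1 \<noteq> e3" "e2 \<noteq> e3"
    "lifted_side p e1 e2 a1 a2 b1 b2" "lifted_side p e1 e3 a1 a3 b1 b3" "lifted_side p e2 e3 a2 a3 b2 b3"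
    unfolding lifted_def by blast
  show "lifted p a1 a3 a2 b1 b3 b2"
    unfolding lifted_def
    by (rule exI[of _ e1], rule exI[of _ e3], rule exI[of _ e2])
       (use e lifted_side_commute[OF e(9)] in simp)
  show "lifted p a2 a1 a3 b2 b1 b3"
    unfolding lifted_def
    by (rule exI[of _ e2], rule exI[of _ e1], rule exI[of _ e3])
       (use e lifted_side_commute[OF e(7)] in simp)
qed

text \<open>Without a lift, each use of \<open>lift_exists\<close> forces four planes to concur. The
  uses with \<open>v12\<close> and with \<open>v13\<close> give two points common to
  \<open>u12\<close>, \<open>u13\<close> and \<open>v23\<close>; they coincide because
  \<open>v23\<close> does not contain \<open>a1\<close>. A third use, with the triangles exchanged,
  adds \<open>u23\<close>.\<close>

lemma lifted_or_cone_aux: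
  assumes frame: "frame p a1 a2 a3 b1 b2 b3"
    and sides: "side p u12 a1 a2 a3" "side p u13 a1 a3 a2" "side p u23 a2 a3 a1"
      "side p v12 b1 b2 b3" "side p v13 b1 b3 b2" "side p v23 b2 b3 b1"
    and off: "\<not> v23 \<sim> a1"
    and nl: "\<not> lifted p a1 a2 a3 b1 b2 b3"
  shows "\<exists>e. e \<sim> u12 \<and> e \<sim> u13 \<and> e \<sim> u23 \<and> e \<sim> v12 \<and> e \<sim> v13 \<and> e \<sim> v23"
proof -
  note s = sideD[OF sides(1)] sideD[OF sides(2)] sideD[OF sides(4)] sideD[OF sides(5)]
  obtain e where e: "e \<sim> u12" "e \<sim> u13" "e \<sim> v12" using meet[of u12 u13 v12] s(1,2,9,16) by metis
  have e1: "e \<sim> v23" using lift_exists[OF frame sides(1,2,4,6) e] nl by blast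
  obtain e' where e': "e' \<sim> u12" "e' \<sim> u13" "e' \<sim> v13" using meet[of u12 u13 v13] s(1,2,9,23) by metis
  have e2: "e' \<sim> v23"
    using lift_exists[OF frame_permute(1)[OF frame] sides(2,1,5) side_commute[THEN iffD1, OF sides(6)]
        e'(2,1,3)] nl lifted_permute(1) by blast
  have "e = e'"
  proof (rule ccontr)
    assume "e \<noteq> e'"
    moreover have "u12 \<noteq> u13" using s(5,13) by metis
    ultimately have "v23 \<sim> a1"
      by (intro grid[of u12 u13 e e' v23 a1]) (use e e' e1 e2 s(1,4,11) in \<open>auto simp: adj_commute\<close>)
    then show False using off by simp
  qed
  then have ev: "e \<sim> v12" "e \<sim> v13" "e \<sim> u12" using e e' by auto
  have "e \<sim> u23"
    using lift_exists[OF frame_swap[OF frame] sides(4,5,1,3) ev] nl lifted_swap by blast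
  then show ?thesis using e ev e1 by blast
qed

lemma lifted_or_cone:
  assumes frame: "frame p a1 a2 a3 b1 b2 b3"
    and sides: "side p u12 a1 a2 a3" "side p u13 a1 a3 a2" "side p u23 a2 a3 a1"
      "side p v12 b1 b2 b3" "side p v13 b1 b3 b2" "side p v23 b2 b3 b1"
    and off: "\<not> v23 \<sim> a1 \<or> \<not> u23 \<sim> b1"
  shows "lifted p a1 a2 a3 b1 b2 b3 \<or>
    (\<exists>e. e \<sim> u12 \<and> e \<sim> u13 \<and> e \<sim> u23 \<and> e \<sim> v12 \<and> e \<sim> v13 \<and> e \<sim> v23)"
  using off lifted_or_cone_aux[OF frame sides]
    lifted_or_cone_aux[OF frame_swap[OF frame] sides(4-6,1-3)] lifted_swap by blast

lemma little_desargues: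
  assumes frame: "frame p a1 a2 a3 b1 b2 b3"
    and proper: "\<not> on_block p a1 a2 a3" "\<not> on_block p b1 b2 b3"
  shows "closes p a1 a2 a3 b1 b2 b3"
proof -
  note f = frameD[OF frame]
  have side: "\<exists>u. side p u a b c"
    if c: "a \<sim> p" "b \<sim> p" "c \<sim> p" "\<not> a \<sim> b" "\<And>u. u \<noteq> p \<Longrightarrow> u \<sim> a \<Longrightarrow> u \<sim> b \<Longrightarrow> \<not> u \<sim> c" for a b c
  proof -
    obtain u where u: "u \<in> \<O>" "\<not> u \<sim> p" "u \<sim> a" "u \<sim> b" by (rule good_opposite[OF f(1) c(1,2,4)])
    moreover have "u \<noteq> p" using u adj_refl good_point by blast
    ultimately show ?thesis using c(5) by (auto simp: side_def)
  qed
  have na: "\<not> (u \<sim> a1 \<and> u \<sim> a2 \<and> u \<sim> a3)" if "u \<noteq> p" for u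
    using proper(1) f(14) that by (auto simp: on_block_def)
  have nb: "\<not> (u \<sim> b1 \<and> u \<sim> b2 \<and> u \<sim> b3)" if "u \<noteq> p" for u
    using proper(2) f(17) that by (auto simp: on_block_def)
  obtain u12 where u12: "side p u12 a1 a2 a3" using side[OF f(12,13,14,6)] na by metis
  obtain u13 where u13: "side p u13 a1 a3 a2" using side[OF f(12,14,13,7)] na by metis
  obtain u23 where u23: "side p u23 a2 a3 a1" using side[OF f(13,14,12,8)] na by metis
  obtain v12 where v12: "side p v12 b1 b2 b3" using side[OF f(15,16,17,9)] nb by metis
  obtain v13 where v13: "side p v13 b1 b3 b2" using side[OF f(15,17,16,10)] nb by metis
  obtain v23 where v23: "side p v23 b2 b3 b1" using side[OF f(16,17,15,11)] nb by metis
  \<comment> \<open>Otherwise the planes \<open>p\<close>, \<open>v23\<close> and \<open>u13\<close>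
    would share the line \<open>a1 b2\<close>, and \<open>u13\<close> would contain
    \<open>b3\<close>. So \<open>lifted_or_cone\<close> applies either directly or with the indices
    1 and 2 exchanged.\<close>
  have "\<not> v23 \<sim> a1 \<or> \<not> u13 \<sim> b2"
  proof (rule ccontr)
    assume "\<not> ?thesis"
    moreover have "a1 \<noteq> b2"
      using f(3,9) by (auto simp: vertical_pair_def adj_commute)
    ultimately have "u13 \<sim> b3"
      by (intro grid[of p v23 a1 b2 u13 b3])
         (use f sideD[OF v23] sideD[OF u13] in \<open>auto simp: adj_commute\<close>)
    then show False
      using vertical_pair_off[OF f(5) sideD(5,3)[OF u13]] by simp
  qed
  then have "(\<not> v23 \<sim> a1 \<or> \<not> u23 \<sim> b1) \<or> (\<not> v13 \<sim> a2 \<or> \<not> u13 \<sim> b2)" by blast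
  then have "lifted p a1 a2 a3 b1 b2 b3 \<or>
    (\<exists>e. e \<sim> u12 \<and> e \<sim> u13 \<and> e \<sim> u23 \<and> e \<sim> v12 \<and> e \<sim> v13 \<and> e \<sim> v23)"
    using lifted_or_cone[OF frame u12 u13 u23 v12 v13 v23]
      lifted_or_cone[OF frame_permute(2)[OF frame] side_commute[THEN iffD1, OF u12] u23 u13
        side_commute[THEN iffD1, OF v12] v23 v13] lifted_permute(2) by blast
  then show ?thesis
    using lifted_closes[OF frame] cone_closes[OF frame u12 u13 u23 v12 v13 v23] by blast
qed


section \<open>Perp-planes and dual nets\<close>

lemma block_eqI:
  assumes "p \<in> \<O>" "y \<in> Points \<Gamma>" "y' \<in> Points \<Gamma>" "y \<noteq> p" "y' \<noteq> p" "a \<noteq> b"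
    "a \<in> perp \<Gamma> {p, y}" "b \<in> perp \<Gamma> {p, y}" "a \<in> perp \<Gamma> {p, y'}" "b \<in> perp \<Gamma> {p, y'}"
  shows "perp \<Gamma> {p, y} = perp \<Gamma> {p, y'}"
proof -
  have P: "p \<in> Points \<Gamma>" using assms good_point by blast
  note mem = mem_perp_pair[OF P assms(2)] mem_perp_pair[OF P assms(3)]
  have *: "e \<sim> y \<longleftrightarrow> e \<sim> y'" if "e \<sim> p" for e
  proof
    assume "e \<sim> y"
    then have "y' \<sim> e" by (intro grid[of p y a b y' e]) (use assms that mem in \<open>auto simp: adj_commute\<close>)
    then show "e \<sim> y'" by (simp add: adj_commute)
  next
    assume "e \<sim> y'"
    then have "y \<sim> e" by (intro grid[of p y' a b y e]) (use assms that mem in \<open>auto simp: adj_commute\<close>)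
    then show "e \<sim> y" by (simp add: adj_commute)
  qed
  show ?thesis using * by (auto simp: mem)
qed

lemma perp_plane_blocks_iff:
  "B \<in> perp_plane_blocks \<Gamma> p \<longleftrightarrow> (\<exists>y\<in>Points \<Gamma>. y \<noteq> p \<and> B = perp \<Gamma> {p, y})"
  by (auto simp: perp_plane_blocks_def)

lemma dual_net_blocks_iff:
  assumes "p \<in> \<O>"
  shows "B \<in> dual_net_blocks \<Gamma> p \<longleftrightarrow> (\<exists>y\<in>Points \<Gamma>. \<not> y \<sim> p \<and> B = perp \<Gamma> {p, y})"
  using good_point[OF assms] by (auto simp: dual_net_blocks_def opposite_iff adj_commute)

text \<open>Blocks are joined by a common neighbour other than \<open>p\<close> and met by
  \<open>meet\<close>; the quadrangle consists of two points on each of two lines through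
  \<open>p\<close>.\<close>

lemma perp_plane_projective:
  assumes p: "p \<in> \<O>"
  shows "projective_plane (perp_plane_points \<Gamma> p) (perp_plane_blocks \<Gamma> p)"
  unfolding projective_plane_def perp_plane_points_def
proof (intro conjI ballI impI)
  have P: "p \<in> Points \<Gamma>" using p good_point by blast
  note mem = mem_perp_pair[OF P]
  show "B \<subseteq> pperp \<Gamma> p" if "B \<in> perp_plane_blocks \<Gamma> p" for B
    using that mem mem_pperp[OF P] by (auto simp: perp_plane_blocks_iff)
  fix a b assume ab: "a \<in> pperp \<Gamma> p" "b \<in> pperp \<Gamma> p" "a \<noteq> b"
  then have ab': "a \<sim> p" "b \<sim> p" using mem_pperp P by auto
  obtain y where y: "y \<sim> a" "y \<sim> b" "y \<noteq> p"
    using common_neighbour[of a b p] ab' adj_points by metis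
  have yP: "y \<in> Points \<Gamma>" using y adj_points by blast
  show "\<exists>!B. B \<in> perp_plane_blocks \<Gamma> p \<and> a \<in> B \<and> b \<in> B"
  proof (rule ex1I[of _ "perp \<Gamma> {p, y}"])
    show "perp \<Gamma> {p, y} \<in> perp_plane_blocks \<Gamma> p \<and> a \<in> perp \<Gamma> {p, y} \<and> b \<in> perp \<Gamma> {p, y}"
      using y ab' mem[OF yP] yP adj_commute by (auto simp: perp_plane_blocks_iff)
    fix B assume "B \<in> perp_plane_blocks \<Gamma> p \<and> a \<in> B \<and> b \<in> B"
    then show "B = perp \<Gamma> {p, y}"
      using block_eqI[OF p _ yP _ y(3) ab(3)] y ab' mem[OF yP] adj_commute
      by (auto simp: perp_plane_blocks_iff)
  qed
next
  have P: "p \<in> Points \<Gamma>" using p good_point by blast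
  note mem = mem_perp_pair[OF P]
  fix B C assume BC: "B \<in> perp_plane_blocks \<Gamma> p" "C \<in> perp_plane_blocks \<Gamma> p" "B \<noteq> C"
  then obtain y y' where y: "y \<in> Points \<Gamma>" "y \<noteq> p" "B = perp \<Gamma> {p, y}" "y' \<in> Points \<Gamma>" "y' \<noteq> p"
    "C = perp \<Gamma> {p, y'}" by (auto simp: perp_plane_blocks_iff)
  obtain a where a: "a \<sim> p" "a \<sim> y" "a \<sim> y'" using meet[OF p y(1,4)] by metis
  show "\<exists>!a. a \<in> B \<and> a \<in> C"
  proof (rule ex1I[of _ a])
    show aBC: "a \<in> B \<and> a \<in> C" using a mem y by auto
    fix b assume "b \<in> B \<and> b \<in> C"
    then show "b = a" using block_eqI[OF p y(1,4,2,5), of a b] aBC y BC by metis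
  qed
next
  have P: "p \<in> Points \<Gamma>" using p good_point by blast
  note mem = mem_perp_pair[OF P]
  obtain M where M: "Inc \<Gamma> p M" using third_line[OF P] by metis
  have M_line: "M \<in> Lines \<Gamma>" using M Inc_carrier by blast
  obtain a where a: "Inc \<Gamma> a M" "a \<noteq> p" using third_point[OF M_line, of p p] by metis
  obtain a' where a': "Inc \<Gamma> a' M" "a' \<noteq> p" "a' \<noteq> a" using third_point[OF M_line] by metis
  have ap: "a \<sim> p" "a' \<sim> p" "a \<sim> a'" using a a' M on_line_adj by metis+
  obtain N b b' where b: "Inc \<Gamma> p N" "Inc \<Gamma> b N" "Inc \<Gamma> b' N" "b \<noteq> b'" "b \<noteq> p" "b' \<noteq> p"
    "\<not> a \<sim> b" "\<not> a \<sim> b'" using other_direction[OF ap(1) a(2)] by metis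
  have bp: "b \<sim> p" "b' \<sim> p" "b \<sim> b'" using b on_line_adj by metis+
  have no: "\<not> (x \<in> B \<and> x' \<in> B \<and> z \<in> B)"
    if B: "B \<in> perp_plane_blocks \<Gamma> p" and x: "x \<sim> p" "x' \<sim> p" "x \<sim> x'" "x \<noteq> x'" "x \<noteq> p"
      and z: "z \<sim> p" "\<not> x \<sim> z" for B x x' z
  proof
    assume in_B: "x \<in> B \<and> x' \<in> B \<and> z \<in> B"
    obtain y where y: "y \<in> Points \<Gamma>" "y \<noteq> p" "B = perp \<Gamma> {p, y}"
      using B by (auto simp: perp_plane_blocks_iff)
    have adj: "x \<sim> y" "x' \<sim> y" "z \<sim> y" using in_B y mem by auto
    have "y \<sim> p" using off_line_of_center[of x p x' y] x adj P adj_commute by metis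
    then show False using no_triangle[of y p x z] y x z adj adj_commute by metis
  qed
  have a'b: "\<not> a' \<sim> b" using no_triangle[of p a' a b] a a' ap bp b adj_commute by metis
  have ba: "\<not> b \<sim> a" "\<not> b \<sim> a'" using b a'b adj_commute by metis+
  have "\<forall>B\<in>perp_plane_blocks \<Gamma> p. \<not> {a, a', b} \<subseteq> B \<and> \<not> {a, a', b'} \<subseteq> B \<and> \<not> {a, b, b'} \<subseteq> B \<and>
      \<not> {a', b, b'} \<subseteq> B"
    using no[OF _ ap a'(3)[symmetric] a(2) bp(1) b(7)] no[OF _ ap a'(3)[symmetric] a(2) bp(2) b(8)]
      no[OF _ bp b(4,5) ap(1) ba(1)] no[OF _ bp b(4,5) ap(2) ba(2)] by auto
  moreover have "distinct [a, a', b, b']"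
    using a a' b ap bp a'b adj_refl adj_points adj_commute by (metis distinct_length_2_or_more distinct_singleton)
  moreover have "{a, a', b, b'} \<subseteq> pperp \<Gamma> p" using ap bp mem_pperp[OF P] by auto
  ultimately show "\<exists>a b c d. {a, b, c, d} \<subseteq> pperp \<Gamma> p \<and> distinct [a, b, c, d] \<and>
    (\<forall>B\<in>perp_plane_blocks \<Gamma> p. \<not> {a, b, c} \<subseteq> B \<and> \<not> {a, b, d} \<subseteq> B \<and> \<not> {a, c, d} \<subseteq> B \<and> \<not> {b, c, d} \<subseteq> B)"
    by blast
qed

section \<open>The dual net of a good point\<close>

lemma mem_dual_net_points:
  "p \<in> \<O> \<Longrightarrow> a \<in> dual_net_points \<Gamma> p \<longleftrightarrow> a \<sim> p \<and> a \<noteq> p"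
  using mem_pperp[OF good_point] by (auto simp: dual_net_points_def)

text \<open>A block comes from a point opposite \<open>p\<close>, which cannot be collinear with two
  points of a line through \<open>p\<close>. Thus parallel means collinear.\<close>

lemma joined_iff:
  assumes p: "p \<in> \<O>" and a: "a \<in> dual_net_points \<Gamma> p" and b: "b \<in> dual_net_points \<Gamma> p" and ab: "a \<noteq> b"
  shows "joined (dual_net_blocks \<Gamma> p) a b \<longleftrightarrow> \<not> a \<sim> b"
proof -
  have P: "p \<in> Points \<Gamma>" using p good_point by blast
  have abp: "a \<sim> p" "b \<sim> p" using a b mem_dual_net_points[OF p] by auto
  show ?thesis
  proof
    assume "joined (dual_net_blocks \<Gamma> p) a b"
    then obtain y where y: "y \<in> Points \<Gamma>" "\<not> y \<sim> p" "a \<sim> y" "b \<sim> y"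
      using mem_perp_pair[OF P] by (auto simp: joined_def dual_net_blocks_iff[OF p])
    then show "\<not> a \<sim> b" using off_line_of_center[of a p b y] abp ab P adj_commute by metis
  next
    assume "\<not> a \<sim> b"
    then obtain y where y: "y \<sim> a" "y \<sim> b" "\<not> y \<sim> p"
      using outside_common_neighbour[OF abp] P by metis
    have "y \<in> Points \<Gamma>" using y adj_points by blast
    then show "joined (dual_net_blocks \<Gamma> p) a b"
      using y abp mem_perp_pair[OF P] adj_commute
      unfolding joined_def by (metis dual_net_blocks_iff[OF p])
  qed
qed

lemma dual_net:
  assumes p: "p \<in> \<O>"
  shows "dual_net (dual_net_points \<Gamma> p) (dual_net_blocks \<Gamma> p)"
  unfolding dual_net_def
proof (intro conjI ballI impI)
  have P: "p \<in> Points \<Gamma>" using p good_point by blast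
  note mem = mem_perp_pair[OF P] and blocks = dual_net_blocks_iff[OF p] and pts = mem_dual_net_points[OF p]
  show "B \<subseteq> dual_net_points \<Gamma> p" if "B \<in> dual_net_blocks \<Gamma> p" for B
    using that mem adj_commute by (auto simp: blocks pts)
  show "a = b" if "B \<in> dual_net_blocks \<Gamma> p" "C \<in> dual_net_blocks \<Gamma> p" "a \<in> B \<inter> C" "b \<in> B \<inter> C" "B \<noteq> C" for B C a b
    using that block_eqI[OF p, of _ _ a b] adj_refl[OF P] by (auto simp: blocks)
  show "\<exists>!b. b \<in> B \<and> \<not> joined (dual_net_blocks \<Gamma> p) a b"
    if a: "a \<in> dual_net_points \<Gamma> p" and B: "B \<in> dual_net_blocks \<Gamma> p" and aB: "a \<notin> B" for a B
  proof -
    obtain y where y: "y \<in> Points \<Gamma>" "\<not> y \<sim> p" "B = perp \<Gamma> {p, y}" using B by (auto simp: blocks)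
    have a': "a \<sim> p" "a \<noteq> p" using a by (auto simp: pts)
    have "\<not> a \<sim> y" using aB y a' mem[OF y(1)] by auto
    then have *: "\<exists>!b. b \<sim> p \<and> b \<sim> y \<and> b \<sim> a"
      using block_parallel_class[OF good_grids[OF p] a' y(1)] y adj_commute by metis
    have "b \<in> B \<and> \<not> joined (dual_net_blocks \<Gamma> p) a b \<longleftrightarrow> b \<sim> p \<and> b \<sim> y \<and> b \<sim> a" for b
    proof (cases "b \<in> B")
      case True
      then have "b \<in> dual_net_points \<Gamma> p" "a \<noteq> b" using y mem[OF y(1)] aB adj_commute by (auto simp: pts)
      then show ?thesis using joined_iff[OF p a] True y mem[OF y(1)] adj_commute by metis
    qed (use y mem[OF y(1)] in auto)
    then show ?thesis using * by simp
  qed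
  have block_through: "\<exists>y\<in>Points \<Gamma>. \<not> y \<sim> p \<and> a \<sim> y \<and> b \<sim> y" if "a \<sim> p" "b \<sim> p" "\<not> a \<sim> b" for a b
    using outside_common_neighbour[OF that P] adj_points adj_commute by metis
  obtain M where M: "Inc \<Gamma> p M" using third_line[OF P] by metis
  have M_line: "M \<in> Lines \<Gamma>" using M Inc_carrier by blast
  obtain a where a: "Inc \<Gamma> a M" "a \<noteq> p" using third_point[OF M_line, of p p] by metis
  have ap: "a \<sim> p" using a M on_line_adj by blast
  show two: "\<exists>B\<in>dual_net_blocks \<Gamma> p. \<exists>C\<in>dual_net_blocks \<Gamma> p. B \<noteq> C \<and> a \<in> B \<and> a \<in> C"
    if a: "a \<in> dual_net_points \<Gamma> p" for a
  proof -
    have ap: "a \<sim> p" "a \<noteq> p" using a by (auto simp: pts)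
    \<comment> \<open>Two points of another line through \<open>p\<close> are never on one block, so
      joining \<open>a\<close> to each of them gives different blocks.\<close>
    obtain N b b' where b: "Inc \<Gamma> p N" "Inc \<Gamma> b N" "Inc \<Gamma> b' N" "b \<noteq> b'" "\<not> a \<sim> b" "\<not> a \<sim> b'"
      using other_direction[OF ap] by metis
    have bp: "b \<sim> p" "b' \<sim> p" "b \<sim> b'" using b on_line_adj by metis+
    obtain y where y: "y \<in> Points \<Gamma>" "\<not> y \<sim> p" "a \<sim> y" "b \<sim> y" using block_through ap bp b by metis
    obtain y' where y': "y' \<in> Points \<Gamma>" "\<not> y' \<sim> p" "a \<sim> y'" "b' \<sim> y'" using block_through ap bp b by metis
    have "\<not> b' \<sim> y" using off_line_of_center[of b p b' y] bp b y P adj_commute by metis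
    then have "b' \<notin> perp \<Gamma> {p, y}" "b' \<in> perp \<Gamma> {p, y'}" using mem y y' bp by auto
    then have "perp \<Gamma> {p, y} \<noteq> perp \<Gamma> {p, y'}" by blast
    moreover have "a \<in> perp \<Gamma> {p, y}" "a \<in> perp \<Gamma> {p, y'}" using mem y y' ap by auto
    ultimately show ?thesis using y y' blocks by blast
  qed
  show "dual_net_blocks \<Gamma> p \<noteq> {}" using two[of a] a ap pts by auto
  fix B assume "B \<in> dual_net_blocks \<Gamma> p"
  then obtain y where y: "y \<in> Points \<Gamma>" "\<not> y \<sim> p" "B = perp \<Gamma> {p, y}" by (auto simp: blocks)
  obtain M1 M2 M3 where Ms: "distinct [M1, M2, M3]" "Inc \<Gamma> p M1" "Inc \<Gamma> p M2" "Inc \<Gamma> p M3"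
    using thick_point[OF P] by blast
  obtain x1 x2 x3 where xs: "Inc \<Gamma> x1 M1" "y \<sim> x1" "Inc \<Gamma> x2 M2" "y \<sim> x2" "Inc \<Gamma> x3 M3" "y \<sim> x3"
    using projection[OF y(1)] Inc_carrier Ms by metis
  have ne: "x1 \<noteq> p" "x2 \<noteq> p" "x3 \<noteq> p" using xs y by metis+
  have "distinct [x1, x2, x3]"
    using linear[of x1 p M1 M2] linear[of x1 p M1 M3] linear[of x2 p M2 M3] Ms xs ne by auto
  moreover have "{x1, x2, x3} \<subseteq> B"
    using xs Ms y mem[OF y(1)] on_line_adj adj_commute by (metis empty_subsetI insert_subset)
  ultimately show "\<exists>a b c. distinct [a, b, c] \<and> {a, b, c} \<subseteq> B" by blast
qed

lemma dual_affine:
  assumes p: "p \<in> \<O>"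
  shows "dual_affine_plane (dual_net_points \<Gamma> p) (dual_net_blocks \<Gamma> p)"
  unfolding dual_affine_plane_def
proof (intro conjI ballI impI)
  show "dual_net (dual_net_points \<Gamma> p) (dual_net_blocks \<Gamma> p)" by (rule dual_net[OF p])
  fix B C assume BC: "B \<in> dual_net_blocks \<Gamma> p" "C \<in> dual_net_blocks \<Gamma> p"
  then obtain y y' where y: "y \<in> Points \<Gamma>" "B = perp \<Gamma> {p, y}" "y' \<in> Points \<Gamma>" "C = perp \<Gamma> {p, y'}"
    by (auto simp: dual_net_blocks_iff[OF p])
  obtain a where "a \<sim> p" "a \<sim> y" "a \<sim> y'" using meet[OF p y(1,3)] by metis
  then have "a \<in> B \<inter> C" using y mem_perp_pair[OF good_point[OF p]] by auto
  then show "B \<inter> C \<noteq> {}" by blast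
qed

text \<open>Vertical lines are the lines through \<open>p\<close> with \<open>p\<close> removed;
  collinearity is transitive there because there are no triangles.\<close>

lemma vertical_lineD:
  assumes p: "p \<in> \<O>" and V: "V \<in> vertical_lines (dual_net_points \<Gamma> p) (dual_net_blocks \<Gamma> p)"
  shows "a \<in> V \<Longrightarrow> a \<in> dual_net_points \<Gamma> p"
    and "a \<in> V \<Longrightarrow> b \<in> dual_net_points \<Gamma> p \<Longrightarrow> b \<in> V \<longleftrightarrow> a \<sim> b"
proof -
  let ?X = "dual_net_points \<Gamma> p" and ?B = "dual_net_blocks \<Gamma> p"
  obtain x where x: "x \<in> ?X" "V = {(a, b). a \<in> ?X \<and> b \<in> ?X \<and> (a = b \<or> parallel ?B a b)} `` {x}"
    using V by (auto simp: vertical_lines_def quotient_def)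
  have mV: "a \<in> V \<longleftrightarrow> a \<in> ?X \<and> x \<sim> a" for a
    using x joined_iff[OF p x(1), of a] adj_refl[of x] mem_dual_net_points[OF p] adj_points
    by (auto simp: parallel_def)
  then show aX: "a \<in> V \<Longrightarrow> a \<in> ?X" for a by blast
  have "a \<sim> b" if "a \<sim> c" "b \<sim> c" "a \<in> ?X" "b \<in> ?X" "c \<in> ?X" for a b c
    using no_triangle[of p c a b] that mem_dual_net_points[OF p] adj_commute by metis
  note trans = this
  assume a: "a \<in> V" and b: "b \<in> ?X"
  have ax: "a \<in> ?X" "x \<sim> a" "a \<sim> x" using a mV adj_commute by auto
  show "b \<in> V \<longleftrightarrow> a \<sim> b"
  proof
    assume "b \<in> V"
    then have "b \<sim> x" using mV adj_commute by auto
    then show "a \<sim> b" using trans[OF ax(3) _ ax(1) b x(1)] by blast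
  next
    assume "a \<sim> b"
    then have "b \<sim> a" by (simp add: adj_commute)
    then show "b \<in> V" using trans[OF ax(2) _ x(1) b ax(1)] b mV by blast
  qed
qed

lemma dual_net_LD:
  assumes p: "p \<in> \<O>"
  shows "LD (dual_net_points \<Gamma> p) (dual_net_blocks \<Gamma> p)"
  unfolding LD_def
proof (intro allI ballI impI)
  let ?X = "dual_net_points \<Gamma> p" and ?B = "dual_net_blocks \<Gamma> p"
  have P: "p \<in> Points \<Gamma>" using p good_point by blast
  note mem = mem_perp_pair[OF P] and blocks = dual_net_blocks_iff[OF p] and pts = mem_dual_net_points[OF p]
  fix A1 A2 A3 a1 a2 a3 B1 B2 B3 b1 b2 b3 V
  assume V: "V \<in> vertical_lines ?X ?B"
    and tA: "triangle ?B A1 A2 A3 a1 a2 a3" and tB: "triangle ?B B1 B2 B3 b1 b2 b3"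
    and persp: "in_perspective_from_infinity ?X ?B a1 a2 a3 b1 b2 b3"
    and "A1 \<inter> B1 \<inter> V \<noteq> {}" "A2 \<inter> B2 \<inter> V \<noteq> {}"
  then obtain i1 i2 where i: "i1 \<in> A1" "i1 \<in> B1" "i1 \<in> V" "i2 \<in> A2" "i2 \<in> B2" "i2 \<in> V" by blast
  obtain V1 V2 V3 where Vs: "V1 \<in> vertical_lines ?X ?B" "V2 \<in> vertical_lines ?X ?B"
    "V3 \<in> vertical_lines ?X ?B" "distinct [V1, V2, V3]" "a1 \<in> V1" "b1 \<in> V1" "a2 \<in> V2" "b2 \<in> V2"
    "a3 \<in> V3" "b3 \<in> V3" "a1 \<noteq> b1" "a2 \<noteq> b2" "a3 \<noteq> b3"
    using persp by (auto simp: in_perspective_from_infinity_def)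
  note D = vertical_lineD[OF p]
  have X: "a1 \<in> ?X" "a2 \<in> ?X" "a3 \<in> ?X" "b1 \<in> ?X" "b2 \<in> ?X" "b3 \<in> ?X" using D(1) Vs by blast+
  have vp: "vertical_pair p a1 b1" "vertical_pair p a2 b2" "vertical_pair p a3 b3"
    using X Vs D(2)[OF Vs(1) Vs(5) X(4)] D(2)[OF Vs(2) Vs(7) X(5)] D(2)[OF Vs(3) Vs(9) X(6)] pts
    by (auto simp: vertical_pair_def)
  have apart: "\<not> a \<sim> b" if W: "W \<in> vertical_lines ?X ?B" "W' \<in> vertical_lines ?X ?B" "W \<noteq> W'" "a \<in> W" "b \<in> W'"
    for W W' a b
  proof
    assume ab: "a \<sim> b"
    have "c \<in> W \<longleftrightarrow> c \<in> W'" for c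
    proof (cases "c \<in> ?X")
      case True
      have "b \<in> W" using ab D(2)[OF W(1,4) D(1)[OF W(2,5)]] by simp
      then show ?thesis using D(2)[OF W(1) _ True] D(2)[OF W(2,5) True] by blast
    qed (use D(1) W in blast)
    then show False using W by blast
  qed
  \<comment> \<open>In the order 2, 3, 1 the sides \<open>A1\<close> and \<open>A2\<close> become
    the two whose meeting points are given on the axis, and \<open>A3\<close> becomes the
    third.\<close>
  have "frame p a2 a3 a1 b2 b3 b1"
    unfolding frame_def using p vp Vs apart by auto
  moreover have not_collinear: "\<not> on_block p c2 c3 c1"
    if t: "triangle ?B C1 C2 C3 c1 c2 c3" and c: "c1 \<in> ?X" "c2 \<in> ?X" "c3 \<in> ?X" for C1 C2 C3 c1 c2 c3
  proof
    assume on: "on_block p c2 c3 c1"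
    obtain y where y: "y \<in> Points \<Gamma>" "C1 = perp \<Gamma> {p, y}" using t by (auto simp: triangle_def blocks)
    have "C2 \<inter> C3 = {c1}" "C3 \<inter> C1 = {c2}" and meets: "C1 \<inter> C2 = {c3}" and ne: "c1 \<noteq> c3" "c2 \<noteq> c3"
      using t by (simp_all add: triangle_def)
    then have C: "c2 \<in> C1" "c3 \<in> C1" "c1 \<in> C2" "C1 \<inter> C2 = {c3}" "c1 \<noteq> c3" "c2 \<noteq> c3"
      by blast+
    have "y \<sim> c1"
      using on_block_adj[OF p _ _ C(6) on] C y mem[OF y(1)] adj_commute by metis
    then have "c1 \<in> C1" using y mem[OF y(1)] c pts adj_commute by metis
    then show False using C by blast
  qed
  ultimately have closes: "closes p a2 a3 a1 b2 b3 b1"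
    using little_desargues not_collinear[OF tA X(1-3)] not_collinear[OF tB X(4-6)] by blast
  have on: "on_block p a b i" if C: "C \<in> ?B" "a \<in> C" "b \<in> C" "i \<in> C" for C a b i
  proof -
    obtain y where y: "y \<in> Points \<Gamma>" "\<not> y \<sim> p" "C = perp \<Gamma> {p, y}" using C(1) by (auto simp: blocks)
    have "y \<noteq> p" using y adj_refl by blast
    moreover have "i \<sim> p" "a \<sim> y" "b \<sim> y" "i \<sim> y" using C(2-4) mem[OF y(1)] y(3) by auto
    ultimately show ?thesis unfolding on_block_def using adj_commute by metis
  qed
  have T: "A1 \<in> ?B" "A2 \<in> ?B" "A3 \<in> ?B" "a2 \<in> A1" "a3 \<in> A1" "a1 \<in> A2" "a3 \<in> A2" "a1 \<in> A3" "a2 \<in> A3"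
    "B1 \<in> ?B" "B2 \<in> ?B" "B3 \<in> ?B" "b2 \<in> B1" "b3 \<in> B1" "b1 \<in> B2" "b3 \<in> B2" "b1 \<in> B3" "b2 \<in> B3"
  proof -
    have "A2 \<inter> A3 = {a1}" "A3 \<inter> A1 = {a2}" "A1 \<inter> A2 = {a3}" "B2 \<inter> B3 = {b1}" "B3 \<inter> B1 = {b2}"
      "B1 \<inter> B2 = {b3}"
      using tA tB by (simp_all add: triangle_def)
    then show "a2 \<in> A1" "a3 \<in> A1" "a1 \<in> A2" "a3 \<in> A2" "a1 \<in> A3" "a2 \<in> A3"
      "b2 \<in> B1" "b3 \<in> B1" "b1 \<in> B2" "b3 \<in> B2" "b1 \<in> B3" "b2 \<in> B3" by blast+
    show "A1 \<in> ?B" "A2 \<in> ?B" "A3 \<in> ?B" "B1 \<in> ?B" "B2 \<in> ?B" "B3 \<in> ?B"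
      using tA tB by (simp_all add: triangle_def)
  qed
  have "A3 \<inter> B3 \<noteq> {}"
  proof (cases "A3 = B3")
    case False
    then show ?thesis using T(3,12) dual_affine[OF p] unfolding dual_affine_plane_def by blast
  qed (use T(8) in blast)
  then obtain i3 where i3: "i3 \<in> A3" "i3 \<in> B3" by blast
  have iX: "i1 \<in> ?X" "i2 \<in> ?X" "i3 \<in> ?X"
    using D(1)[OF V i(3)] D(1)[OF V i(6)] i3(1) T(3)
      conjunct1[OF dual_net[OF p, unfolded dual_net_def]] by blast+
  \<comment> \<open>The axis is the line through \<open>p\<close> that extends
    \<open>V\<close>.\<close>
  obtain L where L: "Inc \<Gamma> p L" "Inc \<Gamma> i1 L" using iX(1) pts line_through by (metis adj_commute)
  have "i2 \<sim> i1" using D(2)[OF V i(6) iX(1)] i by simp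
  then have "Inc \<Gamma> i2 L" using on_lineI[of p L i1 i2] L iX pts by metis
  then have "Inc \<Gamma> i3 L"
    using closes on[OF T(1) T(4,5) i(1)] on[OF T(10) T(13,14) i(2)] on[OF T(2) T(7,6) i(4)]
      on[OF T(11) T(16,15) i(5)] on[OF T(3) T(9,8) i3(1)] on[OF T(12) T(18,17) i3(2)] L
    unfolding closes_def by blast
  then have "i3 \<in> V" using D(2)[OF V i(3) iX(3)] L on_line_adj by blast
  then show "A3 \<inter> B3 \<inter> V \<noteq> {}" using i3 by blast
qed

section \<open>Elations of perp-planes and their duals\<close>

lemma block_through_center:
  assumes p: "p \<in> \<O>" and B: "B \<in> perp_plane_blocks \<Gamma> p" "p \<in> B"
  obtains M where "Inc \<Gamma> p M" "B = {x. Inc \<Gamma> x M}"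
proof -
  obtain y where y: "y \<in> Points \<Gamma>" "y \<noteq> p" "B = perp \<Gamma> {p, y}"
    using B(1) by (auto simp: perp_plane_blocks_iff)
  have mem: "x \<in> B \<longleftrightarrow> x \<sim> p \<and> x \<sim> y" for x
    using mem_perp_pair[OF good_point[OF p] y(1)] y(3) by simp
  then obtain M where M: "Inc \<Gamma> p M" "Inc \<Gamma> y M" using B(2) line_through by metis
  have "x \<in> B \<longleftrightarrow> Inc \<Gamma> x M" for x
    using mem on_lineI[of p M y x] M y(2) on_line_adj by blast
  then show ?thesis using that M by blast
qed

lemma perp_plane_three_points:
  assumes p: "p \<in> \<O>" and B: "B \<in> perp_plane_blocks \<Gamma> p"
  shows "\<exists>x y z. distinct [x, y, z] \<and> {x, y, z} \<subseteq> B"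
proof (cases "p \<in> B")
  case True
  then obtain M where M: "Inc \<Gamma> p M" "B = {x. Inc \<Gamma> x M}" by (rule block_through_center[OF p B])
  then show ?thesis using thick_line[of M] Inc_carrier by blast
next
  case False
  then have "B \<in> dual_net_blocks \<Gamma> p"
    using B mem_perp_pair[OF good_point[OF p]] adj_refl[OF good_point[OF p]] adj_commute
    by (auto simp: perp_plane_blocks_iff dual_net_blocks_iff[OF p])
  moreover have "\<forall>B\<in>dual_net_blocks \<Gamma> p. \<exists>a b c. distinct [a, b, c] \<and> {a, b, c} \<subseteq> B"
    using dual_net[OF p] by (simp add: dual_net_def)
  ultimately show ?thesis by blast
qed

lemma perp_plane_thick:
  assumes "p \<in> \<O>"
  shows "thick_plane (perp_plane_points \<Gamma> p) (perp_plane_blocks \<Gamma> p)"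
  using perp_plane_projective perp_plane_three_points assms by unfold_locales

text \<open>The blocks through \<open>p\<close> are lines of the quadrangle, so
  \<open>flag_closes\<close> is \<open>little_desargues\<close> translated from collinearity to
  blocks.\<close>

lemma perp_plane_flag:
  assumes p: "p \<in> \<O>" and L: "L \<in> perp_plane_blocks \<Gamma> p" "p \<in> L"
  shows "little_desargues_flag (perp_plane_points \<Gamma> p) (perp_plane_blocks \<Gamma> p) p L"
proof -
  let ?X = "perp_plane_points \<Gamma> p" and ?B = "perp_plane_blocks \<Gamma> p"
  have P: "p \<in> Points \<Gamma>" using p good_point by blast
  interpret thick_plane ?X ?B by (rule perp_plane_thick[OF p])
  have pts: "a \<in> ?X \<longleftrightarrow> a \<sim> p" for a using mem_pperp[OF P] by (simp add: perp_plane_points_def)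
  obtain M where M: "Inc \<Gamma> p M" "L = {x. Inc \<Gamma> x M}" by (rule block_through_center[OF p L])
  have center_adj: "a \<sim> b" if V: "V \<in> ?B" "p \<in> V" "a \<in> V" "b \<in> V" for V a b
  proof -
    obtain N where "V = {x. Inc \<Gamma> x N}" by (rule block_through_center[OF p V(1,2)])
    then show ?thesis using V(3,4) on_line_adj by auto
  qed
  show ?thesis
  proof unfold_locales
    show "L \<in> ?B" "p \<in> L" by fact+
    show "\<exists>x\<in>?X. x \<notin> L \<and> \<not> (\<exists>V\<in>?B. p \<in> V \<and> a \<in> V \<and> x \<in> V)" if a: "a \<in> ?X" "a \<notin> L" for a
    proof -
      have ap: "a \<sim> p" "a \<noteq> p" using a pts L by auto
      obtain N b where b: "Inc \<Gamma> p N" "Inc \<Gamma> b N" "b \<noteq> p" "\<not> a \<sim> b" "N \<noteq> M"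
        using other_direction[OF ap] by metis
      have "b \<sim> p" using b on_line_adj by blast
      moreover have "b \<notin> L" using linear[of b p M N] b M by blast
      moreover have "\<not> (\<exists>V\<in>?B. p \<in> V \<and> a \<in> V \<and> b \<in> V)" using center_adj[of _ a b] b(4) by blast
      ultimately show ?thesis using pts by blast
    qed
    fix V1 V2 V3 a1 b1 a2 b2 a3 b3 A12 A23 A13 B12 B23 B13 i12 i23 i13
    assume V: "V1 \<in> ?B" "V2 \<in> ?B" "V3 \<in> ?B" "distinct [L, V1, V2, V3]" "p \<in> V1" "p \<in> V2" "p \<in> V3"
      and ab: "{a1, b1} \<subseteq> V1 - {p}" "{a2, b2} \<subseteq> V2 - {p}" "{a3, b3} \<subseteq> V3 - {p}"
        "a1 \<noteq> b1" "a2 \<noteq> b2" "a3 \<noteq> b3"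
      and blocks: "{A12, A23, A13, B12, B23, B13} \<subseteq> ?B"
      and proper: "\<not> (\<exists>B\<in>?B. {a1, a2, a3} \<subseteq> B)" "\<not> (\<exists>B\<in>?B. {b1, b2, b3} \<subseteq> B)"
      and i: "{a1, a2, i12} \<subseteq> A12" "{b1, b2, i12} \<subseteq> B12" "{a2, a3, i23} \<subseteq> A23" "{b2, b3, i23} \<subseteq> B23"
        "{a1, a3, i13} \<subseteq> A13" "{b1, b3, i13} \<subseteq> B13" "i12 \<in> L" "i23 \<in> L"
    have vp: "vertical_pair p a b" if "{a, b} \<subseteq> V - {p}" "a \<noteq> b" "V \<in> ?B" "p \<in> V" for a b V
      using that center_adj[OF that(3,4)] by (auto simp: vertical_pair_def)
    have apart: "\<not> a \<sim> b"
      if W: "W \<in> ?B" "W' \<in> ?B" "W \<noteq> W'" "p \<in> W" "p \<in> W'" "a \<in> W - {p}" "b \<in> W' - {p}" for W W' a b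
    proof
      assume ab: "a \<sim> b"
      obtain N where N: "Inc \<Gamma> p N" "W = {x. Inc \<Gamma> x N}" by (rule block_through_center[OF p W(1,4)])
      have "b \<sim> p" using center_adj[OF W(2,5)] W by blast
      then have "b \<in> W" using on_lineI[of p N a b] N W ab adj_commute by auto
      then show False using block_eq[OF W(1,2), of p b] W by blast
    qed
    have frame: "frame p a1 a2 a3 b1 b2 b3"
    proof -
      have "V1 \<noteq> V2" "V1 \<noteq> V3" "V2 \<noteq> V3" using V(4) by simp_all
      note apart12 = apart[OF V(1,2) this(1) V(5,6)] and apart13 = apart[OF V(1,3) this(2) V(5,7)]
        and apart23 = apart[OF V(2,3) this(3) V(6,7)]
      have "a1 \<in> V1 - {p}" "b1 \<in> V1 - {p}" "a2 \<in> V2 - {p}" "b2 \<in> V2 - {p}" "a3 \<in> V3 - {p}" "b3 \<in> V3 - {p}"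
        using ab by blast+
      then show ?thesis
        unfolding frame_def using p vp[OF ab(1,4) V(1,5)] vp[OF ab(2,5) V(2,6)] vp[OF ab(3,6) V(3,7)]
          apart12 apart13 apart23 by simp
    qed
    have not_on: "\<not> on_block p c1 c2 c3"
      if c: "\<not> (\<exists>B\<in>?B. {c1, c2, c3} \<subseteq> B)" "c1 \<sim> p" "c2 \<sim> p" for c1 c2 c3
    proof
      assume "on_block p c1 c2 c3"
      then obtain u where u: "c3 \<sim> p" "u \<noteq> p" "u \<sim> c1" "u \<sim> c2" "u \<sim> c3" by (auto simp: on_block_def)
      have uP: "u \<in> Points \<Gamma>" using u adj_points by blast
      have "{c1, c2, c3} \<subseteq> perp \<Gamma> {p, u}" using u c(2,3) mem_perp_pair[OF P uP] by (auto simp: adj_commute)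
      moreover have "perp \<Gamma> {p, u} \<in> ?B" using uP u by (auto simp: perp_plane_blocks_iff)
      ultimately show False using c(1) by blast
    qed
    have closes: "closes p a1 a2 a3 b1 b2 b3"
      using little_desargues[OF frame not_on[OF proper(1)] not_on[OF proper(2)]] frameD[OF frame] by simp
    have on: "on_block p a b i" if C: "{a, b, i} \<subseteq> C" "C \<in> ?B" for a b i C
    proof -
      obtain y where y: "y \<in> Points \<Gamma>" "y \<noteq> p" "C = perp \<Gamma> {p, y}"
        using C(2) by (auto simp: perp_plane_blocks_iff)
      then have "i \<sim> p" "a \<sim> y" "b \<sim> y" "i \<sim> y" using C(1) mem_perp_pair[OF P y(1)] by auto
      then show ?thesis unfolding on_block_def using y(2) adj_commute by metis
    qed
    have "Inc \<Gamma> i13 M"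
      using closes[unfolded closes_def, rule_format, OF M(1) _ _ on[OF i(1)] on[OF i(2)] on[OF i(3)]
          on[OF i(4)] on[OF i(5)] on[OF i(6)]] i(7,8) M(2) blocks by simp
    then show "i13 \<in> L" using M(2) by simp
  qed
qed

lemma perp_plane_flag_transitive:
  assumes "p \<in> \<O>" "L \<in> perp_plane_blocks \<Gamma> p" "p \<in> L"
  shows "center_axis_transitive (perp_plane_points \<Gamma> p) (perp_plane_blocks \<Gamma> p) p L"
  using little_desargues_flag.flag_transitive[OF perp_plane_flag[OF assms]] .

text \<open>This identifies \<open>q\<^sup>\<bottom>\<close> with the lines of the perp-plane of
  \<open>p\<close>. A point collinear with \<open>q\<close> and two points of \<open>K\<close>
  represents \<open>K\<close>; two representatives would force \<open>p \<sim> q\<close> by the grid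
  rule.\<close>

lemma block_representative:
  assumes p: "p \<in> \<O>" and q: "q \<in> Points \<Gamma>" "\<not> p \<sim> q" and K: "K \<in> perp_plane_blocks \<Gamma> p"
  shows "\<exists>!u. u \<sim> q \<and> perp \<Gamma> {p, u} = K"
proof -
  have P: "p \<in> Points \<Gamma>" using p good_point by blast
  obtain y where y: "y \<in> Points \<Gamma>" "y \<noteq> p" "K = perp \<Gamma> {p, y}"
    using K by (auto simp: perp_plane_blocks_iff)
  obtain x z where xz: "x \<noteq> z" "x \<in> K" "z \<in> K" using perp_plane_three_points[OF p K] by auto
  then have adj: "x \<sim> p" "x \<sim> y" "z \<sim> p" "z \<sim> y" using mem_perp_pair[OF P y(1)] y(3) by auto
  obtain u where u: "u \<sim> x" "u \<sim> z" "u \<sim> q"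
    using meet_line[OF p xz(1) _ _ q(1)] adj adj_commute by metis
  have uP: "u \<in> Points \<Gamma>" "u \<noteq> p" using u q adj_points by blast+
  have "perp \<Gamma> {p, u} = K"
    using block_eqI[OF p uP(1) y(1) uP(2) y(2) xz(1)] mem_perp_pair[OF P uP(1)] xz y(3) u adj adj_commute
    by metis
  moreover have "v = u" if v: "v \<sim> q" "perp \<Gamma> {p, v} = K" for v
  proof (rule ccontr)
    assume "v \<noteq> u"
    have vP: "v \<in> Points \<Gamma>" using v adj_points by blast
    have "v \<sim> x" "v \<sim> z" using v xz mem_perp_pair[OF P vP] adj_commute by metis+
    then have "p \<sim> q"
      by (intro grid_last[of p u v x z q])
         (use p u v adj xz \<open>v \<noteq> u\<close> in \<open>auto simp: adj_commute\<close>)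
    then show False using q by simp
  qed
  ultimately show ?thesis using u by blast
qed

text \<open>Under \<open>u \<mapsto> {p, u}\<^sup>\<bottom>\<close>, points collinear with
  \<open>p\<close> become lines through \<open>p\<close>, and \<open>c\<close> becomes the line
  \<open>{p, c}\<^sup>\<bottom>\<close>. An elation with centre \<open>p\<close> and this axis thus
  yields one with axis \<open>{q, p}\<^sup>\<bottom>\<close> and centre \<open>c\<close>.\<close>

lemma dual_translation_line:
  assumes p: "p \<in> \<O>" and q: "q \<in> \<O>" and pq: "\<not> p \<sim> q"
  shows "translation_line (perp_plane_points \<Gamma> q) (perp_plane_blocks \<Gamma> q) (perp \<Gamma> {q, p})"
  unfolding translation_line_def center_axis_transitive_def
proof (intro ballI impI)
  let ?X = "perp_plane_points \<Gamma> p" and ?B = "perp_plane_blocks \<Gamma> p"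
    and ?Y = "perp_plane_points \<Gamma> q" and ?C = "perp_plane_blocks \<Gamma> q"
  let ?A = "perp \<Gamma> {q, p}"
  have P: "p \<in> Points \<Gamma>" and Q: "q \<in> Points \<Gamma>" using p q good_point by blast+
  have qp: "\<not> q \<sim> p" using pq adj_commute by metis
  interpret thick_plane ?X ?B by (rule perp_plane_thick[OF p])
  have X: "a \<in> ?X \<longleftrightarrow> a \<sim> p" for a using mem_pperp[OF P] by (simp add: perp_plane_points_def)
  have Y: "a \<in> ?Y \<longleftrightarrow> a \<sim> q" for a using mem_pperp[OF Q] by (simp add: perp_plane_points_def)
  have memp: "z \<in> perp \<Gamma> {p, u} \<longleftrightarrow> z \<sim> p \<and> z \<sim> u" if "u \<sim> w" for z u w
    using mem_perp_pair[OF P adj_points(1)[OF that]] .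
  have memq: "z \<in> perp \<Gamma> {q, u} \<longleftrightarrow> z \<sim> q \<and> z \<sim> u" if "u \<sim> w" for z u w
    using mem_perp_pair[OF Q adj_points(1)[OF that]] .
  have Bp: "perp \<Gamma> {p, u} \<in> ?B" if "u \<sim> q" for u
    using adj_points(1)[OF that] that pq by (auto simp: perp_plane_blocks_iff)
  have Cq: "perp \<Gamma> {q, z} \<in> ?C" if "z \<sim> p" for z
    using adj_points(1)[OF that] that qp by (auto simp: perp_plane_blocks_iff)
  have repp: "\<exists>!u. u \<sim> q \<and> perp \<Gamma> {p, u} = K" if "K \<in> ?B" for K
    by (rule block_representative[OF p Q pq that])
  have rep_inj: "u = v" if "u \<sim> q" "v \<sim> q" "perp \<Gamma> {p, u} = perp \<Gamma> {p, v}" for u v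
    using repp[OF Bp[OF that(2)]] that by (elim ex1E) metis
  have repq: "\<exists>!z. z \<sim> p \<and> perp \<Gamma> {q, z} = K" if "K \<in> ?C" for K
    by (rule block_representative[OF q P qp that])
  have pp: "p \<sim> p" using adj_refl[OF P] .
  have memA: "z \<in> ?A \<longleftrightarrow> z \<sim> q \<and> z \<sim> p" for z using memq[OF pp] .
  fix c B a b
  assume c: "c \<in> ?A" and B: "B \<in> ?C" "a \<in> B" "b \<in> B" "c \<in> B" "B \<noteq> ?A"
    and off: "a \<notin> insert c ?A" "b \<notin> insert c ?A"
  have cq: "c \<sim> q" "c \<sim> p" using c memA by auto
  obtain z where z: "z \<sim> p" "perp \<Gamma> {q, z} = B" using repq[OF B(1)] by blast
  have az: "a \<sim> q" "a \<sim> z" "b \<sim> q" "b \<sim> z" "c \<sim> z" using B memq[OF z(1)] z(2) by auto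
  have nap: "\<not> a \<sim> p" "\<not> b \<sim> p" using off az memA by auto
  let ?L = "perp \<Gamma> {p, c}" and ?a = "perp \<Gamma> {p, a}" and ?b = "perp \<Gamma> {p, b}"
  have L: "?L \<in> ?B" "p \<in> ?L" using Bp[OF cq(1)] memp[OF cq(1)] cq pp adj_commute by auto
  have zL: "z \<in> ?L" using memp[OF cq(1)] z az adj_commute by auto
  have ab: "?a \<in> ?B" "?b \<in> ?B" "z \<in> ?a" "z \<in> ?b" "p \<notin> ?a" "p \<notin> ?b"
    using Bp[OF az(1)] Bp[OF az(3)] memp[OF az(1)] memp[OF az(3)] z az nap adj_commute by auto
  \<comment> \<open>The lines of \<open>a\<close> and \<open>b\<close> meet in the point
    \<open>z\<close> of the axis, so mapping a single further point \<open>x\<close> of the first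
    into the second suffices.\<close>
  obtain x0 y0 where "x0 \<in> ?a" "y0 \<in> ?a" "x0 \<noteq> y0" using three_points[OF ab(1)] by auto
  then obtain x where x: "x \<in> ?a" "x \<noteq> z" by blast
  have aL: "?a \<noteq> ?L" using L(2) ab(5) by blast
  have xL: "x \<notin> ?L" using block_eq[OF ab(1) L(1) ab(3) x(1) zL] x(2) aL by blast
  have xp: "x \<noteq> p" using x ab by blast
  obtain V where V: "V \<in> ?B" "p \<in> V" "x \<in> V"
    by (rule join[OF block_subset[OF L] block_subset[OF ab(1) x(1)] xp[symmetric]])
  have "V \<noteq> ?b" using V ab by blast
  then obtain x' where x': "x' \<in> V" "x' \<in> ?b" by (rule meet_blocks[OF V(1) ab(2)])
  have x'p: "x' \<noteq> p" using x' ab by blast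
  have VL: "V \<noteq> ?L" using V xL by blast
  have x'L: "x' \<notin> ?L" using block_eq[OF V(1) L(1) V(2) x'(1) L(2)] x'p VL by blast
  obtain f where f: "central_collineation ?X ?B p ?L f" "f x = x'"
    using center_axis_transitiveD[OF perp_plane_flag_transitive[OF p L] V(1,3) x'(1) V(2) VL] xL x'L xp x'p
    by blast
  have fX: "bij_betw f ?X ?X" and fB: "bij_betw ((`) f) ?B ?B"
    and fL: "\<And>x. x \<in> ?L \<Longrightarrow> f x = x" and fc: "\<And>B. B \<in> ?B \<Longrightarrow> p \<in> B \<Longrightarrow> f ` B = B"
    using f(1) by (auto simp: central_collineation_def collineation_def)
  have fK: "f ` K \<in> ?B" if "K \<in> ?B" for K using fB that by (auto simp: bij_betw_def)
  have "z \<in> f ` ?a" "x' \<in> f ` ?a" using imageI[OF ab(3), of f] imageI[OF x(1), of f] fL[OF zL] f(2) by simp_all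
  moreover have "z \<noteq> x'" using zL x'L by blast
  ultimately have fab: "f ` ?a = ?b" using block_eq[OF fK[OF ab(1)] ab(2)] ab(4) x'(2) by blast
  define g where "g u = (THE v. v \<sim> q \<and> perp \<Gamma> {p, v} = f ` perp \<Gamma> {p, u})" for u
  have g: "g u \<sim> q \<and> perp \<Gamma> {p, g u} = f ` perp \<Gamma> {p, u}" if "u \<sim> q" for u
    unfolding g_def by (rule theI'[OF repp[OF fK[OF Bp[OF that]]]])
  have g_eq: "g u = v" if "u \<sim> q" "v \<sim> q" "perp \<Gamma> {p, v} = f ` perp \<Gamma> {p, u}" for u v
    using rep_inj[of "g u" v] g[OF that(1)] that(2,3) by simp
  \<comment> \<open>Preserved incidence makes \<open>g\<close> act on the blocks of \<open>q\<close>
    as \<open>f\<close> acts on the points representing them.\<close>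
  have key: "z \<sim> u \<longleftrightarrow> f z \<sim> g u" if zu: "z \<sim> p" "u \<sim> q" for z u
  proof -
    have fz: "f z \<sim> p" using fX zu X by (auto simp: bij_betw_def)
    have sub: "perp \<Gamma> {p, u} \<subseteq> ?X" using block_subset[OF Bp[OF zu(2)]] by blast
    have "inj_on f ?X" using fX by (simp add: bij_betw_def)
    then have "f z \<in> f ` perp \<Gamma> {p, u} \<longleftrightarrow> z \<in> perp \<Gamma> {p, u}"
      using inj_on_image_mem_iff[of f ?X z "perp \<Gamma> {p, u}"] sub zu X by blast
    then show ?thesis using g[OF zu(2)] memp[of "g u" q] memp[of u q] zu fz by auto
  qed
  have gY: "bij_betw g ?Y ?Y"
    unfolding bij_betw_def
  proof
    show "inj_on g ?Y"
    proof (rule inj_onI)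
      fix u v assume uv: "u \<in> ?Y" "v \<in> ?Y" "g u = g v"
      then have uv': "u \<sim> q" "v \<sim> q" using Y by auto
      have "f ` perp \<Gamma> {p, u} = f ` perp \<Gamma> {p, v}" using g[OF uv'(1)] g[OF uv'(2)] uv(3) by simp
      then have "perp \<Gamma> {p, u} = perp \<Gamma> {p, v}"
        by (rule inj_onD[OF bij_betw_imp_inj_on[OF fB] _ Bp[OF uv'(1)] Bp[OF uv'(2)]])
      then show "u = v" using rep_inj uv' by simp
    qed
    show "g ` ?Y = ?Y"
    proof
      show "g ` ?Y \<subseteq> ?Y" using g Y by auto
      show "?Y \<subseteq> g ` ?Y"
      proof
        fix v assume "v \<in> ?Y"
        then have v: "v \<sim> q" using Y by simp
        then obtain K where K: "K \<in> ?B" "perp \<Gamma> {p, v} = f ` K"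
          using fB Bp[OF v] unfolding bij_betw_def by blast
        obtain u where u: "u \<sim> q" "perp \<Gamma> {p, u} = K" using repp[OF K(1)] by blast
        then have "g u = v" using g_eq v K by blast
        then show "v \<in> g ` ?Y" using u Y by blast
      qed
    qed
  qed
  have gimg: "g ` perp \<Gamma> {q, z} = perp \<Gamma> {q, f z}" if z: "z \<sim> p" for z
  proof -
    have fz: "f z \<sim> p" using fX z X by (auto simp: bij_betw_def)
    have gm: "g u \<in> perp \<Gamma> {q, f z} \<longleftrightarrow> u \<in> perp \<Gamma> {q, z}" if u: "u \<sim> q" for u
      using key[OF z u] g[OF u] memq[OF fz, of "g u"] memq[OF z, of u] u
        adj_commute[of z u] adj_commute[of "f z" "g u"] by simp
    have "v \<in> g ` perp \<Gamma> {q, z}" if v: "v \<in> perp \<Gamma> {q, f z}" for v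
    proof -
      have "v \<in> g ` ?Y" using v memq[OF fz] Y gY by (simp add: bij_betw_def)
      then obtain u where "u \<sim> q" "v = g u" using Y by blast
      then show ?thesis using gm v by blast
    qed
    moreover have "g u \<in> perp \<Gamma> {q, f z}" if "u \<in> perp \<Gamma> {q, z}" for u
      using gm[of u] that memq[OF z] by simp
    ultimately show ?thesis by blast
  qed
  have gC: "bij_betw ((`) g) ?C ?C"
    unfolding bij_betw_def
  proof
    have "?C \<subseteq> Pow ?Y" using perp_plane_projective[OF q] by (auto simp: projective_plane_def)
    then show "inj_on ((`) g) ?C"
      using inj_on_image_Pow[OF bij_betw_imp_inj_on[OF gY]] inj_on_subset by blast
    show "(`) g ` ?C = ?C"
    proof
      show "(`) g ` ?C \<subseteq> ?C"
      proof
        fix K' assume "K' \<in> (`) g ` ?C"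
        then obtain K where K: "K \<in> ?C" "K' = g ` K" by blast
        obtain z where z: "z \<sim> p" "perp \<Gamma> {q, z} = K" using repq[OF K(1)] by blast
        have "f z \<sim> p" using fX z X by (auto simp: bij_betw_def)
        then show "K' \<in> ?C" using K z gimg[OF z(1)] Cq by simp
      qed
      show "?C \<subseteq> (`) g ` ?C"
      proof
        fix K assume K: "K \<in> ?C"
        obtain w where w: "w \<sim> p" "perp \<Gamma> {q, w} = K" using repq[OF K] by blast
        have "w \<in> f ` ?X" using fX w X by (simp add: bij_betw_def)
        then obtain z where z: "z \<sim> p" "w = f z" using X by blast
        then have "g ` perp \<Gamma> {q, z} = K" using gimg[OF z(1)] w by simp
        then show "K \<in> (`) g ` ?C" using Cq[OF z(1)] by blast
      qed
    qed
  qed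
  have "central_collineation ?Y ?C c ?A g"
    unfolding central_collineation_def collineation_def
  proof (intro conjI gY gC ballI impI)
    fix u assume "u \<in> ?A"
    then have u: "u \<sim> q" "u \<sim> p" using memA by auto
    have "f ` perp \<Gamma> {p, u} = perp \<Gamma> {p, u}"
      using fc[OF Bp[OF u(1)]] memp[OF u(1)] u pp adj_commute by auto
    then show "g u = u" using g_eq[OF u(1) u(1)] by simp
  next
    fix K assume K: "K \<in> ?C" "c \<in> K"
    obtain w where w: "w \<sim> p" "perp \<Gamma> {q, w} = K" using repq[OF K(1)] by blast
    then have "w \<in> ?L" using memp[OF cq(1)] memq[OF w(1)] K(2) adj_commute by auto
    then show "g ` K = K" using gimg[OF w(1)] fL w(2) by simp
  qed
  moreover have "g a = b" using g_eq[OF az(1,3)] fab by simp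
  ultimately show "\<exists>f. central_collineation ?Y ?C c ?A f \<and> f a = b" by blast
qed

lemma perp_plane_moufang:
  assumes q: "q \<in> \<O>"
  shows "moufang_plane (perp_plane_points \<Gamma> q) (perp_plane_blocks \<Gamma> q)"
proof -
  let ?Y = "perp_plane_points \<Gamma> q" and ?C = "perp_plane_blocks \<Gamma> q"
  have Q: "q \<in> Points \<Gamma>" using q good_point by blast
  interpret thick_plane ?Y ?C by (rule perp_plane_thick[OF q])
  have dual: "B \<in> ?C \<and> q \<notin> B" if B: "B \<in> dual_net_blocks \<Gamma> q" for B
  proof -
    obtain y where y: "y \<in> Points \<Gamma>" "\<not> y \<sim> q" "B = perp \<Gamma> {q, y}"
      using B by (auto simp: dual_net_blocks_iff[OF q])
    then have "y \<noteq> q" "q \<notin> B"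
      using mem_perp_pair[OF Q y(1), of q] adj_refl[OF Q] adj_commute[of y q] by auto
    then show ?thesis using y by (auto simp: perp_plane_blocks_iff)
  qed
  have "dual_net_blocks \<Gamma> q \<noteq> {}" using dual_net[OF q] by (simp add: dual_net_def)
  then obtain M where M: "M \<in> ?C" "q \<notin> M" using dual by blast
  have "translation_line ?Y ?C A" if A: "A \<in> ?C" "q \<notin> A" for A
  proof -
    obtain y where y: "y \<in> Points \<Gamma>" "y \<noteq> q" "A = perp \<Gamma> {q, y}"
      using A(1) by (auto simp: perp_plane_blocks_iff)
    obtain x z where xz: "x \<in> A" "z \<in> A" "x \<noteq> z" using three_points[OF A(1)] by auto
    then have adj: "x \<sim> q" "x \<sim> y" "z \<sim> q" "z \<sim> y" using mem_perp_pair[OF Q y(1)] y(3) by auto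
    have "\<not> y \<sim> q" using A(2) y mem_perp_pair[OF Q y(1)] adj_refl[OF Q] adj_commute by auto
    then have "\<not> x \<sim> z" using off_line_of_center[of x q z y] adj xz Q adj_commute by metis
    \<comment> \<open>A point of \<open>\<O>\<close> opposite \<open>q\<close> and collinear with
      two points of \<open>A\<close> represents \<open>A\<close>, which brings
      \<open>dual_translation_line\<close> into play.\<close>
    then obtain p where p: "p \<in> \<O>" "\<not> p \<sim> q" "p \<sim> x" "p \<sim> z" by (rule good_opposite[OF q adj(1,3)])
    have P: "p \<in> Points \<Gamma>" "p \<noteq> q" using p good_point adj_refl by blast+
    have "perp \<Gamma> {q, p} = A"
      using block_eqI[OF q P(1) y(1) P(2) y(2) xz(3)] mem_perp_pair[OF Q P(1)] xz(1,2) y(3) p adj adj_commute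
      by auto
    then show ?thesis using dual_translation_line[OF p(1) q p(2)] by simp
  qed
  moreover have "q \<in> ?Y" using mem_pperp[OF Q] adj_refl[OF Q] by (simp add: perp_plane_points_def)
  ultimately show ?thesis using moufang_if_translation_lines_off_point[OF _ M] by blast
qed

end

theorem theorem3:
  fixes \<Gamma> :: "('p, 'l) geometry" and \<O> :: "'p set"
  assumes "generalized_quadrangle \<Gamma>"
    and "\<forall>p\<in>\<O>. regular_point \<Gamma> p"
    and "PP \<Gamma> \<O>"
    and "TP \<Gamma> \<O>"
  shows "(\<forall>p\<in>\<O>. projective_point \<Gamma> p) \<and>
    (\<forall>p\<in>\<O>. moufang_plane (perp_plane_points \<Gamma> p) (perp_plane_blocks \<Gamma> p)) \<and>
    (\<forall>p\<in>\<O>. LD (dual_net_points \<Gamma> p) (dual_net_blocks \<Gamma> p))"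
proof -
  interpret generalized_quadrangle \<Gamma> by fact
  have grids: "completes_grids p" if "p \<in> \<O>" for p
    using assms(2) that regular_completes_grids by blast
  \<comment> \<open>If \<open>p\<close> were the only such point, the intersection in (TP) would be
    the singleton \<open>{p}\<close>.\<close>
  have second: "\<exists>q\<in>\<O>. q \<noteq> p \<and> collinear \<Gamma> q x \<and> collinear \<Gamma> q y"
    if p: "p \<in> \<O>" "collinear \<Gamma> p x" "collinear \<Gamma> p y" "\<not> collinear \<Gamma> x y" for p x y
  proof (rule ccontr)
    assume none: "\<not> ?thesis"
    have xy: "x \<in> Points \<Gamma>" "y \<in> Points \<Gamma>" using p adj_points by blast+
    have "card (perp \<Gamma> {x, y} \<inter> \<O>) \<noteq> 1" using assms(4) xy p(4) by (simp add: TP_def opposite_iff)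
    moreover have "perp \<Gamma> {x, y} \<inter> \<O> = {p}" using none p mem_perp_pair[OF xy] by auto
    ultimately show False by simp
  qed
  obtain p0 where p0: "p0 \<in> \<O>" "meets_all p0"
    using assms(3) projective_meets_all by (auto simp: PP_def)
  \<comment> \<open>The transfer works between opposite points, so a point collinear with
    \<open>p0\<close> is reached in two steps, through a point opposite both.\<close>
  have meets: "meets_all q" if q: "q \<in> \<O>" for q
  proof (cases "collinear \<Gamma> q p0 \<and> q \<noteq> p0")
    case True
    then obtain r where r: "r \<in> \<O>" "\<not> collinear \<Gamma> r p0" "\<not> collinear \<Gamma> r q"
      using good_opposite_both[of p0 \<O> q] p0 grids second by blast
    have "meets_all r"
      using meets_all_transfer[OF grids[OF p0(1)] p0(2) grids[OF r(1)]] r(2) adj_commute by metis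
    then show ?thesis using meets_all_transfer[OF grids[OF r(1)] _ grids[OF q]] r(3) by blast
  next
    case False
    then show ?thesis
      using meets_all_transfer[OF grids[OF p0(1)] p0(2) grids[OF q]] p0(2) adj_commute by metis
  qed
  interpret quadrangle_with_good_points \<Gamma> \<O>
    using grids meets second by unfold_locales
  show ?thesis
    using assms(2) dual_affine perp_plane_moufang dual_net_LD by (simp add: projective_point_def)
qed

end
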